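(* Let $(\Omega,\mathcal{F},\mathbb{P})$ be a complete probability space, let $X_1,X_2,W,R$ be real, reflexive, separable Banach spaces, and let the data $C_1,C_2,K,J_1,J_2,e,i$ satisfy the Basic Assumption stated in the context. Suppose the relatively complete recourse condition $C_1\subset\tilde{C}_1$ is satisfied and that problem $(\mathrm{P})$ is strictly feasible, i.e., $0\in\mathrm{int}\,\mathrm{dom}\,v$. Then $$\inf\mathrm{P}=\max\mathrm{D}<\infty,$$ meaning that the dual problem $(\mathrm{D})$ attains its maximum, and the maximal value coincides with the infimum of the primal problem $(\mathrm{P})$, which need not be attained.
   Context: Basic Assumption. $C_1\subset X_1$ and $C_2\subset X_2$ are nonempty, closed, convex sets and $K\subset R$ is a nonempty, closed, convex cone. $J(x_1,x_2)=J_1(x_1)+J_2(x_1,x_2)$ is convex on $X_1\times X_2$ and everywhere defined and finite; for every $r>0$ there is $a_r>0$ such that $|J_2(x_1,x_2)|\le a_r$ whenever $\|x_1\|_{X_1}+\|x_2\|_{X_2}\le r$. The maps $e:X_1\times X_2\times\Omega\to W$ and $i:X_1\times X_2\times\Omega\to R$ are such that $e(x_1,x_2,\omega)$ is continuous and linear in $(x_1,x_2)$, $i(x_1,x_2,\omega)$ is continuous and $K$-convex in $(x_1,x_2)$, both are measurable (in $\omega$), and for every $r>0$ there are $b_{r,e},b_{r,i}>0$ such that $\|e(x_1,x_2,\omega)\|_W\le b_{r,e}$ and $\|i(x_1,x_2,\omega)\|_R\le b_{r,i}$ a.s. whenever $\|x_1\|_{X_1}+\|x_2\|_{X_2}\le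 r$. Here $r\le_K 0$ means $-r\in K$ (and $r\le_K r'$ means $r'-r\in K$), and $K$-convexity of $i(\cdot,\cdot,\omega)$ means $i(\lambda x_1+(1-\lambda)\hat{x}_1,\lambda x_2+(1-\lambda)\hat{x}_2,\omega)\le_K\lambda i(x_1,x_2,\omega)+(1-\lambda)i(\hat{x}_1,\hat{x}_2,\omega)$ for all $(x_1,x_2),(\hat{x}_1,\hat{x}_2)\in X_1\times X_2$ and $\lambda\in(0,1)$. Spaces. $X:=X_1\times L^\infty(\Omega,X_2)$, $U:=L^\infty(\Omega,W)\times L^\infty(\Omega,R)$, $\Lambda:=L^1(\Omega,W^* )\times L^1(\Omega,R^* )$ (Bochner spaces), paired by $\langle u,\lambda\rangle_{U,\Lambda}:=\int_\Omega\langle u_e(\omega),\lambda_e(\omega)\rangle_{W,W^*}+\langle u_i(\omega),\lambda_i(\omega)\rangle_{R,R^*}\,d\mathbb{P}(\omega)$ for $u=(u_e,u_i)$, $\lambda=(\lambda_e,\lambda_i)$. Primal problem $(\mathrm{P})$: minimize $j(x):=J_1(x_1)+\mathbb{E}[J_2(x_1,x_2(\cdot))]$ over $x=(x_1,x_2)\in X$ subject to $x_1\in C_1$ and, almost surely, $x_2(\omega)\in C_2$, $e(x_1,x_2(\omega),\omega)=0$, $i(x_1,x_2(\omega),\omega)\le_K0$. Perturbed objective: $\varphi(x,u):=j(x)$ if $x_1\in C_1$ and almost surely $x_2(\omega)\in C_2$, $e(x_1,x_2(\omega),\omega)=u_e(\omega)$, $i(x_1,x_2(\omega),\omega)\le_K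 u_i(\omega)$; $\varphi(x,u):=\infty$ otherwise. Value function: $v(u):=\inf_{x\in X}\varphi(x,u)$ for $u\in U$, so $v(0)=\inf\mathrm{P}$; $\mathrm{dom}\,v=\{u\in U:v(u)<\infty\}$. Induced feasible set: $\tilde{C}_1:=\{x_1\in X_1:\exists\,x_2\in L^\infty(\Omega,X_2)\text{ s.t. } e(x_1,x_2(\omega),\omega)=0,\ i(x_1,x_2(\omega),\omega)\le_K0,\ x_2(\omega)\in C_2\text{ a.s.}\}$. Generalized Lagrangian: $L(x,\lambda):=\inf_{u\in U}\{\langle u,\lambda\rangle_{U,\Lambda}+\varphi(x,u)\}$ on $X\times\Lambda$. Dual problem $(\mathrm{D})$: maximize $g(\lambda):=\inf_{x\in X}L(x,\lambda)$ over $\lambda\in\Lambda$. *)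

theory Defs
  imports "HOL-Probability.Probability"
begin

text \<open>Banach spaces are types of class \<open>banach\<close>; class \<open>second_countable_topology\<close> is the
  library's rendering of separability of a metric space. The dual of \<open>'b\<close> is the type
  \<open>'b \<Rightarrow>\<^sub>L real\<close> with the operator norm.\<close>

text \<open>Surjectivity of the canonical embedding into the bidual. The argument is only a type token.\<close>
definition reflexive_space :: "'b::real_normed_vector itself \<Rightarrow> bool"
  where "reflexive_space _ \<longleftrightarrow>
    (\<forall>F :: ('b \<Rightarrow>\<^sub>L real) \<Rightarrow>\<^sub>L real. \<exists>x::'b. \<forall>f. blinfun_apply F f = blinfun_apply f x)"

section \<open>Bochner spaces\<close>

text \<open>Elements of Bochner spaces are represented by functions. Nothing below distinguishes
  functions that agree almost everywhere.\<close>

text \<open>Usable for \<open>'b \<Rightarrow>\<^sub>L real\<close>, which has no \<open>second_countable_topology\<close> instance, so that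
  the library's \<open>integrable\<close> does not apply.\<close>
definition strongly_measurable :: "'a measure \<Rightarrow> ('a \<Rightarrow> 'b::real_normed_vector) \<Rightarrow> bool"
  where "strongly_measurable M f \<longleftrightarrow>
    (\<exists>s. (\<forall>n. simple_function M (s n)) \<and> (AE w in M. (\<lambda>n::nat. s n w) \<longlonglongrightarrow> f w))"

definition bochner_L1 :: "'a measure \<Rightarrow> ('a \<Rightarrow> 'b::real_normed_vector) set"
  where "bochner_L1 M = {f. strongly_measurable M f \<and> integrable M (\<lambda>w. norm (f w))}"

definition Linf_norm :: "'a measure \<Rightarrow> ('a \<Rightarrow> 'b::real_normed_vector) \<Rightarrow> ereal"
  where "Linf_norm M f = esssup M (\<lambda>w. ereal (norm (f w)))"

text \<open>For separable values, Borel measurability is strong measurability.\<close>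
definition bochner_Linf ::
  "'a measure \<Rightarrow> ('a \<Rightarrow> 'b::{real_normed_vector, second_countable_topology}) set"
  where "bochner_Linf M = {f \<in> borel_measurable M. Linf_norm M f < \<infinity>}"

section \<open>Spaces and pairing\<close>

definition X_space :: "'a measure \<Rightarrow>
    ('x1::{banach, second_countable_topology} \<times> ('a \<Rightarrow> 'x2::{banach, second_countable_topology})) set"
  where "X_space M = UNIV \<times> bochner_Linf M"

definition U_space :: "'a measure \<Rightarrow>
    (('a \<Rightarrow> 'w::{banach, second_countable_topology}) \<times> ('a \<Rightarrow> 'r::{banach, second_countable_topology})) set"
  where "U_space M = bochner_Linf M \<times> bochner_Linf M"

definition Lambda_space :: "'a measure \<Rightarrow>
    (('a \<Rightarrow> ('w::banach \<Rightarrow>\<^sub>L real)) \<times> ('a \<Rightarrow> ('r::banach \<Rightarrow>\<^sub>L real))) set"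
  where "Lambda_space M = bochner_L1 M \<times> bochner_L1 M"

definition U_pairing :: "'a measure \<Rightarrow> ('a \<Rightarrow> 'w::banach) \<times> ('a \<Rightarrow> 'r::banach) \<Rightarrow>
    ('a \<Rightarrow> ('w \<Rightarrow>\<^sub>L real)) \<times> ('a \<Rightarrow> ('r \<Rightarrow>\<^sub>L real)) \<Rightarrow> real"
  where "U_pairing M u l =
    (\<integral>w. blinfun_apply (fst l w) (fst u w) + blinfun_apply (snd l w) (snd u w) \<partial>M)"

definition U_dist :: "'a measure \<Rightarrow> ('a \<Rightarrow> 'w::banach) \<times> ('a \<Rightarrow> 'r::banach) \<Rightarrow>
    ('a \<Rightarrow> 'w) \<times> ('a \<Rightarrow> 'r) \<Rightarrow> ereal"
  where "U_dist M u u' =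
    Linf_norm M (\<lambda>w. fst u' w - fst u w) + Linf_norm M (\<lambda>w. snd u' w - snd u w)"

text \<open>The norm topology of \<open>U\<close>.\<close>
definition U_topology :: "'a measure \<Rightarrow>
    (('a \<Rightarrow> 'w::{banach, second_countable_topology}) \<times> ('a \<Rightarrow> 'r::{banach, second_countable_topology})) topology"
  where "U_topology M = topology (\<lambda>S. S \<subseteq> U_space M \<and>
    (\<forall>u\<in>S. \<exists>\<epsilon>>0. \<forall>u'\<in>U_space M. U_dist M u u' < ereal \<epsilon> \<longrightarrow> u' \<in> S))"

lemma openin_U_topology:
  fixes M :: "'a measure"
    and S :: "(('a \<Rightarrow> 'w::{banach, second_countable_topology}) \<times> ('a \<Rightarrow> 'r::{banach, second_countable_topology})) set"
  shows "openin (U_topology M) S \<longleftrightarrow> S \<subseteq> U_space M \<and>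
    (\<forall>u\<in>S. \<exists>\<epsilon>>0. \<forall>u'\<in>U_space M. U_dist M u u' < ereal \<epsilon> \<longrightarrow> u' \<in> S)"
proof -
  have "istopology (\<lambda>S :: (('a \<Rightarrow> 'w) \<times> ('a \<Rightarrow> 'r)) set. S \<subseteq> U_space M \<and>
      (\<forall>u\<in>S. \<exists>\<epsilon>>0. \<forall>u'\<in>U_space M. U_dist M u u' < ereal \<epsilon> \<longrightarrow> u' \<in> S))"
    unfolding istopology_def
  proof (intro conjI allI impI; (elim conjE)?)
    fix S T :: "(('a \<Rightarrow> 'w) \<times> ('a \<Rightarrow> 'r)) set"
    assume S: "S \<subseteq> U_space M"
        "\<forall>u\<in>S. \<exists>\<epsilon>>0. \<forall>u'\<in>U_space M. U_dist M u u' < ereal \<epsilon> \<longrightarrow> u' \<in> S"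
      and T: "T \<subseteq> U_space M"
        "\<forall>u\<in>T. \<exists>\<epsilon>>0. \<forall>u'\<in>U_space M. U_dist M u u' < ereal \<epsilon> \<longrightarrow> u' \<in> T"
    show "S \<inter> T \<subseteq> U_space M" using S by blast
    show "\<forall>u\<in>S \<inter> T. \<exists>\<epsilon>>0. \<forall>u'\<in>U_space M. U_dist M u u' < ereal \<epsilon> \<longrightarrow> u' \<in> S \<inter> T"
    proof
      fix u assume "u \<in> S \<inter> T"
      then obtain d1 d2 where "d1 > 0" "d2 > 0"
        and "\<forall>u'\<in>U_space M. U_dist M u u' < ereal d1 \<longrightarrow> u' \<in> S"
        and "\<forall>u'\<in>U_space M. U_dist M u u' < ereal d2 \<longrightarrow> u' \<in> T"
        using S(2) T(2) by blast
      moreover have "ereal (min d1 d2) \<le> ereal d1" "ereal (min d1 d2) \<le> ereal d2" "min d1 d2 > 0"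
        using \<open>d1 > 0\<close> \<open>d2 > 0\<close> by simp_all
      ultimately show "\<exists>\<epsilon>>0. \<forall>u'\<in>U_space M. U_dist M u u' < ereal \<epsilon> \<longrightarrow> u' \<in> S \<inter> T"
        by (meson IntI order.strict_trans2)
    qed
  next
    fix \<K> :: "(('a \<Rightarrow> 'w) \<times> ('a \<Rightarrow> 'r)) set set" assume K: "\<forall>S\<in>\<K>. S \<subseteq> U_space M \<and>
      (\<forall>u\<in>S. \<exists>\<epsilon>>0. \<forall>u'\<in>U_space M. U_dist M u u' < ereal \<epsilon> \<longrightarrow> u' \<in> S)"
    show "\<Union>\<K> \<subseteq> U_space M" using K by blast
    show "\<forall>u\<in>\<Union>\<K>. \<exists>\<epsilon>>0. \<forall>u'\<in>U_space M. U_dist M u u' < ereal \<epsilon> \<longrightarrow> u' \<in> \<Union>\<K>"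
      using K by (meson UnionE UnionI)
  qed
  then show ?thesis
    by (simp add: U_topology_def topology_inverse')
qed

lemma topspace_U_topology:
  fixes M :: "'a measure"
  shows "topspace (U_topology M) = (U_space M :: (('a \<Rightarrow> 'w::{banach, second_countable_topology}) \<times> ('a \<Rightarrow> 'r::{banach, second_countable_topology})) set)"
proof -
  have "openin (U_topology M) (U_space M :: (('a \<Rightarrow> 'w) \<times> ('a \<Rightarrow> 'r)) set)"
    unfolding openin_U_topology by (auto intro: exI[of _ 1])
  moreover have "topspace (U_topology M) \<subseteq> (U_space M :: (('a \<Rightarrow> 'w) \<times> ('a \<Rightarrow> 'r)) set)"
    using openin_topspace[of "U_topology M"] unfolding openin_U_topology by blast
  ultimately show ?thesis
    by (simp add: openin_subset subset_antisym)
qed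

section \<open>The problem\<close>

definition cone_le :: "'r::real_vector set \<Rightarrow> 'r \<Rightarrow> 'r \<Rightarrow> bool"
  where "cone_le K r r' \<longleftrightarrow> r' - r \<in> K"

definition K_convex :: "'r::real_vector set \<Rightarrow> ('x1::real_vector \<Rightarrow> 'x2::real_vector \<Rightarrow> 'r) \<Rightarrow> bool"
  where "K_convex K h \<longleftrightarrow> (\<forall>x1 x2 y1 y2. \<forall>t\<in>{0<..<1::real}.
    cone_le K (h (t *\<^sub>R x1 + (1 - t) *\<^sub>R y1) (t *\<^sub>R x2 + (1 - t) *\<^sub>R y2))
      (t *\<^sub>R h x1 x2 + (1 - t) *\<^sub>R h y1 y2))"

context
  fixes M :: "'a measure"
    and C1 :: "'x1::{banach, second_countable_topology} set"
    and C2 :: "'x2::{banach, second_countable_topology} set"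
    and K :: "'r::{banach, second_countable_topology} set"
    and J1 :: "'x1 \<Rightarrow> real"
    and J2 :: "'x1 \<Rightarrow> 'x2 \<Rightarrow> real"
    and e :: "'x1 \<Rightarrow> 'x2 \<Rightarrow> 'a \<Rightarrow> 'w::{banach, second_countable_topology}"
    and i :: "'x1 \<Rightarrow> 'x2 \<Rightarrow> 'a \<Rightarrow> 'r"
begin

definition basic_assumption :: bool
  where "basic_assumption \<longleftrightarrow>
    C1 \<noteq> {} \<and> closed C1 \<and> convex C1 \<and>
    C2 \<noteq> {} \<and> closed C2 \<and> convex C2 \<and>
    closed K \<and> convex_cone K \<and>
    convex_on UNIV (\<lambda>(x1, x2). J1 x1 + J2 x1 x2) \<and>
    (\<forall>r>0. \<exists>a>0. \<forall>x1 x2. norm x1 + norm x2 \<le> r \<longrightarrow> \<bar>J2 x1 x2\<bar> \<le> a) \<and>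
    (\<forall>w\<in>space M. bounded_linear (\<lambda>(x1, x2). e x1 x2 w)) \<and>
    (\<forall>w\<in>space M. continuous_on UNIV (\<lambda>(x1, x2). i x1 x2 w) \<and> K_convex K (\<lambda>x1 x2. i x1 x2 w)) \<and>
    (\<forall>x1 x2. (\<lambda>w. e x1 x2 w) \<in> borel_measurable M) \<and>
    (\<forall>x1 x2. (\<lambda>w. i x1 x2 w) \<in> borel_measurable M) \<and>
    (\<forall>r>0. \<exists>b>0. \<forall>x1 x2. norm x1 + norm x2 \<le> r \<longrightarrow> (AE w in M. norm (e x1 x2 w) \<le> b)) \<and>
    (\<forall>r>0. \<exists>b>0. \<forall>x1 x2. norm x1 + norm x2 \<le> r \<longrightarrow> (AE w in M. norm (i x1 x2 w) \<le> b))"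

definition objective :: "'x1 \<times> ('a \<Rightarrow> 'x2) \<Rightarrow> real"
  where "objective x = J1 (fst x) + (\<integral>w. J2 (fst x) (snd x w) \<partial>M)"

definition feasible_set :: "('x1 \<times> ('a \<Rightarrow> 'x2)) set"
  where "feasible_set = {(x1, x2) \<in> X_space M. x1 \<in> C1 \<and>
    (AE w in M. x2 w \<in> C2 \<and> e x1 (x2 w) w = 0 \<and> cone_le K (i x1 (x2 w) w) 0)}"

definition inf_P :: ereal
  where "inf_P = (INF x\<in>feasible_set. ereal (objective x))"

definition perturbed_objective ::
    "'x1 \<times> ('a \<Rightarrow> 'x2) \<Rightarrow> ('a \<Rightarrow> 'w) \<times> ('a \<Rightarrow> 'r) \<Rightarrow> ereal"
  where "perturbed_objective x u =
    (if fst x \<in> C1 \<and>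
        (AE w in M. snd x w \<in> C2 \<and> e (fst x) (snd x w) w = fst u w \<and>
          cone_le K (i (fst x) (snd x w) w) (snd u w))
     then ereal (objective x) else \<infinity>)"

definition value_function :: "('a \<Rightarrow> 'w) \<times> ('a \<Rightarrow> 'r) \<Rightarrow> ereal"
  where "value_function u = (INF x\<in>X_space M. perturbed_objective x u)"

definition value_domain :: "(('a \<Rightarrow> 'w) \<times> ('a \<Rightarrow> 'r)) set"
  where "value_domain = {u \<in> U_space M. value_function u < \<infinity>}"

definition strictly_feasible :: bool
  where "strictly_feasible \<longleftrightarrow> ((\<lambda>_. 0), (\<lambda>_. 0)) \<in> U_topology M interior_of value_domain"

definition induced_feasible_set :: "'x1 set"
  where "induced_feasible_set = {x1. \<exists>x2\<in>bochner_Linf M. AE w in M.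
    e x1 (x2 w) w = 0 \<and> cone_le K (i x1 (x2 w) w) 0 \<and> x2 w \<in> C2}"

definition lagrangian :: "'x1 \<times> ('a \<Rightarrow> 'x2) \<Rightarrow>
    ('a \<Rightarrow> ('w \<Rightarrow>\<^sub>L real)) \<times> ('a \<Rightarrow> ('r \<Rightarrow>\<^sub>L real)) \<Rightarrow> ereal"
  where "lagrangian x l =
    (INF u\<in>U_space M. ereal (U_pairing M u l) + perturbed_objective x u)"

definition dual_objective ::
    "('a \<Rightarrow> ('w \<Rightarrow>\<^sub>L real)) \<times> ('a \<Rightarrow> ('r \<Rightarrow>\<^sub>L real)) \<Rightarrow> ereal"
  where "dual_objective l = (INF x\<in>X_space M. lagrangian x l)"

end

end

theory Submission
  imports Defs
begin

text \<open>
  Since \<open>0\<close> is interior to the domain of the convex value function \<open>v\<close>, the Hahn-Banach theorem gives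
  a linear functional \<open>l\<close> on bounded measurable functions with \<open>l u \<le> v u - v 0\<close>.

  A Baire argument provides a ball of perturbations that are served by decisions \<open>(x1, x2)\<close>, with a
  recourse \<open>y\<close> for \<open>x1\<close>, of uniformly bounded size. If \<open>l\<close> were unbounded on it along \<open>u k\<close>, the dyadic
  mean of the corresponding \<open>x1 k\<close> would be a single first-stage decision that serves every
  \<open>2 ^ - (k + 1) *\<^sub>R u k\<close> at a second-stage cost bounded in \<open>k\<close>: combine the recourses
  \<open>y j\<close> for \<open>j \<noteq> k\<close> with \<open>x2 k\<close>. So \<open>l\<close> is bounded, although \<open>J1\<close> need not be continuous.

  The singular part of \<open>l\<close> lives on sets \<open>F n\<close> of vanishing probability. Replacing \<open>x2\<close> by a recourse
  for \<open>x1\<close> on \<open>F n\<close> turns a decision for \<open>u\<close> into one for \<open>u\<close> cut to the complement of \<open>F n\<close>, with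
  almost the same cost; hence the absolutely continuous part of \<open>l\<close> still minorizes \<open>v - v 0\<close>. By the
  Radon-Nikodym theorem, and because the duals of \<open>W\<close> and \<open>R\<close> are separable, it is given by an
  integrable density, whose negative solves the dual problem.
\<close>

section \<open>The Hahn-Banach theorem\<close>

text \<open>Two obstacles shape the argument. First, boundedness of \<open>l\<close> would normally
  follow from an upper bound of \<open>v\<close> near 0, but bounded decisions need not have bounded
  costs: \<open>J1\<close> may be unbounded on bounded sets of an infinite-dimensional space, and
  only \<open>J2\<close> is controlled. Costs are therefore compared at one fixed first stage. The
  dyadic mean allows this because its first-stage terms \<open>x1 j\<close> are the same for every
  k; only the second stage in position k switches from recourse to decision, and choosing
  \<open>l (u k)\<close> above k times 2^(k+1) beats the weight of that position. Second, bounded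
  functions with values in an infinite-dimensional space need not be uniform limits of simple
  functions, so continuity of a functional does not determine it by its values on simple functions.
  Variation is therefore taken over all bounded measurable functions, and absolute continuity
  supplies the convergence along bounded pointwise limits on which the integral representation
  rests.\<close>

definition function_subspace :: "('a \<Rightarrow> 'z::real_vector) set \<Rightarrow> bool"
  where "function_subspace S \<longleftrightarrow> (\<lambda>_. 0) \<in> S \<and>
    (\<forall>f\<in>S. \<forall>g\<in>S. (\<lambda>w. f w + g w) \<in> S) \<and> (\<forall>f\<in>S. \<forall>t. (\<lambda>w. t *\<^sub>R f w) \<in> S)"

definition sublinear_on :: "('a \<Rightarrow> 'z::real_vector) set \<Rightarrow> (('a \<Rightarrow> 'z) \<Rightarrow> real) \<Rightarrow> bool"
  where "sublinear_on S q \<longleftrightarrow>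
    (\<forall>f\<in>S. \<forall>g\<in>S. q (\<lambda>w. f w + g w) \<le> q f + q g) \<and>
    (\<forall>f\<in>S. \<forall>t\<ge>0. q (\<lambda>w. t *\<^sub>R f w) = t * q f)"

definition linear_functional_on :: "('a \<Rightarrow> 'z::real_vector) set \<Rightarrow> (('a \<Rightarrow> 'z) \<Rightarrow> real) \<Rightarrow> bool"
  where "linear_functional_on S l \<longleftrightarrow>
    (\<forall>f\<in>S. \<forall>g\<in>S. l (\<lambda>w. f w + g w) = l f + l g) \<and>
    (\<forall>f\<in>S. \<forall>t. l (\<lambda>w. t *\<^sub>R f w) = t * l f)"

lemma function_subspaceD:
  assumes S: "function_subspace S"
  shows "f \<in> S \<Longrightarrow> g \<in> S \<Longrightarrow> (\<lambda>w. f w + g w) \<in> S"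
    and "f \<in> S \<Longrightarrow> (\<lambda>w. t *\<^sub>R f w) \<in> S"
    and "f \<in> S \<Longrightarrow> (\<lambda>w. - f w) \<in> S"
proof -
  show scl: "f \<in> S \<Longrightarrow> (\<lambda>w. t *\<^sub>R f w) \<in> S" for f t
    using S by (auto simp: function_subspace_def)
  show "f \<in> S \<Longrightarrow> g \<in> S \<Longrightarrow> (\<lambda>w. f w + g w) \<in> S"
    using S by (auto simp: function_subspace_def)
  show "f \<in> S \<Longrightarrow> (\<lambda>w. - f w) \<in> S"
    using scl[of f "-1"] by simp
qed

lemma sublinear_onD:
  assumes "sublinear_on S q" "f \<in> S"
  shows "g \<in> S \<Longrightarrow> q (\<lambda>w. f w + g w) \<le> q f + q g"
    and "t \<ge> 0 \<Longrightarrow> q (\<lambda>w. t *\<^sub>R f w) = t * q f"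
  using assms by (auto simp: sublinear_on_def)

lemma sublinear_on_zero: "sublinear_on S q \<Longrightarrow> f \<in> S \<Longrightarrow> q (\<lambda>_. 0) = 0"
  using sublinear_onD(2)[of S q f 0] by simp

lemma sublinear_on_minus_ge:
  assumes "function_subspace S" "sublinear_on S q" "f \<in> S"
  shows "- q (\<lambda>w. - f w) \<le> q f"
proof -
  note m = function_subspaceD(3)[OF assms(1,3)]
  have "q (\<lambda>w. f w + - f w) \<le> q f + q (\<lambda>w. - f w)"
    using sublinear_onD(1)[OF assms(2,3) m] .
  then show ?thesis
    using sublinear_on_zero[OF assms(2,3)] by simp
qed

text \<open>The largest sublinear minorant of \<open>q\<close> that is linear along \<open>a\<close> and agrees with \<open>q\<close> there.\<close>
definition sublinear_shift :: "(('a \<Rightarrow> 'z::real_vector) \<Rightarrow> real) \<Rightarrow> ('a \<Rightarrow> 'z) \<Rightarrow> ('a \<Rightarrow> 'z) \<Rightarrow> real"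
  where "sublinear_shift q a f = (INF t\<in>{0..}. q (\<lambda>w. f w + t *\<^sub>R a w) - t * q a)"

text \<open>The expression under the infimum is sublinear jointly in \<open>f\<close> and
  \<open>t\<close>, so minimizing over \<open>t \<ge> 0\<close> leaves a sublinear functional. If
  \<open>q\<close> is minimal, the shift equals \<open>q\<close>, and the second claim then makes
  \<open>q\<close> odd at \<open>a\<close>.\<close>

lemma sublinear_shift:
  fixes q :: "('a \<Rightarrow> 'z::real_vector) \<Rightarrow> real"
  assumes S: "function_subspace S" and q: "sublinear_on S q" and a: "a \<in> S"
  shows "f \<in> S \<Longrightarrow> sublinear_shift q a f \<le> q f"
    and "sublinear_shift q a (\<lambda>w. - a w) \<le> - q a"
    and "sublinear_on S (sublinear_shift q a)"
proof -
  note add = function_subspaceD(1)[OF S] and scl = function_subspaceD(2)[OF S] and neg = function_subspaceD(3)[OF S]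
  have ta: "q (\<lambda>w. t *\<^sub>R a w) = t * q a" if "t \<ge> 0" for t
    using sublinear_onD(2)[OF q a that] .
  \<comment> \<open>A lower bound free of \<open>t\<close>: the infimum defining the shift is over a
    set bounded below, hence meaningful in the reals.\<close>
  have lb: "- q (\<lambda>w. - f w) \<le> q (\<lambda>w. f w + t *\<^sub>R a w) - t * q a" if f: "f \<in> S" and t: "t \<ge> 0" for f t
  proof -
    have "q (\<lambda>w. (f w + t *\<^sub>R a w) + - f w) \<le> q (\<lambda>w. f w + t *\<^sub>R a w) + q (\<lambda>w. - f w)"
      by (intro sublinear_onD(1)[OF q] add neg scl f a)
    then show ?thesis using ta[OF t] by simp
  qed
  have bdd: "bdd_below ((\<lambda>t. q (\<lambda>w. f w + t *\<^sub>R a w) - t * q a) ` {0..})" if "f \<in> S" for f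
    using lb[OF that] by (auto intro!: bdd_belowI2)
  have le: "sublinear_shift q a f \<le> q (\<lambda>w. f w + t *\<^sub>R a w) - t * q a" if "f \<in> S" "t \<ge> 0" for f t
    unfolding sublinear_shift_def using that by (intro cINF_lower bdd) auto
  have ge: "c \<le> sublinear_shift q a f" if "\<And>t. t \<ge> 0 \<Longrightarrow> c \<le> q (\<lambda>w. f w + t *\<^sub>R a w) - t * q a" for c f
    unfolding sublinear_shift_def using that by (intro cINF_greatest) auto
  show "f \<in> S \<Longrightarrow> sublinear_shift q a f \<le> q f" for f
    using le[of f 0] by simp
  show "sublinear_shift q a (\<lambda>w. - a w) \<le> - q a"
    using le[OF neg[OF a], of 1] sublinear_on_zero[OF q a] by simp
  show "sublinear_on S (sublinear_shift q a)"
    unfolding sublinear_on_def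
  proof (intro conjI ballI allI impI)
    fix f g assume f: "f \<in> S" and g: "g \<in> S"
    \<comment> \<open>The parameter \<open>s + t\<close> serves \<open>f + g\<close> whenever
      \<open>s\<close> serves \<open>f\<close> and \<open>t\<close> serves \<open>g\<close>; taking
      both infima gives subadditivity.\<close>
    have "sublinear_shift q a (\<lambda>w. f w + g w) - (q (\<lambda>w. g w + t *\<^sub>R a w) - t * q a)
        \<le> q (\<lambda>w. f w + s *\<^sub>R a w) - s * q a" if "s \<ge> 0" "t \<ge> 0" for s t
    proof -
      have "sublinear_shift q a (\<lambda>w. f w + g w)
          \<le> q (\<lambda>w. (f w + g w) + (s + t) *\<^sub>R a w) - (s + t) * q a"
        using that by (intro le add f g) auto
      also have "(\<lambda>w. (f w + g w) + (s + t) *\<^sub>R a w) = (\<lambda>w. (f w + s *\<^sub>R a w) + (g w + t *\<^sub>R a w))"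
        by (auto simp: algebra_simps)
      also have "q \<dots> \<le> q (\<lambda>w. f w + s *\<^sub>R a w) + q (\<lambda>w. g w + t *\<^sub>R a w)"
        by (intro sublinear_onD(1)[OF q] add scl f g a)
      finally show ?thesis by (simp add: algebra_simps)
    qed
    then have h: "sublinear_shift q a (\<lambda>w. f w + g w) - (q (\<lambda>w. g w + t *\<^sub>R a w) - t * q a)
        \<le> sublinear_shift q a f" if "t \<ge> 0" for t
      using that by (intro ge) auto
    have "sublinear_shift q a (\<lambda>w. f w + g w) - sublinear_shift q a f
        \<le> q (\<lambda>w. g w + t *\<^sub>R a w) - t * q a" if "t \<ge> 0" for t
      using h[OF that] by linarith
    then have "sublinear_shift q a (\<lambda>w. f w + g w) - sublinear_shift q a f \<le> sublinear_shift q a g"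
      by (intro ge)
    then show "sublinear_shift q a (\<lambda>w. f w + g w) \<le> sublinear_shift q a f + sublinear_shift q a g"
      by simp
  next
    fix f and t :: real assume f: "f \<in> S" and t: "t \<ge> 0"
    show "sublinear_shift q a (\<lambda>w. t *\<^sub>R f w) = t * sublinear_shift q a f"
    proof (cases "t = 0")
      case True
      have "sublinear_shift q a (\<lambda>w. 0) = 0"
      proof (rule antisym)
        have z: "(\<lambda>_. 0) \<in> S" using S by (simp add: function_subspace_def)
        show "sublinear_shift q a (\<lambda>w. 0) \<le> 0"
          using le[OF z, of 0] sublinear_on_zero[OF q a] by simp
        show "0 \<le> sublinear_shift q a (\<lambda>w. 0)"
          using ta by (intro ge) simp
      qed
      then show ?thesis using True by simp
    next
      case False
      then have tp: "t > 0" using t by simp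
      \<comment> \<open>Scaling the argument by \<open>t\<close> amounts to rescaling the parameter,
        which maps \<open>{0..}\<close> onto itself.\<close>
      have e: "q (\<lambda>w. t *\<^sub>R f w + (t * s) *\<^sub>R a w) - (t * s) * q a
          = t * (q (\<lambda>w. f w + s *\<^sub>R a w) - s * q a)" for s
      proof -
        have "q (\<lambda>w. t *\<^sub>R (f w + s *\<^sub>R a w)) = t * q (\<lambda>w. f w + s *\<^sub>R a w)"
          by (intro sublinear_onD(2)[OF q] add scl f a t)
        then show ?thesis by (simp add: algebra_simps)
      qed
      show ?thesis
      proof (rule antisym)
        have "sublinear_shift q a (\<lambda>w. t *\<^sub>R f w) / t \<le> sublinear_shift q a f"
        proof (rule ge)
          fix s :: real assume "s \<ge> 0"
          then have "sublinear_shift q a (\<lambda>w. t *\<^sub>R f w)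
              \<le> q (\<lambda>w. t *\<^sub>R f w + (t * s) *\<^sub>R a w) - (t * s) * q a"
            using t by (intro le scl f) simp
          then show "sublinear_shift q a (\<lambda>w. t *\<^sub>R f w) / t \<le> q (\<lambda>w. f w + s *\<^sub>R a w) - s * q a"
            unfolding e using tp by (simp add: field_simps)
        qed
        then show "sublinear_shift q a (\<lambda>w. t *\<^sub>R f w) \<le> t * sublinear_shift q a f"
          using tp by (simp add: field_simps)
        show "t * sublinear_shift q a f \<le> sublinear_shift q a (\<lambda>w. t *\<^sub>R f w)"
        proof (rule ge)
          fix s :: real assume "s \<ge> 0"
          then have "sublinear_shift q a f \<le> q (\<lambda>w. f w + (s / t) *\<^sub>R a w) - (s / t) * q a"
            using tp by (intro le f) simp
          then show "t * sublinear_shift q a f \<le> q (\<lambda>w. t *\<^sub>R f w + s *\<^sub>R a w) - s * q a"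
            using e[of "s / t"] tp by simp
        qed
      qed
    qed
  qed
qed

text \<open>Zorn's lemma for the reversed pointwise order. The infimum of a chain is again sublinear
  because two members can be replaced by the smaller one, and it is finite because every member
  dominates \<open>- p (\<lambda>w. - f w)\<close>.\<close>

lemma ex_minimal_sublinear:
  fixes p :: "('a \<Rightarrow> 'z::real_vector) \<Rightarrow> real"
  assumes S: "function_subspace S" and p: "sublinear_on S p"
  shows "\<exists>q. sublinear_on S q \<and> (\<forall>f\<in>S. q f \<le> p f) \<and>
    (\<forall>r. sublinear_on S r \<longrightarrow> (\<forall>f\<in>S. r f \<le> q f) \<longrightarrow> (\<forall>f\<in>S. r f = q f))"
proof -
  \<comment> \<open>Values outside \<open>S\<close> are fixed to be 0, so that the order, which
    compares on \<open>S\<close> only, is antisymmetric.\<close>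
  define A where "A = {q. sublinear_on S q \<and> (\<forall>f\<in>S. q f \<le> p f) \<and> (\<forall>f. f \<notin> S \<longrightarrow> q f = 0)}"
  define P :: "(('a \<Rightarrow> 'z) \<Rightarrow> real) \<Rightarrow> (('a \<Rightarrow> 'z) \<Rightarrow> real) \<Rightarrow> bool"
    where "P q r \<longleftrightarrow> (\<forall>f\<in>S. r f \<le> q f)" for q r
  note add = function_subspaceD(1)[OF S] and scl = function_subspaceD(2)[OF S] and neg = function_subspaceD(3)[OF S]
  have res: "sublinear_on S (\<lambda>f. if f \<in> S then q f else 0)" if "sublinear_on S q" for q
    using that add scl by (simp add: sublinear_on_def)
  have lower: "- p (\<lambda>w. - f w) \<le> q f" if "q \<in> A" "f \<in> S" for q f
  proof -
    have "sublinear_on S q" "q (\<lambda>w. - f w) \<le> p (\<lambda>w. - f w)"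
      using that(1) neg[OF that(2)] by (auto simp: A_def)
    then show ?thesis using sublinear_on_minus_ge[OF S _ that(2), of q] by simp
  qed
  have "\<exists>m\<in>A. \<forall>a\<in>A. P m a \<longrightarrow> a = m"
  proof (rule predicate_Zorn)
    have "q = r" if "q \<in> A" "r \<in> A" "P q r" "P r q" for q r
    proof
      fix f show "q f = r f"
        using that by (cases "f \<in> S") (auto simp: A_def P_def intro: antisym)
    qed
    then show "partial_order_on A (relation_of P A)"
      by (intro partial_order_on_relation_ofI) (auto simp: P_def intro: order_trans)
  next
    fix C assume C: "C \<in> Chains (relation_of P A)"
    have CA: "C \<subseteq> A" and Ct: "\<And>q r. q \<in> C \<Longrightarrow> r \<in> C \<Longrightarrow> P q r \<or> P r q"
      using C by (auto simp: Chains_def relation_of_def)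
    show "\<exists>u\<in>A. \<forall>a\<in>C. P a u"
    proof (cases "C = {}")
      case True
      have "(\<lambda>f. if f \<in> S then p f else 0) \<in> A"
        using res[OF p] by (auto simp: A_def)
      then show ?thesis using True by blast
    next
      case False
      define u where "u f = (if f \<in> S then INF q\<in>C. q f else 0)" for f
      have bdd: "bdd_below ((\<lambda>q. q f) ` C)" if "f \<in> S" for f
        using lower[OF _ that] CA by (intro bdd_belowI2[of _ "- p (\<lambda>w. - f w)"]) blast
      have ule: "u f \<le> q f" if "q \<in> C" "f \<in> S" for q f
        using cINF_lower[OF bdd[OF that(2)] that(1)] that(2) by (simp add: u_def)
      have uge: "c \<le> u f" if "\<And>q. q \<in> C \<Longrightarrow> c \<le> q f" "f \<in> S" for c f
        using cINF_greatest[OF False, of c "\<lambda>q. q f"] that by (simp add: u_def)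
      have sub: "sublinear_on S q" if "q \<in> C" for q
        using CA that by (auto simp: A_def)
      have "sublinear_on S u"
        unfolding sublinear_on_def
      proof (intro conjI ballI allI impI)
        fix f g assume f: "f \<in> S" and g: "g \<in> S"
        have "u (\<lambda>w. f w + g w) - r g \<le> q f" if q: "q \<in> C" and r: "r \<in> C" for q r
        proof -
          \<comment> \<open>\<open>s\<close> is the smaller of \<open>q\<close> and
            \<open>r\<close>; its subadditivity bounds the infimum by
            \<open>q f + r g\<close>.\<close>
          obtain s where s: "s \<in> C" "P q s" "P r s"
            using Ct[OF q r] q r by (auto simp: P_def)
          have "u (\<lambda>w. f w + g w) \<le> s f + s g"
            using ule[OF s(1) add[OF f g]] sublinear_onD(1)[OF sub[OF s(1)] f g] by simp
          then show ?thesis using s f g unfolding P_def by (smt (verit))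
        qed
        then have "u (\<lambda>w. f w + g w) - r g \<le> u f" if "r \<in> C" for r
          using that f by (intro uge) auto
        then have "u (\<lambda>w. f w + g w) - u f \<le> u g"
          using g by (intro uge) (auto simp: algebra_simps)
        then show "u (\<lambda>w. f w + g w) \<le> u f + u g" by simp
      next
        fix f and t :: real assume f: "f \<in> S" and t: "t \<ge> 0"
        have e: "q (\<lambda>w. t *\<^sub>R f w) = t * q f" if "q \<in> C" for q
          using sublinear_onD(2)[OF sub[OF that] f t] .
        show "u (\<lambda>w. t *\<^sub>R f w) = t * u f"
        proof (cases "t = 0")
          case True
          obtain q where "q \<in> C" using False by blast
          have "u (\<lambda>w. t *\<^sub>R f w) \<le> 0"
            using ule[OF \<open>q \<in> C\<close> scl[OF f, of t]] e[OF \<open>q \<in> C\<close>] True by simp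
          moreover have "0 \<le> u (\<lambda>w. t *\<^sub>R f w)"
          proof (rule uge[OF _ scl[OF f]])
            fix r assume "r \<in> C"
            from e[OF this] show "0 \<le> r (\<lambda>w. t *\<^sub>R f w)" using True by simp
          qed
          ultimately show ?thesis using True by simp
        next
          case False
          then have tp: "t > 0" using t by simp
          show ?thesis
          proof (rule antisym)
            have "u (\<lambda>w. t *\<^sub>R f w) / t \<le> u f"
            proof (rule uge[OF _ f])
              fix q assume "q \<in> C"
              then show "u (\<lambda>w. t *\<^sub>R f w) / t \<le> q f"
                using ule[OF _ scl[OF f], of q t] e[of q] tp by (simp add: field_simps)
            qed
            then show "u (\<lambda>w. t *\<^sub>R f w) \<le> t * u f" using tp by (simp add: field_simps)
            show "t * u f \<le> u (\<lambda>w. t *\<^sub>R f w)"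
            proof (rule uge[OF _ scl[OF f]])
              fix q assume "q \<in> C"
              then show "t * u f \<le> q (\<lambda>w. t *\<^sub>R f w)"
                using ule[OF _ f, of q] e[of q] t by (simp add: mult_left_mono)
            qed
          qed
        qed
      qed
      moreover have "\<forall>f\<in>S. u f \<le> p f"
      proof
        fix f assume f: "f \<in> S"
        obtain q where "q \<in> C" using False by blast
        then have "u f \<le> q f" "q f \<le> p f" using ule f CA by (auto simp: A_def)
        then show "u f \<le> p f" by simp
      qed
      ultimately have "u \<in> A" by (auto simp: A_def u_def)
      then show ?thesis using ule by (auto simp: P_def)
    qed
  qed
  then obtain q where q: "q \<in> A" "\<And>a. a \<in> A \<Longrightarrow> P q a \<Longrightarrow> a = q" by blast
  show ?thesis
  proof (intro exI[of _ q] conjI allI impI)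
    show "sublinear_on S q" "\<forall>f\<in>S. q f \<le> p f" using q(1) by (auto simp: A_def)
    fix r assume r: "sublinear_on S r" "\<forall>f\<in>S. r f \<le> q f"
    have "(\<lambda>f. if f \<in> S then r f else 0) \<in> A"
    proof -
      have "r f \<le> p f" if "f \<in> S" for f
        using r(2) q(1) that unfolding A_def by force
      then show ?thesis using res[OF r(1)] by (simp add: A_def)
    qed
    moreover have "P q (\<lambda>f. if f \<in> S then r f else 0)"
      using r(2) by (simp add: P_def)
    ultimately have e: "(\<lambda>f. if f \<in> S then r f else 0) = q" by (rule q(2))
    show "\<forall>f\<in>S. r f = q f"
    proof
      fix f assume "f \<in> S"
      then show "r f = q f" using fun_cong[OF e, of f] by simp
    qed
  qed
qed

text \<open>A minimal sublinear minorant coincides with its own shift along every \<open>a\<close>,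
  which makes it odd; an odd sublinear functional is linear.\<close>

theorem Hahn_Banach_sublinear:
  fixes p :: "('a \<Rightarrow> 'z::real_vector) \<Rightarrow> real"
  assumes S: "function_subspace S" and p: "sublinear_on S p"
  obtains l where "linear_functional_on S l" "\<forall>f\<in>S. l f \<le> p f"
proof -
  obtain q where q: "sublinear_on S q" "\<forall>f\<in>S. q f \<le> p f"
    "\<forall>r. sublinear_on S r \<longrightarrow> (\<forall>f\<in>S. r f \<le> q f) \<longrightarrow> (\<forall>f\<in>S. r f = q f)"
    using ex_minimal_sublinear[OF S p] by (elim exE conjE)
  note add = function_subspaceD(1)[OF S] and scl = function_subspaceD(2)[OF S] and neg = function_subspaceD(3)[OF S]
  have odd: "q (\<lambda>w. - a w) = - q a" if a: "a \<in> S" for a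
  proof -
    have "\<forall>f\<in>S. sublinear_shift q a f = q f"
      using sublinear_shift[OF S q(1) a] by (intro q(3)[THEN spec, THEN mp, THEN mp]) auto
    then have "q (\<lambda>w. - a w) \<le> - q a"
      using sublinear_shift(2)[OF S q(1) a] neg[OF a] by simp
    then show ?thesis using sublinear_on_minus_ge[OF S q(1) a] by simp
  qed
  have "linear_functional_on S q"
    unfolding linear_functional_on_def
  proof (intro conjI ballI allI)
    fix f g assume f: "f \<in> S" and g: "g \<in> S"
    have "q (\<lambda>w. (f w + g w) + - g w) \<le> q (\<lambda>w. f w + g w) + q (\<lambda>w. - g w)"
      by (intro sublinear_onD(1)[OF q(1)] add neg f g)
    then show "q (\<lambda>w. f w + g w) = q f + q g"
      using sublinear_onD(1)[OF q(1) f g] odd[OF g] by simp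
  next
    fix f and t :: real assume f: "f \<in> S"
    show "q (\<lambda>w. t *\<^sub>R f w) = t * q f"
    proof (cases "t \<ge> 0")
      case True then show ?thesis using sublinear_onD(2)[OF q(1) f] by simp
    next
      case False
      then have "q (\<lambda>w. (- t) *\<^sub>R f w) = - t * q f"
        by (intro sublinear_onD(2)[OF q(1) f]) simp
      moreover have "q (\<lambda>w. (- t) *\<^sub>R f w) = - q (\<lambda>w. t *\<^sub>R f w)"
        using odd[OF scl[OF f, of t]] by simp
      ultimately show ?thesis by simp
    qed
  qed
  then show ?thesis using q(2) by (rule that)
qed

section \<open>Separability of the dual of a reflexive separable space\<close>

text \<open>The space is viewed as the functions on the one-point type \<open>unit\<close>. The
  functional is sought below the shift of \<open>p\<close> along \<open>a\<close> instead of below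
  \<open>p\<close> itself: this controls its value at \<open>- a\<close>, hence gives equality at
  \<open>a\<close>.\<close>

lemma Hahn_Banach_normed:
  fixes p :: "'v::real_normed_vector \<Rightarrow> real"
  assumes add: "\<And>x y. p (x + y) \<le> p x + p y" and scale: "\<And>t x. t \<ge> 0 \<Longrightarrow> p (t *\<^sub>R x) = t * p x"
    and le_norm: "\<And>x. p x \<le> norm x"
  obtains f :: "'v \<Rightarrow>\<^sub>L real" where "\<And>x. blinfun_apply f x \<le> p x" "blinfun_apply f a = p a"
proof -
  let ?P = "\<lambda>g :: unit \<Rightarrow> 'v. p (g ())"
  have S: "function_subspace (UNIV :: (unit \<Rightarrow> 'v) set)" by (simp add: function_subspace_def)
  have P: "sublinear_on UNIV ?P" using add scale by (simp add: sublinear_on_def)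
  note shift = sublinear_shift[OF S P UNIV_I[of "\<lambda>_. a"]]
  obtain l where l: "linear_functional_on UNIV l" "\<forall>g\<in>UNIV. l g \<le> sublinear_shift ?P (\<lambda>_. a) g"
    by (rule Hahn_Banach_sublinear[OF S shift(3)])
  define h where "h x = l (\<lambda>_. x)" for x
  have l_add: "l (\<lambda>w. f w + g w) = l f + l g" and l_scale: "l (\<lambda>w. t *\<^sub>R f w) = t * l f" for f g t
    using l(1) by (simp_all add: linear_functional_on_def)
  have h_add: "h (x + y) = h x + h y" for x y
    using l_add[of "\<lambda>_. x" "\<lambda>_. y"] by (simp add: h_def)
  have h_scale: "h (t *\<^sub>R x) = t * h x" for t x
    using l_scale[of t "\<lambda>_. x"] by (simp add: h_def)
  have h_le: "h x \<le> p x" for x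
    using l(2) shift(1)[of "\<lambda>_. x"] unfolding h_def by (meson UNIV_I order_trans)
  have h_minus: "h (- x) = - h x" for x using h_scale[of "-1" x] by simp
  have bl: "bounded_linear h"
  proof (rule bounded_linear_intro[of _ 1])
    show "norm (h x) \<le> norm x * 1" for x
      using h_le[of x] h_le[of "- x"] le_norm[of x] le_norm[of "- x"] by (simp add: h_minus abs_le_iff)
  qed (simp_all add: h_add h_scale)
  show ?thesis
  proof (rule that[of "Blinfun h"])
    show "blinfun_apply (Blinfun h) x \<le> p x" for x by (simp add: bounded_linear_Blinfun_apply bl h_le)
    have "h (- a) \<le> - p a" using l(2) shift(2) unfolding h_def by (meson UNIV_I order_trans)
    then show "blinfun_apply (Blinfun h) a = p a"
      using h_le[of a] by (simp add: bounded_linear_Blinfun_apply bl h_minus)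
  qed
qed

section \<open>Distance to the rational span of a sequence\<close>

definition rat_combinations :: "(nat \<Rightarrow> 'v::real_vector) \<Rightarrow> 'v set"
  where "rat_combinations f = range (\<lambda>xs::(rat \<times> nat) list. \<Sum>(q, k)\<leftarrow>xs. of_rat q *\<^sub>R f k)"

lemma countable_rat_combinations: "countable (rat_combinations f)"
  by (simp add: rat_combinations_def)

lemma zero_rat_combinations: "0 \<in> rat_combinations f"
  unfolding rat_combinations_def by (rule range_eqI[of _ _ "[]"]) simp

lemma add_rat_combinations:
  assumes "x \<in> rat_combinations f" "y \<in> rat_combinations f"
  shows "x + y \<in> rat_combinations f"
proof -
  obtain xs ys :: "(rat \<times> nat) list" where "x = (\<Sum>(q, k)\<leftarrow>xs. of_rat q *\<^sub>R f k)" "y = (\<Sum>(q, k)\<leftarrow>ys. of_rat q *\<^sub>R f k)"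
    using assms unfolding rat_combinations_def by blast
  then show ?thesis unfolding rat_combinations_def by (intro range_eqI[of _ _ "xs @ ys"]) simp
qed

lemma scale_rat_combinations:
  assumes "x \<in> rat_combinations f"
  shows "of_rat r *\<^sub>R x \<in> rat_combinations f"
proof -
  obtain xs :: "(rat \<times> nat) list" where xs: "x = (\<Sum>(q, k)\<leftarrow>xs. of_rat q *\<^sub>R f k)"
    using assms unfolding rat_combinations_def by blast
  have "of_rat r *\<^sub>R (\<Sum>(q, k)\<leftarrow>xs. of_rat q *\<^sub>R f k) = (\<Sum>(q, k)\<leftarrow>map (\<lambda>(q, k). (r * q, k)) xs. of_rat q *\<^sub>R f k)"
    by (induction xs) (auto simp: scaleR_add_right of_rat_mult)
  then show ?thesis unfolding rat_combinations_def xs by (intro range_eqI)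
qed

lemma generator_rat_combinations: "f k \<in> rat_combinations f"
  unfolding rat_combinations_def by (rule range_eqI[of _ _ "[(1, k)]"]) simp

text \<open>Real factors can be approximated by rational ones, so the distance to the rational span
  is positively homogeneous, as it would be for a subspace. Used as a majorant in the Hahn-Banach
  theorem, it yields functionals that vanish on the span.\<close>

lemma infdist_rat_combinations:
  fixes f :: "nat \<Rightarrow> 'v::real_normed_vector"
  defines "p \<equiv> \<lambda>x. infdist x (rat_combinations f)"
  shows "p (x + y) \<le> p x + p y" and "t \<ge> 0 \<Longrightarrow> p (t *\<^sub>R x) = t * p x" and "p x \<le> norm x"
    and "e \<in> rat_combinations f \<Longrightarrow> p e = 0"
proof -
  let ?E = "rat_combinations f"
  have ne: "?E \<noteq> {}" using zero_rat_combinations by blast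
  have le: "p x \<le> norm (x - e)" if "e \<in> ?E" for x e
    unfolding p_def using infdist_le[OF that, of x] by (simp add: dist_norm)
  have ge: "c \<le> p x" if "\<And>e. e \<in> ?E \<Longrightarrow> c \<le> norm (x - e)" for c x
    unfolding p_def infdist_def using ne that by (auto intro!: cINF_greatest simp: dist_norm)
  show "p x \<le> norm x" for x using le[OF zero_rat_combinations, of x] by simp
  show "e \<in> ?E \<Longrightarrow> p e = 0" unfolding p_def by simp
  have "p (x + y) - norm (y - e) \<le> p x" if "e \<in> ?E" for e
  proof (rule ge)
    fix e' assume "e' \<in> ?E"
    then have "p (x + y) \<le> norm ((x + y) - (e' + e))"
      by (intro le add_rat_combinations that)
    also have "\<dots> \<le> norm (x - e') + norm (y - e)"
      using norm_triangle_ineq[of "x - e'" "y - e"] by (simp add: algebra_simps)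
    finally show "p (x + y) - norm (y - e) \<le> norm (x - e')" by simp
  qed
  then have "p (x + y) - p x \<le> p y" by (intro ge) (simp add: algebra_simps)
  then show "p (x + y) \<le> p x + p y" by simp
  have sle: "p (t *\<^sub>R x) \<le> t * p x" if t: "t > 0" for t x
  proof -
    have "p (t *\<^sub>R x) / t \<le> norm (x - e)" if e: "e \<in> ?E" for e
    proof -
      have "p (t *\<^sub>R x) \<le> t * norm (x - e) + d" if d: "d > 0" for d
      proof -
        \<comment> \<open>\<open>q\<close> exceeds \<open>t\<close> by so little that replacing
          \<open>t *\<^sub>R e\<close> by \<open>of_rat q *\<^sub>R e\<close> costs at most
          \<open>d\<close>; the \<open>+ 1\<close> guards against \<open>e = 0\<close>.\<close>
        obtain q where q: "t < of_rat q" "of_rat q < t + d / (norm e + 1)"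
          using of_rat_dense[of t "t + d / (norm e + 1)"] d by (auto simp: add_nonneg_pos)
        have "t *\<^sub>R x - of_rat q *\<^sub>R e = t *\<^sub>R (x - e) + (t - of_rat q) *\<^sub>R e"
          by (simp add: algebra_simps)
        then have "norm (t *\<^sub>R x - of_rat q *\<^sub>R e) \<le> t * norm (x - e) + \<bar>t - of_rat q\<bar> * norm e"
          using norm_triangle_ineq[of "t *\<^sub>R (x - e)" "(t - of_rat q) *\<^sub>R e"] t by simp
        moreover have "\<bar>t - of_rat q\<bar> * norm e \<le> d / (norm e + 1) * (norm e + 1)"
          using q d by (intro mult_mono) auto
        moreover have "d / (norm e + 1) * (norm e + 1) = d"
          using norm_ge_zero[of e] by (simp add: add_nonneg_eq_0_iff)
        ultimately show ?thesis
          using le[OF scale_rat_combinations[OF e, of q], of "t *\<^sub>R x"] by linarith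
      qed
      then have "p (t *\<^sub>R x) \<le> t * norm (x - e)" by (rule field_le_epsilon)
      then show ?thesis using t by (simp add: field_simps)
    qed
    then have "p (t *\<^sub>R x) / t \<le> p x" by (rule ge)
    then show ?thesis using t by (simp add: field_simps)
  qed
  show "p (t *\<^sub>R x) = t * p x" if "t \<ge> 0" for t x
  proof (cases "t = 0")
    case True
    have "p 0 = 0" unfolding p_def by (intro infdist_zero zero_rat_combinations)
    then show ?thesis using True by simp
  next
    case False
    then have t: "t > 0" using that by simp
    \<comment> \<open>The reverse inequality is \<open>sle\<close> for the factor
      \<open>1 / t\<close>.\<close>
    have "p ((1 / t) *\<^sub>R (t *\<^sub>R x)) \<le> 1 / t * p (t *\<^sub>R x)" using t by (intro sle) simp
    then have "t * p x \<le> p (t *\<^sub>R x)" using t by (simp add: field_simps)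
    then show ?thesis using sle[OF t, of x] by simp
  qed
qed

text \<open>The factor 2 is there because the supremum of \<open>\<bar>g d\<bar>\<close> over the
  unit ball of the dual is not claimed to be attained; some \<open>g\<close> exceeds half of it as
  soon as it is positive.\<close>

lemma ex_almost_norming:
  fixes d :: "'w::real_normed_vector"
  shows "\<exists>g :: 'w \<Rightarrow>\<^sub>L real. norm g \<le> 1 \<and> (\<forall>f :: 'w \<Rightarrow>\<^sub>L real. \<bar>blinfun_apply f d\<bar> \<le> 2 * norm f * \<bar>blinfun_apply g d\<bar>)"
proof -
  define s where "s = (SUP g\<in>{g :: 'w \<Rightarrow>\<^sub>L real. norm g \<le> 1}. \<bar>blinfun_apply g d\<bar>)"
  have bdd: "bdd_above ((\<lambda>g :: 'w \<Rightarrow>\<^sub>L real. \<bar>blinfun_apply g d\<bar>) ` {g. norm g \<le> 1})"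
  proof (rule bdd_aboveI2[of _ _ "norm d"])
    fix g :: "'w \<Rightarrow>\<^sub>L real" assume "g \<in> {g. norm g \<le> 1}"
    then show "\<bar>blinfun_apply g d\<bar> \<le> norm d"
      using norm_blinfun[of g d] mult_right_mono[of "norm g" 1 "norm d"] by simp
  qed
  have s: "\<bar>blinfun_apply g d\<bar> \<le> s" if "norm g \<le> 1" for g :: "'w \<Rightarrow>\<^sub>L real"
    unfolding s_def using that by (intro cSUP_upper bdd) simp
  have f: "\<bar>blinfun_apply f d\<bar> \<le> norm f * s" for f :: "'w \<Rightarrow>\<^sub>L real"
  proof (cases "f = 0")
    case False
    have "\<bar>blinfun_apply ((1 / norm f) *\<^sub>R f) d\<bar> \<le> s" using False by (intro s) simp
    then show ?thesis using False by (simp add: field_simps scaleR_blinfun.rep_eq abs_mult)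
  qed simp
  show ?thesis
  proof (cases "s \<le> 0")
    case True
    have "\<bar>blinfun_apply f d\<bar> \<le> 0" for f :: "'w \<Rightarrow>\<^sub>L real"
      using f[of f] True mult_nonneg_nonpos[of "norm f" s] by simp
    then show ?thesis by (intro exI[of _ 0]) simp
  next
    case False
    have "\<exists>g :: 'w \<Rightarrow>\<^sub>L real. norm g \<le> 1 \<and> s / 2 < \<bar>blinfun_apply g d\<bar>"
    proof (rule ccontr)
      assume "\<not> ?thesis"
      then have "\<bar>blinfun_apply g d\<bar> \<le> s / 2" if "norm g \<le> 1" for g :: "'w \<Rightarrow>\<^sub>L real" using that by (meson not_less)
      then have "s \<le> s / 2"
        unfolding s_def by (intro cSUP_least) (auto intro!: exI[of _ 0])
      then show False using False by simp
    qed
    then obtain g :: "'w \<Rightarrow>\<^sub>L real" where g: "norm g \<le> 1" "s / 2 < \<bar>blinfun_apply g d\<bar>" by blast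
    have "\<bar>blinfun_apply f d\<bar> \<le> 2 * norm f * \<bar>blinfun_apply g d\<bar>" for f :: "'w \<Rightarrow>\<^sub>L real"
      using f[of f] mult_left_mono[of "s / 2" "\<bar>blinfun_apply g d\<bar>" "2 * norm f"] g by simp
    then show ?thesis using g(1) by blast
  qed
qed

text \<open>Let \<open>g k\<close> almost norm the dense points \<open>x k\<close>. A functional on
  the dual that vanishes on all \<open>g k\<close> is, by reflexivity, evaluation at some
  \<open>z\<close>. For \<open>x k\<close> close to \<open>z\<close> the value of \<open>g k\<close>
  at \<open>x k\<close> equals that at \<open>x k - z\<close> and is small, so \<open>f\<close> is
  small at \<open>x k\<close> and therefore at \<open>z\<close>. Hence the rational span of the
  \<open>g k\<close> is dense.\<close>

lemma reflexive_space_separable_dual: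
  assumes "reflexive_space TYPE('w::{real_normed_vector, second_countable_topology})"
  obtains E :: "('w::{real_normed_vector, second_countable_topology} \<Rightarrow>\<^sub>L real) set"
  where "countable E" "E \<noteq> {}" "\<And>f \<epsilon>. \<epsilon> > 0 \<Longrightarrow> \<exists>e\<in>E. norm (f - e) < \<epsilon>"
proof -
  obtain D :: "'w set" where D: "countable D" "\<And>X. open X \<Longrightarrow> X \<noteq> {} \<Longrightarrow> \<exists>d\<in>D. d \<in> X"
    by (erule countable_dense_setE)
  have "D \<noteq> {}" using D(2)[of UNIV] by auto
  define x where "x = from_nat_into D"
  have "\<forall>k. \<exists>g :: 'w \<Rightarrow>\<^sub>L real. norm g \<le> 1 \<and> (\<forall>f :: 'w \<Rightarrow>\<^sub>L real. \<bar>blinfun_apply f (x k)\<bar> \<le> 2 * norm f * \<bar>blinfun_apply g (x k)\<bar>)"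
    using ex_almost_norming by blast
  from choice[OF this] obtain g :: "nat \<Rightarrow> 'w \<Rightarrow>\<^sub>L real" where g: "\<And>k. norm (g k) \<le> 1"
    "\<And>k f. \<bar>blinfun_apply f (x k)\<bar> \<le> 2 * norm f * \<bar>blinfun_apply (g k) (x k)\<bar>" by blast
  define E where "E = rat_combinations g"
  define p where "p f = infdist f E" for f
  note p = infdist_rat_combinations[where f = g, folded E_def, folded p_def]
  have p0: "p f = 0" for f
  proof (rule ccontr)
    assume ne: "p f \<noteq> 0"
    have "0 \<le> p f" unfolding p_def by (rule infdist_nonneg)
    then have pos: "p f > 0" using ne by simp
    obtain F :: "('w \<Rightarrow>\<^sub>L real) \<Rightarrow>\<^sub>L real" where F: "\<And>h. blinfun_apply F h \<le> p h" "blinfun_apply F f = p f"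
      by (rule Hahn_Banach_normed[of p f, OF p(1,2,3)]) auto
    obtain z where z: "\<And>h. blinfun_apply F h = blinfun_apply h z"
      using assms unfolding reflexive_space_def by blast
    have gz: "blinfun_apply (g k) z = 0" for k
    proof -
      have e: "g k \<in> E" "of_rat (- 1) *\<^sub>R g k \<in> E"
        unfolding E_def by (intro scale_rat_combinations generator_rat_combinations)+
      have "blinfun_apply F (g k) \<le> 0" "blinfun_apply F (of_rat (- 1) *\<^sub>R g k) \<le> 0"
        using F(1) p(4)[OF e(1)] p(4)[OF e(2)] by metis+
      then show ?thesis by (simp add: z blinfun.minus_right blinfun.minus_left)
    qed
    have "blinfun_apply f z > 0" using pos F(2) z by simp
    moreover have "blinfun_apply f z \<le> d" if d: "d > 0" for d
    proof -
      \<comment> \<open>The two errors below add up to \<open>3 * norm f\<close> times the distance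
        to \<open>z\<close>; the \<open>+ 1\<close> makes the division safe.\<close>
      define r where "r = d / (3 * norm f + 1)"
      have nf: "3 * norm f + 1 > 0" using norm_ge_zero[of f] by linarith
      have "r > 0" unfolding r_def using d nf by simp
      then obtain y where y: "y \<in> D" "y \<in> ball z r" using D(2)[of "ball z r"] by auto
      then obtain k where k: "y = x k"
        using D(1) \<open>D \<noteq> {}\<close> unfolding x_def by (metis from_nat_into_surj)
      have dist: "norm (x k - z) < r" using y(2) by (simp add: k dist_norm norm_minus_commute)
      have "\<bar>blinfun_apply (g k) (x k)\<bar> = \<bar>blinfun_apply (g k) (x k - z)\<bar>" using gz by (simp add: blinfun.diff_right)
      also have "\<dots> \<le> 1 * norm (x k - z)"
        using norm_blinfun[of "g k" "x k - z"] g(1)[of k] mult_right_mono[of "norm (g k)" 1 "norm (x k - z)"] by simp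
      finally have "\<bar>blinfun_apply f (x k)\<bar> \<le> 2 * norm f * norm (x k - z)"
        using g(2)[of f k] mult_left_mono[of "\<bar>blinfun_apply (g k) (x k)\<bar>" "norm (x k - z)" "2 * norm f"] by simp
      moreover have "\<bar>blinfun_apply f (x k) - blinfun_apply f z\<bar> \<le> norm f * norm (x k - z)"
        using norm_blinfun[of f "x k - z"] by (simp add: blinfun.diff_right)
      ultimately have "blinfun_apply f z \<le> 3 * norm f * norm (x k - z)" by (simp add: abs_le_iff)
      also have "\<dots> \<le> 3 * norm f * r" using dist by (intro mult_left_mono) auto
      also have "\<dots> \<le> (3 * norm f + 1) * r" using \<open>r > 0\<close> by (intro mult_right_mono) auto
      also have "\<dots> = d" unfolding r_def using nf by simp
      finally show ?thesis .
    qed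
    then have "blinfun_apply f z \<le> 0" using field_le_epsilon[of "blinfun_apply f z" 0] by simp
    ultimately show False by simp
  qed
  show ?thesis
  proof (rule that[of E])
    show "countable E" unfolding E_def by (rule countable_rat_combinations)
    show "E \<noteq> {}" unfolding E_def using zero_rat_combinations by blast
    fix f :: "'w \<Rightarrow>\<^sub>L real" and \<epsilon> :: real assume "\<epsilon> > 0"
    have "\<exists>e\<in>E. dist f e < \<epsilon>"
    proof (rule ccontr)
      assume "\<not> ?thesis"
      then have "\<epsilon> \<le> p f"
        unfolding p_def infdist_def using \<open>E \<noteq> {}\<close> by (auto intro!: cINF_greatest simp: not_less)
      then show False using p0[of f] \<open>\<epsilon> > 0\<close> by simp
    qed
    then show "\<exists>e\<in>E. norm (f - e) < \<epsilon>" by (simp add: dist_norm)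
  qed
qed

section \<open>Linear minorants of the value function\<close>

definition dyadic_mean :: "(nat \<Rightarrow> 'b::banach) \<Rightarrow> 'b"
  where "dyadic_mean p = (\<Sum>k. (1/2) ^ Suc k *\<^sub>R p k)"

lemma half_power_Suc_sums: "(\<lambda>k. (1/2) ^ Suc k * N) sums (N::real)"
  using sums_mult2[OF power_half_series, of N] by simp

lemma dyadic_mean_summable:
  fixes p :: "nat \<Rightarrow> 'b::banach"
  assumes "\<And>k. norm (p k) \<le> N"
  shows "summable (\<lambda>k. (1/2) ^ Suc k *\<^sub>R p k)"
proof (rule summable_comparison_test')
  show "summable (\<lambda>k. (1/2) ^ Suc k * N)"
    using half_power_Suc_sums sums_summable by blast
  show "norm ((1/2) ^ Suc k *\<^sub>R p k) \<le> (1/2) ^ Suc k * N" if "k \<ge> 0" for k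
    using assms[of k] by (simp del: power_Suc)
qed

lemma dyadic_mean_sums:
  fixes p :: "nat \<Rightarrow> 'b::banach"
  assumes "\<And>k. norm (p k) \<le> N"
  shows "(\<lambda>k. (1/2) ^ Suc k *\<^sub>R p k) sums dyadic_mean p"
  unfolding dyadic_mean_def by (rule summable_sums[OF dyadic_mean_summable[OF assms]])

lemma norm_dyadic_mean_le:
  fixes p :: "nat \<Rightarrow> 'b::banach"
  assumes "\<And>k. norm (p k) \<le> N"
  shows "norm (dyadic_mean p) \<le> N"
proof -
  have "norm (dyadic_mean p) \<le> (\<Sum>k. (1/2) ^ Suc k * N)"
    unfolding dyadic_mean_def
  proof (rule norm_suminf_le)
    show "norm ((1/2) ^ Suc k *\<^sub>R p k) \<le> (1/2) ^ Suc k * N" for k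
      using assms[of k] by (simp del: power_Suc)
    show "summable (\<lambda>k. (1/2) ^ Suc k * N)"
      using half_power_Suc_sums sums_summable by blast
  qed
  then show ?thesis using sums_unique[OF half_power_Suc_sums[of N]] by simp
qed

lemma dyadic_mean_Pair:
  fixes a :: "nat \<Rightarrow> 'b::banach" and b :: "nat \<Rightarrow> 'c::banach"
  assumes "\<And>k. norm (a k) \<le> N" "\<And>k. norm (b k) \<le> N'"
  shows "dyadic_mean (\<lambda>k. (a k, b k)) = (dyadic_mean a, dyadic_mean b)"
proof -
  have "(\<lambda>k. ((1/2) ^ Suc k *\<^sub>R a k, (1/2) ^ Suc k *\<^sub>R b k)) sums (dyadic_mean a, dyadic_mean b)"
    using dyadic_mean_sums[of a, OF assms(1)] dyadic_mean_sums[of b, OF assms(2)]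
    by (simp add: sums_def sum_prod tendsto_Pair del: power_Suc)
  then show ?thesis
    unfolding dyadic_mean_def by (simp add: sums_iff del: power_Suc)
qed

lemma dyadic_mean_single: "dyadic_mean (\<lambda>j. if j = k then v else 0) = (1/2) ^ Suc k *\<^sub>R v"
proof -
  have "(\<lambda>j. (1/2) ^ Suc j *\<^sub>R (if j = k then v else 0)) sums ((1/2) ^ Suc k *\<^sub>R v)"
    using sums_single[of k "\<lambda>j. (1/2) ^ Suc j *\<^sub>R v"] by (simp add: if_distrib cong: if_cong)
  then show ?thesis by (simp add: dyadic_mean_def sums_iff)
qed

text \<open>A partial sum has total weight below 1. Putting the missing weight
  \<open>(1/2) ^ n\<close> on a point of \<open>C\<close> turns it into a convex combination, and
  this correction vanishes in the limit.\<close>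

lemma dyadic_mean_in:
  fixes C :: "'b::banach set"
  assumes "closed C" "convex C" "\<And>k. p k \<in> C" "\<And>k. norm (p k) \<le> N"
  shows "dyadic_mean p \<in> C"
proof -
  have part: "(\<Sum>k<n. (1/2) ^ Suc k *\<^sub>R p k) + (1/2) ^ n *\<^sub>R q \<in> C"
    if "\<And>k. p k \<in> C" "q \<in> C" for n p q
    using that
  proof (induction n arbitrary: p)
    case (Suc n)
    \<comment> \<open>The first point takes weight 1/2; the induction hypothesis handles the shifted
      sequence with the other half.\<close>
    have "(\<Sum>k<n. (1/2) ^ Suc k *\<^sub>R p (Suc k)) + (1/2) ^ n *\<^sub>R q \<in> C"
      using Suc.IH[of "\<lambda>k. p (Suc k)"] Suc.prems by simp
    then have h: "(1/2) *\<^sub>R p 0 + (1/2) *\<^sub>R ((\<Sum>k<n. (1/2) ^ Suc k *\<^sub>R p (Suc k)) + (1/2) ^ n *\<^sub>R q) \<in> C"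
      using Suc.prems(1)[of 0] by (intro convexD[OF assms(2)]) auto
    have "(\<Sum>k<Suc n. (1/2) ^ Suc k *\<^sub>R p k) + (1/2) ^ Suc n *\<^sub>R q =
        (1/2) *\<^sub>R p 0 + (1/2) *\<^sub>R ((\<Sum>k<n. (1/2) ^ Suc k *\<^sub>R p (Suc k)) + (1/2) ^ n *\<^sub>R q)"
      unfolding sum.lessThan_Suc_shift by (simp add: scaleR_sum_right scaleR_add_right add.assoc)
    then show ?case using h by simp
  qed simp
  have "(\<lambda>n. (\<Sum>k<n. (1/2) ^ Suc k *\<^sub>R p k) + (1/2) ^ n *\<^sub>R p 0) \<longlonglongrightarrow> dyadic_mean p + 0 *\<^sub>R p 0"
    using dyadic_mean_sums[of p, OF assms(4)] unfolding sums_def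
    by (intro tendsto_intros LIMSEQ_power_zero) auto
  then have lim: "(\<lambda>n. (\<Sum>k<n. (1/2) ^ Suc k *\<^sub>R p k) + (1/2) ^ n *\<^sub>R p 0) \<longlonglongrightarrow> dyadic_mean p"
    by simp
  have mem: "(\<Sum>k<n. (1/2) ^ Suc k *\<^sub>R p k) + (1/2) ^ n *\<^sub>R p 0 \<in> C" for n
    by (intro part assms(3))
  show ?thesis
    by (rule closed_sequentially[OF assms(1) mem lim])
qed

lemma borel_measurable_dyadic_mean:
  fixes f :: "nat \<Rightarrow> 'a \<Rightarrow> 'b::{banach, second_countable_topology}"
  assumes [measurable]: "\<And>k. f k \<in> borel_measurable M"
    and "\<And>k w. w \<in> space M \<Longrightarrow> norm (f k w) \<le> N"
  shows "(\<lambda>w. dyadic_mean (\<lambda>k. f k w)) \<in> borel_measurable M"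
proof (rule borel_measurable_LIMSEQ_metric)
  show "(\<lambda>w. \<Sum>k<n. (1/2) ^ Suc k *\<^sub>R f k w) \<in> borel_measurable M" for n
    by measurable
  show "(\<lambda>n. \<Sum>k<n. (1/2) ^ Suc k *\<^sub>R f k w) \<longlonglongrightarrow> dyadic_mean (\<lambda>k. f k w)"
    if "w \<in> space M" for w
    using dyadic_mean_sums[of "\<lambda>k. f k w" N] assms(2)[OF that] by (simp add: sums_def)
qed

text \<open>Representatives of essentially bounded functions that are bounded everywhere on
  \<open>space M\<close>. Bounds can then be checked pointwise, and a functional on them need not
  respect null sets from the outset.\<close>

definition bdd_measurable :: "'a measure \<Rightarrow> ('a \<Rightarrow> 'b::{real_normed_vector, second_countable_topology}) set"
  where "bdd_measurable M = {f \<in> borel_measurable M. \<exists>c. \<forall>w\<in>space M. norm (f w) \<le> c}"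

abbreviation norm_le_on :: "'a measure \<Rightarrow> ('a \<Rightarrow> 'b::real_normed_vector) \<Rightarrow> real \<Rightarrow> bool"
  where "norm_le_on M u b \<equiv> \<forall>w\<in>space M. norm (u w) \<le> b"

lemma bdd_measurableI:
  "f \<in> borel_measurable M \<Longrightarrow> (\<And>w. w \<in> space M \<Longrightarrow> norm (f w) \<le> c) \<Longrightarrow> f \<in> bdd_measurable M"
  by (auto simp: bdd_measurable_def)

lemma bdd_measurableD [measurable_dest]:
  "f \<in> bdd_measurable M \<Longrightarrow> f \<in> borel_measurable M"
  by (auto simp: bdd_measurable_def)

lemma bdd_measurable_bound:
  assumes "f \<in> bdd_measurable M"
  obtains c where "c > 0" "norm_le_on M f c"
proof -
  obtain c where "norm_le_on M f c" using assms by (auto simp: bdd_measurable_def)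
  then show ?thesis by (intro that[of "max c 1"]) (auto simp: max.coboundedI1)
qed

lemma function_subspace_bdd_measurable:
  "function_subspace (bdd_measurable M)"
  unfolding function_subspace_def
proof (intro conjI ballI allI)
  show "(\<lambda>_. 0) \<in> bdd_measurable M" by (rule bdd_measurableI[of _ _ 0]) auto
  fix f g :: "'a \<Rightarrow> 'b" assume f: "f \<in> bdd_measurable M" and g: "g \<in> bdd_measurable M"
  obtain c d where "\<And>w. w \<in> space M \<Longrightarrow> norm (f w) \<le> c" "\<And>w. w \<in> space M \<Longrightarrow> norm (g w) \<le> d"
    using bdd_measurable_bound[OF f] bdd_measurable_bound[OF g] by metis
  then show "(\<lambda>w. f w + g w) \<in> bdd_measurable M"
    using f g by (intro bdd_measurableI[of _ _ "c + d"]) (auto intro!: norm_triangle_mono measurable)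
next
  fix f :: "'a \<Rightarrow> 'b" and t :: real assume f: "f \<in> bdd_measurable M"
  obtain c where "\<And>w. w \<in> space M \<Longrightarrow> norm (f w) \<le> c"
    using bdd_measurable_bound[OF f] by metis
  then show "(\<lambda>w. t *\<^sub>R f w) \<in> bdd_measurable M"
    using f by (intro bdd_measurableI[of _ _ "\<bar>t\<bar> * c"]) (auto intro!: mult_left_mono measurable)
qed

lemma bdd_measurable_add: "f \<in> bdd_measurable M \<Longrightarrow> g \<in> bdd_measurable M \<Longrightarrow> (\<lambda>w. f w + g w) \<in> bdd_measurable M"
  and bdd_measurable_scaleR: "f \<in> bdd_measurable M \<Longrightarrow> (\<lambda>w. t *\<^sub>R f w) \<in> bdd_measurable M"
  and bdd_measurable_zero: "(\<lambda>_. 0) \<in> bdd_measurable M"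
  using function_subspace_bdd_measurable[of M] by (auto simp: function_subspace_def)

lemma bdd_measurable_minus: "f \<in> bdd_measurable M \<Longrightarrow> (\<lambda>w. - f w) \<in> bdd_measurable M"
  using bdd_measurable_scaleR[of f M "-1"] by simp

lemma bdd_measurable_diff: "f \<in> bdd_measurable M \<Longrightarrow> g \<in> bdd_measurable M \<Longrightarrow> (\<lambda>w. f w - g w) \<in> bdd_measurable M"
  using bdd_measurable_add[OF _ bdd_measurable_minus, of f M g] by simp

lemma bdd_measurable_dyadic_mean:
  fixes f :: "nat \<Rightarrow> 'a \<Rightarrow> 'b::{banach, second_countable_topology}"
  assumes "\<And>k. f k \<in> borel_measurable M" "\<And>k w. w \<in> space M \<Longrightarrow> norm (f k w) \<le> N"
  shows "(\<lambda>w. dyadic_mean (\<lambda>k. f k w)) \<in> bdd_measurable M"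
  by (rule bdd_measurableI[OF borel_measurable_dyadic_mean[OF assms] norm_dyadic_mean_le[OF assms(2)]])

text \<open>The first stage \<open>x1\<close> is one point, fixed before \<open>w\<close> is known;
  only the second stage and the perturbation depend on \<open>w\<close>. All constraints sit in the
  fibres \<open>G w\<close>.\<close>

definition admissible :: "'a measure \<Rightarrow> ('a \<Rightarrow> ('x1 \<times> 'x2::{real_normed_vector, second_countable_topology} \<times> 'z) set)
    \<Rightarrow> 'x1 \<Rightarrow> ('a \<Rightarrow> 'x2) \<Rightarrow> ('a \<Rightarrow> 'z) \<Rightarrow> bool"
  where "admissible M G x1 x2 u \<longleftrightarrow> x2 \<in> bdd_measurable M \<and> (AE w in M. (x1, x2 w, u w) \<in> G w)"

definition expected_cost :: "'a measure \<Rightarrow> ('x1 \<Rightarrow> real) \<Rightarrow> ('x1 \<Rightarrow> 'x2 \<Rightarrow> real) \<Rightarrow> 'x1 \<Rightarrow> ('a \<Rightarrow> 'x2) \<Rightarrow> real"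
  where "expected_cost M J1 J2 x1 x2 = J1 x1 + (\<integral>w. J2 x1 (x2 w) \<partial>M)"

text \<open>An abstract form of the problem, with \<open>v0\<close> later the optimal value.
  \<open>recourse\<close> says that a first stage which serves some perturbation can also serve the
  perturbation 0; \<open>strict\<close> is strict feasibility for the sup norm.\<close>

locale recourse_problem = prob_space M for M :: "'a measure" +
  fixes G :: "'a \<Rightarrow> ('x1::{banach, second_countable_topology} \<times> 'x2::{banach, second_countable_topology} \<times>
      'z::{banach, second_countable_topology}) set"
    and J1 :: "'x1 \<Rightarrow> real" and J2 :: "'x1 \<Rightarrow> 'x2 \<Rightarrow> real" and v0 :: real
  assumes closed_G: "\<And>w. w \<in> space M \<Longrightarrow> closed (G w)"
    and convex_G: "\<And>w. w \<in> space M \<Longrightarrow> convex (G w)"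
    and convex_J: "convex_on UNIV (\<lambda>(x1, x2). J1 x1 + J2 x1 x2)"
    and bounded_J2: "\<And>r. r > 0 \<Longrightarrow> \<exists>a>0. \<forall>x1 x2. norm x1 + norm x2 \<le> r \<longrightarrow> \<bar>J2 x1 x2\<bar> \<le> a"
    and recourse: "\<And>x1 x2 u. admissible M G x1 x2 u \<Longrightarrow> \<exists>y. admissible M G x1 y (\<lambda>_. 0)"
    and strict: "\<exists>\<delta>>0. \<forall>u\<in>bdd_measurable M. norm_le_on M u \<delta> \<longrightarrow>
      (\<exists>x1 x2. admissible M G x1 x2 u)"
    and lower_bound: "\<And>x1 x2. admissible M G x1 x2 (\<lambda>_. 0) \<Longrightarrow> v0 \<le> expected_cost M J1 J2 x1 x2"
begin

section \<open>Convexity of the cost and of admissibility\<close>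

abbreviation "adm \<equiv> admissible M G"
abbreviation "cost \<equiv> expected_cost M J1 J2"

text \<open>A convex function that is bounded on balls is continuous. Continuity in the second stage
  is what makes \<open>J2 x1 (x2 w)\<close> measurable in \<open>w\<close>.\<close>

lemma continuous_J2: "continuous_on UNIV (J2 x1)"
proof -
  have conv: "convex_on UNIV (J2 x1)"
  proof (rule convex_onI)
    fix t :: real and y z :: 'x2 assume "0 < t" "t < 1"
    then have "J1 ((1 - t) *\<^sub>R x1 + t *\<^sub>R x1) + J2 ((1 - t) *\<^sub>R x1 + t *\<^sub>R x1) ((1 - t) *\<^sub>R y + t *\<^sub>R z)
        \<le> (1 - t) * (J1 x1 + J2 x1 y) + t * (J1 x1 + J2 x1 z)"
      using convex_onD[OF convex_J, of t "(x1, y)" "(x1, z)"] by simp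
    moreover have "(1 - t) *\<^sub>R x1 + t *\<^sub>R x1 = x1"
      by (simp flip: scaleR_add_left)
    ultimately show "J2 x1 ((1 - t) *\<^sub>R y + t *\<^sub>R z) \<le> (1 - t) * J2 x1 y + t * J2 x1 z"
      by (simp add: algebra_simps)
  qed simp
  have "continuous (at y) (J2 x1)" for y
  proof -
    obtain a where a: "\<And>y'. norm x1 + norm y' \<le> norm x1 + norm y + 1 \<Longrightarrow> \<bar>J2 x1 y'\<bar> \<le> a"
      using bounded_J2[of "norm x1 + norm y + 1"] by (metis add_nonneg_pos add_nonneg_nonneg norm_ge_zero zero_less_one)
    have "continuous_on (ball y 1) (J2 x1)"
    proof (rule convex_on_bounded_continuous[where b = a])
      show "convex_on (ball y 1) (J2 x1)" using conv by (rule convex_on_subset) auto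
      show "\<forall>y'\<in>ball y 1. \<bar>J2 x1 y'\<bar> \<le> a"
      proof
        fix y' assume "y' \<in> ball y 1"
        then have "norm y' \<le> norm y + 1"
          using norm_triangle_sub[of y' y] by (simp add: dist_norm norm_minus_commute)
        then show "\<bar>J2 x1 y'\<bar> \<le> a" by (intro a) simp
      qed
    qed auto
    then show ?thesis by (simp add: continuous_on_eq_continuous_at)
  qed
  then show ?thesis by (simp add: continuous_on_eq_continuous_within continuous_at_imp_continuous_within)
qed

lemma measurable_J2 [measurable (raw)]:
  "x2 \<in> borel_measurable M \<Longrightarrow> (\<lambda>w. J2 x1 (x2 w)) \<in> borel_measurable M"
  using borel_measurable_continuous_onI[OF continuous_J2] by (rule measurable_compose_rev)

lemma integrable_J2:
  assumes "x2 \<in> bdd_measurable M"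
  shows "integrable M (\<lambda>w. J2 x1 (x2 w))"
proof -
  obtain c where c: "c > 0" "norm_le_on M x2 c"
    by (rule bdd_measurable_bound[OF assms])
  obtain a where a: "\<And>y. norm x1 + norm y \<le> norm x1 + c \<Longrightarrow> \<bar>J2 x1 y\<bar> \<le> a"
    using bounded_J2[of "norm x1 + c"] c(1) by (metis add_nonneg_pos norm_ge_zero)
  show ?thesis
  proof (rule integrable_const_bound[of _ a])
    show "AE w in M. norm (J2 x1 (x2 w)) \<le> a" using a c(2) by (intro AE_I2) simp
  qed (intro measurable_J2 bdd_measurableD assms)
qed

lemma cost_convex:
  assumes "x2 \<in> bdd_measurable M" "y2 \<in> bdd_measurable M" "0 \<le> t" "t \<le> 1"
  shows "cost (t *\<^sub>R x1 + (1 - t) *\<^sub>R y1) (\<lambda>w. t *\<^sub>R x2 w + (1 - t) *\<^sub>R y2 w)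
    \<le> t * cost x1 x2 + (1 - t) * cost y1 y2"
proof -
  let ?z1 = "t *\<^sub>R x1 + (1 - t) *\<^sub>R y1" and ?z2 = "\<lambda>w. t *\<^sub>R x2 w + (1 - t) *\<^sub>R y2 w"
  have z: "?z2 \<in> bdd_measurable M"
    by (intro bdd_measurable_add bdd_measurable_scaleR assms)
  \<comment> \<open>\<open>J1\<close> is moved under the integral because convexity is available for
    the sum \<open>J1 + J2\<close> only.\<close>
  have e: "cost x1 x2 = (\<integral>w. J1 x1 + J2 x1 (x2 w) \<partial>M)" if "x2 \<in> bdd_measurable M" for x1 x2
    using integrable_J2[OF that] by (simp add: expected_cost_def prob_space)
  have "(\<integral>w. J1 ?z1 + J2 ?z1 (?z2 w) \<partial>M)
      \<le> (\<integral>w. t * (J1 x1 + J2 x1 (x2 w)) + (1 - t) * (J1 y1 + J2 y1 (y2 w)) \<partial>M)"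
  proof (rule integral_mono)
    show "J1 ?z1 + J2 ?z1 (?z2 w) \<le> t * (J1 x1 + J2 x1 (x2 w)) + (1 - t) * (J1 y1 + J2 y1 (y2 w))" for w
      using convex_onD[OF convex_J, of t "(y1, y2 w)" "(x1, x2 w)"] assms(3,4) by (simp add: add.commute)
  qed (use assms z integrable_J2 in auto)
  also have "\<dots> = t * (\<integral>w. J1 x1 + J2 x1 (x2 w) \<partial>M) + (1 - t) * (\<integral>w. J1 y1 + J2 y1 (y2 w) \<partial>M)"
    using integrable_J2[OF assms(1)] integrable_J2[OF assms(2)] by simp
  finally show ?thesis using assms z by (simp add: e)
qed

lemma adm_convex:
  assumes "adm x1 x2 u" "adm y1 y2 v" "0 \<le> t" "t \<le> 1"
  shows "adm (t *\<^sub>R x1 + (1 - t) *\<^sub>R y1) (\<lambda>w. t *\<^sub>R x2 w + (1 - t) *\<^sub>R y2 w)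
    (\<lambda>w. t *\<^sub>R u w + (1 - t) *\<^sub>R v w)"
  unfolding admissible_def
proof
  show "(\<lambda>w. t *\<^sub>R x2 w + (1 - t) *\<^sub>R y2 w) \<in> bdd_measurable M"
    using assms by (intro bdd_measurable_add bdd_measurable_scaleR) (auto simp: admissible_def)
  have "AE w in M. (x1, x2 w, u w) \<in> G w" "AE w in M. (y1, y2 w, v w) \<in> G w"
    using assms by (auto simp: admissible_def)
  then show "AE w in M. (t *\<^sub>R x1 + (1 - t) *\<^sub>R y1, t *\<^sub>R x2 w + (1 - t) *\<^sub>R y2 w,
      t *\<^sub>R u w + (1 - t) *\<^sub>R v w) \<in> G w"
    using AE_space
  proof eventually_elim
    case (elim w)
    then show ?case
      using convexD[OF convex_G[of w] elim(1,2), of t "1 - t"] assms(3,4) by simp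
  qed
qed

text \<open>Subadditivity of difference quotients. The weights \<open>a\<close> and
  \<open>1 - a\<close> give both perturbations the same factor \<open>r\<close>, which means that
  \<open>1 / r\<close> is \<open>1 / s + 1 / t\<close>.\<close>

lemma adm_combine:
  assumes x: "adm x1 x2 (\<lambda>w. s *\<^sub>R u w)" and y: "adm y1 y2 (\<lambda>w. t *\<^sub>R v w)" and st: "s > 0" "t > 0"
  obtains z1 z2 r where "r > 0" "adm z1 z2 (\<lambda>w. r *\<^sub>R (u w + v w))"
    "(cost z1 z2 - v0) / r \<le> (cost x1 x2 - v0) / s + (cost y1 y2 - v0) / t"
proof -
  define a where "a = t / (s + t)"
  define r where "r = s * t / (s + t)"
  have a: "0 \<le> a" "a \<le> 1" "a * s = r" "(1 - a) * t = r" "r > 0"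
    using st by (auto simp: a_def r_def field_simps)
  show ?thesis
  proof (rule that[OF a(5)])
    have "(\<lambda>w. a *\<^sub>R s *\<^sub>R u w + (1 - a) *\<^sub>R t *\<^sub>R v w) = (\<lambda>w. r *\<^sub>R (u w + v w))"
      using a by (simp add: scaleR_add_right)
    then show "adm (a *\<^sub>R x1 + (1 - a) *\<^sub>R y1) (\<lambda>w. a *\<^sub>R x2 w + (1 - a) *\<^sub>R y2 w) (\<lambda>w. r *\<^sub>R (u w + v w))"
      using adm_convex[OF x y a(1,2)] by simp
    have "cost (a *\<^sub>R x1 + (1 - a) *\<^sub>R y1) (\<lambda>w. a *\<^sub>R x2 w + (1 - a) *\<^sub>R y2 w) - v0
        \<le> a * (cost x1 x2 - v0) + (1 - a) * (cost y1 y2 - v0)"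
      using cost_convex[of x2 y2 a x1 y1] a x y by (simp add: admissible_def algebra_simps)
    also have "\<dots> = r * ((cost x1 x2 - v0) / s + (cost y1 y2 - v0) / t)"
      using st unfolding a_def r_def by (simp add: divide_simps)
    finally show "(cost (a *\<^sub>R x1 + (1 - a) *\<^sub>R y1) (\<lambda>w. a *\<^sub>R x2 w + (1 - a) *\<^sub>R y2 w) - v0) / r
        \<le> (cost x1 x2 - v0) / s + (cost y1 y2 - v0) / t"
      using a(5) by (simp add: pos_divide_le_eq mult.commute)
  qed
qed

lemma ex_adm_scaled:
  assumes "u \<in> bdd_measurable M"
  obtains t x1 x2 where "t > 0" "adm x1 x2 (\<lambda>w. t *\<^sub>R u w)"
proof -
  obtain d where d: "d > 0" "\<And>u. u \<in> bdd_measurable M \<Longrightarrow> norm_le_on M u d \<Longrightarrow> \<exists>x1 x2. adm x1 x2 u"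
    using strict by blast
  obtain c where c: "c > 0" "norm_le_on M u c"
    by (rule bdd_measurable_bound[OF assms])
  have "\<exists>x1 x2. adm x1 x2 (\<lambda>w. (d / c) *\<^sub>R u w)"
    using c d(1) by (intro d(2) bdd_measurable_scaleR assms) (auto simp: divide_simps mult_left_mono)
  then show ?thesis using that[of "d / c"] c d(1) by auto
qed

text \<open>Difference quotients of the value function at 0 in direction \<open>u\<close>. If
  \<open>v0\<close> is the value at 0, their infimum is the directional derivative there.\<close>

definition slopes :: "('a \<Rightarrow> 'z) \<Rightarrow> real set"
  where "slopes u = {(cost x1 x2 - v0) / t | x1 x2 t. t > 0 \<and> adm x1 x2 (\<lambda>w. t *\<^sub>R u w)}"

lemma slopesI: "t > 0 \<Longrightarrow> adm x1 x2 (\<lambda>w. t *\<^sub>R u w) \<Longrightarrow> (cost x1 x2 - v0) / t \<in> slopes u"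
  unfolding slopes_def by (intro CollectI exI[of _ x1] exI[of _ x2] exI[of _ t] conjI refl)

lemma slopesE:
  assumes "a \<in> slopes u"
  obtains x1 x2 t where "t > 0" "adm x1 x2 (\<lambda>w. t *\<^sub>R u w)" "a = (cost x1 x2 - v0) / t"
  using assms unfolding slopes_def by (elim CollectE exE conjE) (rule that)

lemma slopes_nonempty:
  assumes "u \<in> bdd_measurable M"
  shows "slopes u \<noteq> {}"
proof -
  obtain t x1 x2 where "t > 0" "adm x1 x2 (\<lambda>w. t *\<^sub>R u w)"
    by (rule ex_adm_scaled[OF assms])
  from slopesI[OF this] show ?thesis by blast
qed

lemma slopes_add_le:
  assumes "a \<in> slopes u" "b \<in> slopes v"
  obtains c where "c \<in> slopes (\<lambda>w. u w + v w)" "c \<le> a + b"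
proof -
  obtain x1 x2 s where x: "s > 0" "adm x1 x2 (\<lambda>w. s *\<^sub>R u w)" "a = (cost x1 x2 - v0) / s"
    by (rule slopesE[OF assms(1)])
  obtain y1 y2 t where y: "t > 0" "adm y1 y2 (\<lambda>w. t *\<^sub>R v w)" "b = (cost y1 y2 - v0) / t"
    by (rule slopesE[OF assms(2)])
  obtain z1 z2 r where z: "r > 0" "adm z1 z2 (\<lambda>w. r *\<^sub>R (u w + v w))"
    "(cost z1 z2 - v0) / r \<le> (cost x1 x2 - v0) / s + (cost y1 y2 - v0) / t"
    by (rule adm_combine[OF x(2) y(2) x(1) y(1)])
  show ?thesis
    using that[OF slopesI[OF z(1,2)]] z(3) x(3) y(3) by simp
qed

lemma slopes_zero_ge: "a \<in> slopes (\<lambda>_. 0) \<Longrightarrow> a \<ge> 0"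
  using lower_bound by (auto elim!: slopesE)

text \<open>A single slope along \<open>- u\<close> bounds all slopes along \<open>u\<close> from
  below, because their sum dominates a slope along 0, which is nonnegative.\<close>

lemma slopes_bdd_below:
  assumes "u \<in> bdd_measurable M"
  shows "bdd_below (slopes u)"
proof -
  obtain b where b: "b \<in> slopes (\<lambda>w. - u w)"
    using slopes_nonempty[OF bdd_measurable_minus[OF assms]] by blast
  have "- b \<le> a" if a: "a \<in> slopes u" for a
  proof -
    obtain c where "c \<in> slopes (\<lambda>w. u w + - u w)" "c \<le> a + b"
      by (rule slopes_add_le[OF a b])
    then show ?thesis using slopes_zero_ge[of c] by simp
  qed
  then show ?thesis by (rule bdd_belowI)
qed

lemma slopes_scale:
  assumes "t > 0" "a \<in> slopes u"
  shows "t * a \<in> slopes (\<lambda>w. t *\<^sub>R u w)"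
proof -
  obtain x1 x2 s where s: "s > 0" "adm x1 x2 (\<lambda>w. s *\<^sub>R u w)" "a = (cost x1 x2 - v0) / s"
    by (rule slopesE[OF assms(2)])
  have "s / t > 0" "adm x1 x2 (\<lambda>w. (s / t) *\<^sub>R t *\<^sub>R u w)"
    using assms s by auto
  from slopesI[OF this] show ?thesis using s(3) assms(1) by (simp add: mult.commute)
qed

lemma sublinear_Inf_slopes: "sublinear_on (bdd_measurable M) (\<lambda>u. Inf (slopes u))"
  unfolding sublinear_on_def
proof (intro conjI ballI allI impI)
  fix u v :: "'a \<Rightarrow> 'z" assume u: "u \<in> bdd_measurable M" and v: "v \<in> bdd_measurable M"
  have s: "Inf (slopes (\<lambda>w. u w + v w)) \<le> a + b" if "a \<in> slopes u" "b \<in> slopes v" for a b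
  proof -
    obtain c where c: "c \<in> slopes (\<lambda>w. u w + v w)" "c \<le> a + b"
      by (rule slopes_add_le[OF \<open>a \<in> slopes u\<close> \<open>b \<in> slopes v\<close>])
    have "Inf (slopes (\<lambda>w. u w + v w)) \<le> c"
      by (rule cInf_lower[OF c(1) slopes_bdd_below[OF bdd_measurable_add[OF u v]]])
    then show ?thesis using c(2) by simp
  qed
  have "Inf (slopes (\<lambda>w. u w + v w)) - b \<le> Inf (slopes u)" if "b \<in> slopes v" for b
    using s that slopes_nonempty[OF u] by (intro cInf_greatest) (auto simp: algebra_simps)
  then have "Inf (slopes (\<lambda>w. u w + v w)) - Inf (slopes u) \<le> Inf (slopes v)"
    using slopes_nonempty[OF v] by (intro cInf_greatest) (auto simp: algebra_simps)
  then show "Inf (slopes (\<lambda>w. u w + v w)) \<le> Inf (slopes u) + Inf (slopes v)" by simp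
next
  fix u :: "'a \<Rightarrow> 'z" and t :: real assume u: "u \<in> bdd_measurable M" and t: "t \<ge> 0"
  have le: "Inf (slopes (\<lambda>w. t *\<^sub>R u w)) \<le> t * Inf (slopes u)" if u: "u \<in> bdd_measurable M" and t: "t > 0" for u t
  proof -
    have "Inf (slopes (\<lambda>w. t *\<^sub>R u w)) / t \<le> Inf (slopes u)"
    proof (rule cInf_greatest[OF slopes_nonempty[OF u]])
      fix a assume "a \<in> slopes u"
      then have "Inf (slopes (\<lambda>w. t *\<^sub>R u w)) \<le> t * a"
        using t u by (intro cInf_lower slopes_scale slopes_bdd_below bdd_measurable_scaleR)
      then show "Inf (slopes (\<lambda>w. t *\<^sub>R u w)) / t \<le> a" using t by (simp add: field_simps)
    qed
    then show ?thesis using t by (simp add: field_simps)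
  qed
  show "Inf (slopes (\<lambda>w. t *\<^sub>R u w)) = t * Inf (slopes u)"
  proof (cases "t = 0")
    case False
    then have tp: "t > 0" using t by simp
    have "Inf (slopes (\<lambda>w. (1/t) *\<^sub>R t *\<^sub>R u w)) \<le> (1/t) * Inf (slopes (\<lambda>w. t *\<^sub>R u w))"
      using tp by (intro le bdd_measurable_scaleR u) simp
    then have "t * Inf (slopes u) \<le> Inf (slopes (\<lambda>w. t *\<^sub>R u w))"
      using tp by (simp add: field_simps)
    then show ?thesis using le[OF u tp] by simp
  next
    case True
    let ?i = "Inf (slopes (\<lambda>_. 0))"
    have z: "(\<lambda>_. 0) \<in> bdd_measurable M" by (rule bdd_measurable_zero)
    \<comment> \<open>Scaling the direction 0 by 1/2 gives \<open>?i \<le> (1/2) * ?i\<close>, so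
      the nonnegative number \<open>?i\<close> is 0.\<close>
    have "?i \<ge> 0" using slopes_nonempty[OF z] slopes_zero_ge by (rule cInf_greatest)
    moreover have "?i \<le> (1/2) * ?i" using le[OF z, of "1/2"] by simp
    ultimately show ?thesis using True by simp
  qed
qed

text \<open>The gap \<open>cost x1 x2 - v0\<close> is itself the slope with step 1, so a linear
  functional below the infimum of the slopes minorizes it.\<close>

lemma ex_linear_minorant:
  "\<exists>l. linear_functional_on (bdd_measurable M) l \<and>
    (\<forall>x1 x2. \<forall>u\<in>bdd_measurable M. adm x1 x2 u \<longrightarrow> l u \<le> cost x1 x2 - v0)"
proof -
  obtain l where l: "linear_functional_on (bdd_measurable M) l"
      "\<forall>u\<in>bdd_measurable M. l u \<le> Inf (slopes u)"
    by (rule Hahn_Banach_sublinear[OF function_subspace_bdd_measurable sublinear_Inf_slopes])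
  have "l u \<le> cost x1 x2 - v0" if u: "u \<in> bdd_measurable M" "adm x1 x2 u" for x1 x2 u
  proof -
    have "cost x1 x2 - v0 \<in> slopes u"
      using slopesI[of 1 x1 x2 u] u(2) by simp
    then have "Inf (slopes u) \<le> cost x1 x2 - v0"
      by (rule cInf_lower[OF _ slopes_bdd_below[OF u(1)]])
    then show ?thesis using l(2) u(1) by force
  qed
  then show ?thesis using l(1) by blast
qed

end

section \<open>Boundedness of linear minorants\<close>

context recourse_problem
begin

text \<open>The recourse \<open>y\<close> for the same \<open>x1\<close> belongs to the definition
  because dyadic means will mix the decision for one perturbation with recourses in all other
  positions, under a common bound \<open>N\<close>.\<close>

definition bounded_recourse :: "real \<Rightarrow> ('a \<Rightarrow> 'z) \<Rightarrow> bool"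
  where "bounded_recourse N u \<longleftrightarrow> u \<in> bdd_measurable M \<and>
    (\<exists>x1 x2 y. norm x1 \<le> N \<and> norm_le_on M x2 N \<and> norm_le_on M y N \<and>
      adm x1 x2 u \<and> adm x1 y (\<lambda>_. 0))"

lemma bounded_recourse_measurable: "bounded_recourse N u \<Longrightarrow> u \<in> bdd_measurable M"
  by (simp add: bounded_recourse_def)

lemma bounded_recourse_mono:
  assumes "bounded_recourse N u" "N \<le> N'"
  shows "bounded_recourse N' u"
proof -
  obtain x1 x2 y where x: "norm x1 \<le> N" "norm_le_on M x2 N"
    "norm_le_on M y N" "adm x1 x2 u" "adm x1 y (\<lambda>_. 0)"
    using assms(1) unfolding bounded_recourse_def by (elim exE conjE)
  have "norm x1 \<le> N'" "norm_le_on M x2 N'" "norm_le_on M y N'"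
    using x(1-3) assms(2) by force+
  then show ?thesis unfolding bounded_recourse_def
    using x bounded_recourse_measurable[OF assms(1)]
    by (intro conjI exI[of _ x1] exI[of _ x2] exI[of _ y])
qed

lemma adm_cong:
  assumes "\<And>w. w \<in> space M \<Longrightarrow> u w = v w" "adm x1 x2 u"
  shows "adm x1 x2 v"
proof -
  have "AE w in M. (x1, x2 w, u w) \<in> G w" using assms(2) by (simp add: admissible_def)
  then have "AE w in M. (x1, x2 w, v w) \<in> G w"
    using AE_space by eventually_elim (simp add: assms(1))
  then show ?thesis using assms(2) by (simp add: admissible_def)
qed

lemma bdd_measurable_cong:
  assumes "\<And>w. w \<in> space M \<Longrightarrow> u w = v w" "u \<in> bdd_measurable M"
  shows "v \<in> bdd_measurable M"
proof -
  obtain c where "c > 0" "norm_le_on M u c"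
    by (rule bdd_measurable_bound[OF assms(2)])
  moreover have "v \<in> borel_measurable M"
    using bdd_measurableD[OF assms(2)] measurable_cong[of M u v borel] assms(1) by blast
  ultimately show ?thesis using assms(1) by (intro bdd_measurableI[of _ _ c]) auto
qed

lemma bounded_recourse_cong:
  assumes "\<And>w. w \<in> space M \<Longrightarrow> u w = v w" "bounded_recourse N u"
  shows "bounded_recourse N v"
proof -
  obtain x1 x2 y where x: "norm x1 \<le> N" "norm_le_on M x2 N"
    "norm_le_on M y N" "adm x1 x2 u" "adm x1 y (\<lambda>_. 0)"
    using assms(2) unfolding bounded_recourse_def by (elim exE conjE)
  have "adm x1 x2 v" "v \<in> bdd_measurable M"
    by (rule adm_cong[OF _ x(4)] bdd_measurable_cong[OF _ bounded_recourse_measurable[OF assms(2)]],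
        erule assms(1))+
  then show ?thesis unfolding bounded_recourse_def
    using x by (intro conjI exI[of _ x1] exI[of _ x2] exI[of _ y])
qed

lemma ex_bounded_recourse:
  assumes u: "u \<in> bdd_measurable M" and x: "adm x1 x2 u"
  shows "\<exists>n::nat. bounded_recourse (real n) u"
proof -
  obtain y where y: "adm x1 y (\<lambda>_. 0)" using recourse[OF x] by blast
  have m: "x2 \<in> bdd_measurable M" "y \<in> bdd_measurable M"
    using x y by (auto simp: admissible_def)
  obtain c where c: "c > 0" "norm_le_on M x2 c"
    by (rule bdd_measurable_bound[OF m(1)])
  obtain d where d: "d > 0" "norm_le_on M y d"
    by (rule bdd_measurable_bound[OF m(2)])
  obtain n :: nat where "max (norm x1) (max c d) \<le> real n"
    using real_arch_simple by blast
  then have "norm x1 \<le> real n" "\<forall>w\<in>space M. norm (x2 w) \<le> real n" "\<forall>w\<in>space M. norm (y w) \<le> real n"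
    using c d by force+
  then show ?thesis
    using u x y unfolding bounded_recourse_def
    by (intro exI[of _ n] conjI exI[of _ x1] exI[of _ x2] exI[of _ y])
qed

lemma bounded_recourse_convex:
  assumes u: "bounded_recourse N u" and v: "bounded_recourse N v" and t: "0 \<le> t" "t \<le> 1"
  shows "bounded_recourse N (\<lambda>w. t *\<^sub>R u w + (1 - t) *\<^sub>R v w)"
proof -
  obtain x1 x2 y where x: "norm x1 \<le> N" "norm_le_on M x2 N"
    "norm_le_on M y N" "adm x1 x2 u" "adm x1 y (\<lambda>_. 0)"
    using u unfolding bounded_recourse_def by blast
  obtain z1 z2 q where z: "norm z1 \<le> N" "norm_le_on M z2 N"
    "norm_le_on M q N" "adm z1 z2 v" "adm z1 q (\<lambda>_. 0)"
    using v unfolding bounded_recourse_def by blast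
  have nrm: "norm (t *\<^sub>R a + (1 - t) *\<^sub>R b) \<le> N" if "norm a \<le> N" "norm b \<le> N" for a b :: "'n::real_normed_vector"
  proof -
    have "norm (t *\<^sub>R a + (1 - t) *\<^sub>R b) \<le> t * norm a + (1 - t) * norm b"
      using norm_triangle_ineq[of "t *\<^sub>R a" "(1 - t) *\<^sub>R b"] t by simp
    also have "\<dots> \<le> t * N + (1 - t) * N"
      using that t by (intro add_mono mult_left_mono) auto
    finally show ?thesis by (simp add: algebra_simps)
  qed
  show ?thesis
    unfolding bounded_recourse_def
  proof (intro conjI exI)
    show "(\<lambda>w. t *\<^sub>R u w + (1 - t) *\<^sub>R v w) \<in> bdd_measurable M"
      using u v by (intro bdd_measurable_add bdd_measurable_scaleR bounded_recourse_measurable)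
    show "norm (t *\<^sub>R x1 + (1 - t) *\<^sub>R z1) \<le> N" using x z by (intro nrm)
    show "\<forall>w\<in>space M. norm (t *\<^sub>R x2 w + (1 - t) *\<^sub>R z2 w) \<le> N" using x z by (intro ballI nrm) auto
    show "\<forall>w\<in>space M. norm (t *\<^sub>R y w + (1 - t) *\<^sub>R q w) \<le> N" using x z by (intro ballI nrm) auto
    show "adm (t *\<^sub>R x1 + (1 - t) *\<^sub>R z1) (\<lambda>w. t *\<^sub>R x2 w + (1 - t) *\<^sub>R z2 w) (\<lambda>w. t *\<^sub>R u w + (1 - t) *\<^sub>R v w)"
      by (rule adm_convex[OF x(4) z(4) t])
    show "adm (t *\<^sub>R x1 + (1 - t) *\<^sub>R z1) (\<lambda>w. t *\<^sub>R y w + (1 - t) *\<^sub>R q w) (\<lambda>_. 0)"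
      using adm_convex[OF x(5) z(5) t] by simp
  qed
qed

text \<open>Pointwise in \<open>w\<close> this is \<open>dyadic_mean_in\<close> for the closed
  convex set \<open>G w\<close> in the product space; the exceptional null sets are countably
  many.\<close>

lemma adm_dyadic_mean:
  assumes x1: "\<And>k. norm (x1 k) \<le> N" and x2: "\<And>k w. w \<in> space M \<Longrightarrow> norm (x2 k w) \<le> N"
    and u: "\<And>k w. w \<in> space M \<Longrightarrow> norm (u k w) \<le> c" and adm: "\<And>k. adm (x1 k) (x2 k) (u k)"
  shows "adm (dyadic_mean x1) (\<lambda>w. dyadic_mean (\<lambda>k. x2 k w)) (\<lambda>w. dyadic_mean (\<lambda>k. u k w))"
  unfolding admissible_def
proof
  show "(\<lambda>w. dyadic_mean (\<lambda>k. x2 k w)) \<in> bdd_measurable M"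
    using adm x2 by (intro bdd_measurable_dyadic_mean) (auto simp: admissible_def bdd_measurableD)
  have "AE w in M. \<forall>k. (x1 k, x2 k w, u k w) \<in> G w"
    using adm by (simp add: AE_all_countable admissible_def)
  then show "AE w in M. (dyadic_mean x1, dyadic_mean (\<lambda>k. x2 k w), dyadic_mean (\<lambda>k. u k w)) \<in> G w"
    using AE_space
  proof eventually_elim
    case (elim w)
    have xu: "norm (x2 k w, u k w) \<le> N + c" for k
      using norm_Pair_le[of "x2 k w" "u k w"] x2[OF elim(2), of k] u[OF elim(2), of k] by simp
    have xxu: "norm (x1 k, x2 k w, u k w) \<le> N + (N + c)" for k
      using norm_Pair_le[of "x1 k" "(x2 k w, u k w)"] x1[of k] xu[of k] by simp
    have "dyadic_mean (\<lambda>k. (x1 k, x2 k w, u k w)) \<in> G w"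
      using elim(1) xxu closed_G[OF elim(2)] convex_G[OF elim(2)]
      by (intro dyadic_mean_in[of _ _ "N + (N + c)"]) auto
    also have "dyadic_mean (\<lambda>k. (x1 k, x2 k w, u k w)) = (dyadic_mean x1, dyadic_mean (\<lambda>k. (x2 k w, u k w)))"
      by (rule dyadic_mean_Pair[OF x1 xu])
    also have "dyadic_mean (\<lambda>k. (x2 k w, u k w)) = (dyadic_mean (\<lambda>k. x2 k w), dyadic_mean (\<lambda>k. u k w))"
      by (rule dyadic_mean_Pair[OF x2[OF elim(2)] u[OF elim(2)]])
    finally show ?case .
  qed
qed

lemma bounded_recourse_choice:
  assumes "\<And>k::nat. bounded_recourse N (u k)"
  shows "\<exists>x1 x2 y. \<forall>k. norm (x1 k) \<le> N \<and> norm_le_on M (x2 k) N \<and>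
    norm_le_on M (y k) N \<and> adm (x1 k) (x2 k) (u k) \<and> adm (x1 k) (y k) (\<lambda>_. 0)"
proof -
  have "\<forall>k. \<exists>x1 x2 y. norm x1 \<le> N \<and> norm_le_on M x2 N \<and>
    norm_le_on M y N \<and> adm x1 x2 (u k) \<and> adm x1 y (\<lambda>_. 0)"
    using assms by (auto simp: bounded_recourse_def)
  from choice[OF this] obtain x1 where "\<forall>k. \<exists>x2 y. norm (x1 k) \<le> N \<and> norm_le_on M x2 N \<and>
    norm_le_on M y N \<and> adm (x1 k) x2 (u k) \<and> adm (x1 k) y (\<lambda>_. 0)" by (elim exE)
  from choice[OF this] obtain x2 where "\<forall>k. \<exists>y. norm (x1 k) \<le> N \<and> norm_le_on M (x2 k) N \<and>
    norm_le_on M y N \<and> adm (x1 k) (x2 k) (u k) \<and> adm (x1 k) y (\<lambda>_. 0)" by (elim exE)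
  from choice[OF this] show ?thesis by (elim exE) (intro exI)
qed

lemma bounded_recourse_dyadic_mean:
  assumes good: "\<And>k. bounded_recourse N (u k)" and c: "\<And>k w. w \<in> space M \<Longrightarrow> norm (u k w) \<le> c"
  shows "bounded_recourse N (\<lambda>w. dyadic_mean (\<lambda>k. u k w))"
proof -
  obtain x1 x2 y where x: "\<forall>k. norm (x1 k) \<le> N \<and> norm_le_on M (x2 k) N \<and>
    norm_le_on M (y k) N \<and> adm (x1 k) (x2 k) (u k) \<and> adm (x1 k) (y k) (\<lambda>_. 0)"
    using bounded_recourse_choice[of N u, OF good] by (elim exE)
  show ?thesis
    unfolding bounded_recourse_def
  proof (intro conjI exI)
    show "(\<lambda>w. dyadic_mean (\<lambda>k. u k w)) \<in> bdd_measurable M"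
      by (rule bdd_measurable_dyadic_mean[OF bdd_measurableD[OF bounded_recourse_measurable[OF good]] c])
    show "norm (dyadic_mean x1) \<le> N" using x by (intro norm_dyadic_mean_le) auto
    show "\<forall>w\<in>space M. norm (dyadic_mean (\<lambda>k. x2 k w)) \<le> N" "\<forall>w\<in>space M. norm (dyadic_mean (\<lambda>k. y k w)) \<le> N"
      using x by (auto intro!: norm_dyadic_mean_le)
    show "adm (dyadic_mean x1) (\<lambda>w. dyadic_mean (\<lambda>k. x2 k w)) (\<lambda>w. dyadic_mean (\<lambda>k. u k w))"
      using x c by (intro adm_dyadic_mean) auto
    have "adm (dyadic_mean x1) (\<lambda>w. dyadic_mean (\<lambda>k. y k w)) (\<lambda>w. dyadic_mean (\<lambda>k. 0))"
      using x by (intro adm_dyadic_mean[where c = 0]) auto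
    then show "adm (dyadic_mean x1) (\<lambda>w. dyadic_mean (\<lambda>k. y k w)) (\<lambda>w. 0)"
      by (simp add: dyadic_mean_def)
  qed
qed

text \<open>Baire's argument by nested balls. The levels of \<open>bounded_recourse\<close> exhaust
  the ball of radius \<open>\<delta>\<close>; if each of them were nowhere dense there, balls
  avoiding one level after the other could be nested, and the limit of their centres would belong to
  no level. The decision for \<open>- u0\<close> is recorded for moving the centre to 0
  later.\<close>

lemma bounded_recourse_somewhere_dense:
  "\<exists>(n::nat) u0 \<epsilon>. u0 \<in> bdd_measurable M \<and> \<epsilon> > 0 \<and> (\<exists>x1 x2. adm x1 x2 (\<lambda>w. - u0 w)) \<and>
    (\<forall>u\<in>bdd_measurable M. (\<forall>w\<in>space M. norm (u w - u0 w) \<le> \<epsilon>) \<longrightarrow> (\<forall>\<eta>>0.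
      \<exists>a. bounded_recourse n a \<and> (\<forall>w\<in>space M. norm (a w - u w) \<le> \<eta>)))"
proof -
  obtain \<delta> where d: "\<delta> > 0" "\<And>u. u \<in> bdd_measurable M \<Longrightarrow> norm_le_on M u \<delta> \<Longrightarrow> \<exists>x1 x2. adm x1 x2 u"
    using strict by blast
  \<comment> \<open>The pair \<open>p\<close> is a centre with a positive radius; \<open>P\<close>
    keeps the ball inside the ball of radius \<open>\<delta>\<close> around 0.\<close>
  define P :: "('a \<Rightarrow> 'z) \<times> real \<Rightarrow> bool" where
    "P p \<longleftrightarrow> fst p \<in> bdd_measurable M \<and> snd p > 0 \<and> (\<forall>w\<in>space M. norm (fst p w) + snd p \<le> \<delta>)" for p
  \<comment> \<open>Ball \<open>q\<close> lies in ball \<open>p\<close>, has at most half its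
    radius, and misses level \<open>n\<close>.\<close>
  define Q :: "nat \<Rightarrow> ('a \<Rightarrow> 'z) \<times> real \<Rightarrow> ('a \<Rightarrow> 'z) \<times> real \<Rightarrow> bool" where
    "Q n p q \<longleftrightarrow> snd q \<le> snd p / 2 \<and> (\<forall>w\<in>space M. norm (fst q w - fst p w) \<le> snd p / 2) \<and>
      (\<forall>a. bounded_recourse n a \<longrightarrow> \<not> (\<forall>w\<in>space M. norm (a w - fst q w) \<le> snd q))" for n p q
  have "\<exists>n u0 \<epsilon>. u0 \<in> bdd_measurable M \<and> norm_le_on M u0 \<delta> \<and> \<epsilon> > 0 \<and>
      (\<forall>u\<in>bdd_measurable M. (\<forall>w\<in>space M. norm (u w - u0 w) \<le> \<epsilon>) \<longrightarrow> (\<forall>\<eta>>0.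
      \<exists>a. bounded_recourse (real n) a \<and> (\<forall>w\<in>space M. norm (a w - u w) \<le> \<eta>)))" (is ?dense)
  proof (rule ccontr)
    assume neg: "\<not> ?dense"
    have step: "\<exists>q. P q \<and> Q n p q" if p: "P p" for n p
    proof -
      have "norm (fst p w) \<le> \<delta>" if "w \<in> space M" for w
        using p that unfolding P_def by (smt (verit))
      then obtain u \<eta> where u: "u \<in> bdd_measurable M" "\<forall>w\<in>space M. norm (u w - fst p w) \<le> snd p / 2" "\<eta> > 0"
        and a: "\<forall>a. bounded_recourse n a \<longrightarrow> \<not> (\<forall>w\<in>space M. norm (a w - u w) \<le> \<eta>)"
        using neg p unfolding P_def by (metis half_gt_zero)
      \<comment> \<open>The new radius must not exceed \<open>\<eta>\<close>, to miss level
        \<open>n\<close>, nor half the old radius, to stay inside the old ball.\<close>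
      have "norm (u w) + min \<eta> (snd p / 2) \<le> \<delta>" if w: "w \<in> space M" for w
      proof -
        have "norm (u w) \<le> norm (fst p w) + norm (u w - fst p w)"
          using norm_triangle_sub by blast
        then show ?thesis using u(2) w p unfolding P_def by (smt (verit) field_sum_of_halves)
      qed
      then have "P (u, min \<eta> (snd p / 2))" using u p by (simp add: P_def)
      moreover have "Q n p (u, min \<eta> (snd p / 2))"
        unfolding Q_def
      proof (intro conjI allI impI)
        fix b assume "bounded_recourse n b"
        then obtain w where "w \<in> space M" "\<not> norm (b w - u w) \<le> \<eta>" using a by blast
        then show "\<not> (\<forall>w\<in>space M. norm (b w - fst (u, min \<eta> (snd p / 2)) w) \<le> snd (u, min \<eta> (snd p / 2)))"
          by auto
      qed (use u in auto)
      ultimately show ?thesis by blast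
    qed
    have "P (\<lambda>_. 0, \<delta>)" using d by (simp add: P_def bdd_measurable_zero)
    from dependent_nat_choice[where P = "\<lambda>n. P" and Q = Q, OF exI[of P, OF this] step]
    obtain f where f: "\<And>n. P (f n)" "\<And>n. Q n (f n) (f (Suc n))" by blast
    define v where "v n = fst (f n)" for n
    define r where "r n = snd (f n)" for n
    have v: "v n \<in> bdd_measurable M" "r n > 0" "\<And>w. w \<in> space M \<Longrightarrow> norm (v n w) \<le> \<delta>" for n
      using f(1)[of n] unfolding P_def v_def r_def by (auto intro: order_trans[rotated])
    have s: "r (Suc n) \<le> r n / 2" "\<And>w. w \<in> space M \<Longrightarrow> norm (v (Suc n) w - v n w) \<le> r n / 2"
      "\<And>a. bounded_recourse n a \<Longrightarrow> \<not> (\<forall>w\<in>space M. norm (a w - v (Suc n) w) \<le> r (Suc n))" for n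
      using f(2)[of n] unfolding Q_def v_def r_def by auto
    have nest: "norm (v (n + k) w - v n w) + r (n + k) \<le> r n" if w: "w \<in> space M" for n k w
    proof (induction k)
      case (Suc k)
      have "norm (v (n + Suc k) w - v n w) \<le> norm (v (Suc (n + k)) w - v (n + k) w) + norm (v (n + k) w - v n w)"
        using norm_triangle_ineq[of "v (Suc (n + k)) w - v (n + k) w" "v (n + k) w - v n w"] by simp
      also have "\<dots> \<le> r (n + k) / 2 + (r n - r (n + k))"
        using s(2)[OF w, of "n + k"] Suc by simp
      finally show ?case using s(1)[of "n + k"] by simp
    qed simp
    have r0: "r n \<le> r 0 * (1/2) ^ n" for n
      using s(1) by (induction n) (auto intro: order_trans)
    have rlim: "(\<lambda>n. r 0 * (1/2) ^ n) \<longlonglongrightarrow> 0"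
      by (intro tendsto_mult_right_zero LIMSEQ_power_zero) auto
    have close: "norm (v m w - v n w) \<le> r n" if "w \<in> space M" "n \<le> m" for m n w
      using nest[OF that(1), of n "m - n"] v(2)[of m] that(2) by simp
    have conv: "convergent (\<lambda>n. v n w)" if w: "w \<in> space M" for w
    proof (rule Cauchy_convergent, rule CauchyI')
      fix e' :: real assume "e' > 0"
      define e where "e = e' / 2"
      have "e > 0" "e' = 2 * e" using \<open>e' > 0\<close> by (auto simp: e_def)
      then obtain n0 where "r 0 * (1/2) ^ n0 < e"
        using order_tendstoD(2)[OF rlim, of e] by (auto simp: eventually_sequentially)
      then have "r n0 < e" using r0[of n0] by simp
      moreover have "norm (v m w - v n w) \<le> 2 * r n0" if "m \<ge> n0" "n > m" for m n
        using close[OF w, of n0 m] close[OF w, of n0 n] that norm_triangle_ineq4[of "v m w - v n0 w" "v n w - v n0 w"] by simp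
      ultimately have "norm (v m w - v n w) < 2 * e" if "m \<ge> n0" "n > m" for m n
        using that by (smt (verit))
      then show "\<exists>M. \<forall>m\<ge>M. \<forall>n>m. dist (v m w) (v n w) < e'"
        unfolding dist_norm \<open>e' = 2 * e\<close> by blast
    qed
    define L where "L w = (if w \<in> space M then lim (\<lambda>n. v n w) else 0)" for w
    have lim: "(\<lambda>n. v n w) \<longlonglongrightarrow> L w" if "w \<in> space M" for w
      using conv[OF that] that by (simp add: L_def convergent_LIMSEQ_iff)
    have Lclose: "norm (L w - v n w) \<le> r n" if w: "w \<in> space M" for n w
    proof (rule LIMSEQ_le_const2)
      show "(\<lambda>m. norm (v m w - v n w)) \<longlonglongrightarrow> norm (L w - v n w)"
        by (intro tendsto_intros lim w)
      show "\<exists>N. \<forall>m\<ge>N. norm (v m w - v n w) \<le> r n" using close[OF w] by blast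
    qed
    have Lb: "norm (L w) \<le> \<delta>" if w: "w \<in> space M" for w
      using v(3)[OF w] by (intro LIMSEQ_le_const2[OF tendsto_norm[OF lim[OF w]]]) auto
    have "L \<in> borel_measurable M"
      by (rule borel_measurable_LIMSEQ_metric[OF bdd_measurableD[OF v(1)] lim])
    then have L: "L \<in> bdd_measurable M" using Lb by (rule bdd_measurableI)
    obtain n where "bounded_recourse (real n) L"
      using d(2)[OF L] Lb ex_bounded_recourse[OF L] by blast
    \<comment> \<open>\<open>L\<close> lies in every ball, in particular in ball
      \<open>Suc n\<close>, which was chosen to miss level \<open>n\<close>.\<close>
    then show False using s(3)[of n L] Lclose[of _ "Suc n"] by blast
  qed
  then obtain n u0 \<epsilon> where h: "u0 \<in> bdd_measurable M" "norm_le_on M u0 \<delta>" "\<epsilon> > 0"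
      "\<forall>u\<in>bdd_measurable M. (\<forall>w\<in>space M. norm (u w - u0 w) \<le> \<epsilon>) \<longrightarrow> (\<forall>\<eta>>0.
      \<exists>a. bounded_recourse (real n) a \<and> (\<forall>w\<in>space M. norm (a w - u w) \<le> \<eta>))"
    by (elim exE conjE)
  have "\<exists>x1 x2. adm x1 x2 (\<lambda>w. - u0 w)"
    using h(2) by (intro d(2) bdd_measurable_minus h(1)) simp
  then show ?thesis
    using h by (intro exI[of _ n] exI[of _ u0] exI[of _ \<epsilon>] conjI)
qed

text \<open>Every \<open>u\<close> is the midpoint of \<open>u0 + 2 u\<close> and
  \<open>- u0\<close>. The first is approximated at level \<open>n\<close>, the second belongs to
  level \<open>m\<close>, and midpoints stay at the larger level. Doubling \<open>u\<close> accounts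
  for the radius \<open>\<epsilon> / 2\<close>.\<close>

lemma bounded_recourse_dense_ball:
  "\<exists>N \<rho>. \<rho> > 0 \<and> (\<forall>u\<in>bdd_measurable M. norm_le_on M u \<rho> \<longrightarrow> (\<forall>\<eta>>0.
      \<exists>a. bounded_recourse N a \<and> (\<forall>w\<in>space M. norm (a w - u w) \<le> \<eta>)))"
proof -
  obtain n :: nat and u0 \<epsilon> z1 z2 where u0: "u0 \<in> bdd_measurable M" "\<epsilon> > 0"
    "adm z1 z2 (\<lambda>w. - u0 w)"
    "\<forall>u\<in>bdd_measurable M. (\<forall>w\<in>space M. norm (u w - u0 w) \<le> \<epsilon>) \<longrightarrow> (\<forall>\<eta>>0.
      \<exists>a. bounded_recourse n a \<and> (\<forall>w\<in>space M. norm (a w - u w) \<le> \<eta>))"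
    using bounded_recourse_somewhere_dense by (elim exE conjE)
  obtain m :: nat where m: "bounded_recourse m (\<lambda>w. - u0 w)"
    using ex_bounded_recourse[OF bdd_measurable_minus[OF u0(1)] u0(3)] by blast
  show ?thesis
  proof (rule exI[of _ "real (max n m)"], rule exI[of _ "\<epsilon> / 2"], intro conjI ballI impI allI)
    fix u :: "'a \<Rightarrow> 'z" and \<eta> :: real
    assume u: "u \<in> bdd_measurable M" "\<forall>w\<in>space M. norm (u w) \<le> \<epsilon> / 2" and e: "\<eta> > 0"
    have "\<exists>a. bounded_recourse n a \<and> (\<forall>w\<in>space M. norm (a w - (u0 w + 2 *\<^sub>R u w)) \<le> \<eta>)"
      using u by (intro u0(4)[rule_format, OF _ _ e] bdd_measurable_add bdd_measurable_scaleR u0(1)) auto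
    then obtain a where a: "bounded_recourse n a" "\<forall>w\<in>space M. norm (a w - (u0 w + 2 *\<^sub>R u w)) \<le> \<eta>" by blast
    have "bounded_recourse (max n m) (\<lambda>w. (1/2) *\<^sub>R a w + (1 - 1/2) *\<^sub>R (- u0 w))"
      by (intro bounded_recourse_convex bounded_recourse_mono[OF a(1)] bounded_recourse_mono[OF m]) auto
    moreover have "norm ((1/2) *\<^sub>R a w + (1 - 1/2) *\<^sub>R (- u0 w) - u w) \<le> \<eta>" if "w \<in> space M" for w
    proof -
      have "(1/2) *\<^sub>R a w + (1 - 1/2) *\<^sub>R (- u0 w) - u w = (1/2) *\<^sub>R (a w - (u0 w + 2 *\<^sub>R u w))"
        by (simp add: scaleR_diff_right scaleR_add_right)
      then show ?thesis using a(2) that e by (simp del: scaleR_half_double) (smt (verit))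
    qed
    ultimately show "\<exists>a. bounded_recourse (max n m) a \<and> (\<forall>w\<in>space M. norm (a w - u w) \<le> \<eta>)" by blast
  qed (use u0 in auto)
qed

text \<open>As in the open mapping theorem, density is upgraded by successive approximation:
  approximate within half the radius, double the remainder, and repeat. This writes \<open>u\<close>
  as a dyadic mean of functions of level \<open>N\<close>, and a level is closed under bounded
  dyadic means.\<close>

lemma bounded_recourse_ball:
  "\<exists>N \<rho>. \<rho> > 0 \<and> (\<forall>u\<in>bdd_measurable M. norm_le_on M u \<rho> \<longrightarrow> bounded_recourse N u)"
proof -
  obtain N \<rho> where r: "\<rho> > 0"
    and dense: "\<forall>u\<in>bdd_measurable M. norm_le_on M u \<rho> \<longrightarrow> (\<forall>\<eta>>0.
      \<exists>a. bounded_recourse N a \<and> (\<forall>w\<in>space M. norm (a w - u w) \<le> \<eta>))"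
    using bounded_recourse_dense_ball by (elim exE conjE)
  show ?thesis
  proof (rule exI[of _ N], rule exI[of _ "\<rho> / 2"], intro conjI ballI impI)
    fix u :: "'a \<Rightarrow> 'z" assume u: "u \<in> bdd_measurable M" "\<forall>w\<in>space M. norm (u w) \<le> \<rho> / 2"
    define P where "P q \<longleftrightarrow> q \<in> bdd_measurable M \<and> norm_le_on M q \<rho>" for q :: "'a \<Rightarrow> 'z"
    define Q where "Q q q' \<longleftrightarrow> (\<exists>a. bounded_recourse N a \<and> (\<forall>w\<in>space M. norm (a w - q w) \<le> \<rho> / 2) \<and>
      q' = (\<lambda>w. 2 *\<^sub>R (q w - a w)))" for q q' :: "'a \<Rightarrow> 'z"
    have step: "\<exists>q'. P q' \<and> Q q q'" if q: "P q" for q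
    proof -
      obtain a where a: "bounded_recourse N a" "\<forall>w\<in>space M. norm (a w - q w) \<le> \<rho> / 2"
        using dense[rule_format, of q "\<rho> / 2"] q r unfolding P_def by auto
      have "(\<lambda>w. 2 *\<^sub>R (q w - a w)) \<in> bdd_measurable M"
        using q bounded_recourse_measurable[OF a(1)] unfolding P_def
        by (intro bdd_measurable_scaleR bdd_measurable_diff) auto
      then have "P (\<lambda>w. 2 *\<^sub>R (q w - a w))"
        using a(2) by (simp add: P_def norm_minus_commute mult.commute)
      then show ?thesis using a unfolding Q_def by blast
    qed
    \<comment> \<open>Starting at \<open>2 u\<close> makes up for the first weight being 1/2; this
      halves the radius of the ball.\<close>
    have "P (\<lambda>w. 2 *\<^sub>R u w)" using u by (auto simp: P_def intro!: bdd_measurable_scaleR)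
    then have "\<exists>q. (\<forall>n::nat. P (q n) \<and> Q (q n) (q (Suc n))) \<and> q 0 = (\<lambda>w. 2 *\<^sub>R u w)"
      using dependent_nat_choice[where P = "\<lambda>n q. P q \<and> (n = 0 \<longrightarrow> q = (\<lambda>w. 2 *\<^sub>R u w))" and Q = "\<lambda>n. Q"]
        step by (metis nat.distinct(1))
    then obtain q where q: "\<And>n::nat. P (q n)" "\<And>n. Q (q n) (q (Suc n))" "q 0 = (\<lambda>w. 2 *\<^sub>R u w)" by blast
    have "\<forall>n. \<exists>a. bounded_recourse N a \<and> (\<forall>w\<in>space M. norm (a w - q n w) \<le> \<rho> / 2) \<and>
      q (Suc n) = (\<lambda>w. 2 *\<^sub>R (q n w - a w))"
      using q(2) unfolding Q_def by blast
    from choice[OF this] obtain a where a: "\<And>n. bounded_recourse N (a n)"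
      "\<And>n w. w \<in> space M \<Longrightarrow> norm (a n w - q n w) \<le> \<rho> / 2" "\<And>n. q (Suc n) = (\<lambda>w. 2 *\<^sub>R (q n w - a n w))"
      by (elim exE) blast
    have qb: "norm (q n w) \<le> \<rho>" if "w \<in> space M" for n w
      using q(1)[of n] that by (auto simp: P_def)
    have ab: "norm (a n w) \<le> 2 * \<rho>" if w: "w \<in> space M" for n w
      using norm_triangle_sub[of "a n w" "q n w"] a(2)[OF w, of n] qb[OF w, of n] r by simp
    have "dyadic_mean (\<lambda>k. a k w) = u w" if w: "w \<in> space M" for w
    proof -
      \<comment> \<open>The remainder is \<open>q n\<close> with weight
        \<open>(1/2) ^ Suc n\<close>, which tends to 0 since all \<open>q n\<close> are bounded by
        \<open>\<rho>\<close>.\<close>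
      have part: "(\<Sum>k<n. (1/2) ^ Suc k *\<^sub>R a k w) = u w - (1/2) ^ Suc n *\<^sub>R q n w" for n
      proof (induction n)
        case (Suc n)
        have "(1/2) ^ Suc (Suc n) *\<^sub>R q (Suc n) w = (1/2) ^ Suc n *\<^sub>R (q n w - a n w)"
          unfolding a(3) by simp
        then show ?case using Suc by (simp add: scaleR_diff_right del: power_Suc)
      qed (simp add: q(3))
      have "(\<lambda>n. (1/2) ^ Suc n *\<^sub>R q n w) \<longlonglongrightarrow> 0"
      proof (rule Lim_null_comparison)
        show "\<forall>\<^sub>F n in sequentially. norm ((1/2) ^ Suc n *\<^sub>R q n w) \<le> (1/2) ^ Suc n * \<rho>"
          using qb[OF w] by (auto intro!: always_eventually mult_left_mono simp del: power_Suc)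
        show "(\<lambda>n. (1/2) ^ Suc n * \<rho>) \<longlonglongrightarrow> 0"
          using tendsto_mult_left_zero[OF LIMSEQ_Suc[OF LIMSEQ_power_zero[of "1/2::real"]], of \<rho>] by simp
      qed
      then have "(\<lambda>n. \<Sum>k<n. (1/2) ^ Suc k *\<^sub>R a k w) \<longlonglongrightarrow> u w - 0"
        unfolding part by (intro tendsto_diff tendsto_const)
      moreover have "(\<lambda>n. \<Sum>k<n. (1/2) ^ Suc k *\<^sub>R a k w) \<longlonglongrightarrow> dyadic_mean (\<lambda>k. a k w)"
        using dyadic_mean_sums[of "\<lambda>k. a k w", OF ab[OF w]] unfolding sums_def .
      ultimately show ?thesis using LIMSEQ_unique by fastforce
    qed
    then show "bounded_recourse N u"
      using bounded_recourse_dyadic_mean[OF a(1) ab] by (rule bounded_recourse_cong)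
  qed (use r in auto)
qed

lemma linear_minorant_bounded:
  assumes lin: "linear_functional_on (bdd_measurable M) l"
    and le: "\<And>x1 x2 u. u \<in> bdd_measurable M \<Longrightarrow> adm x1 x2 u \<Longrightarrow> l u \<le> cost x1 x2 - v0"
  shows "\<exists>c. \<forall>u\<in>bdd_measurable M. \<forall>b>0. norm_le_on M u b \<longrightarrow> \<bar>l u\<bar> \<le> c * b"
proof -
  have scl: "l (\<lambda>w. t *\<^sub>R u w) = t * l u" if "u \<in> bdd_measurable M" for t and u :: "'a \<Rightarrow> 'z"
    using lin that by (simp add: linear_functional_on_def)
  obtain N \<rho> where r: "\<rho> > 0"
    "\<forall>u\<in>bdd_measurable M. norm_le_on M u \<rho> \<longrightarrow> bounded_recourse N u"
    using bounded_recourse_ball by (elim exE conjE)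
  have "\<exists>B. \<forall>u\<in>bdd_measurable M. norm_le_on M u \<rho> \<longrightarrow> l u \<le> B" (is ?bounded)
  proof (rule ccontr)
    assume "\<not> ?bounded"
    \<comment> \<open>The factor \<open>2 ^ Suc k\<close> cancels the weight with which
      \<open>u k\<close> enters the dyadic mean below.\<close>
    then have "\<forall>k::nat. \<exists>u :: 'a \<Rightarrow> 'z. u \<in> bdd_measurable M \<and> norm_le_on M u \<rho> \<and> l u > real k * 2 ^ Suc k"
      by (meson not_le)
    from choice[OF this] obtain u where u: "\<And>k. u k \<in> bdd_measurable M"
      "\<And>k w. w \<in> space M \<Longrightarrow> norm (u k w) \<le> \<rho>" "\<And>k. l (u k) > real k * 2 ^ Suc k"
      by (elim exE) blast
    have "bounded_recourse N (u k)" for k using u r(2) by simp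
    from bounded_recourse_choice[of N u, OF this] obtain x1 x2 y where
      x: "\<forall>k. norm (x1 k) \<le> N \<and> norm_le_on M (x2 k) N \<and>
        norm_le_on M (y k) N \<and> adm (x1 k) (x2 k) (u k) \<and> adm (x1 k) (y k) (\<lambda>_. 0)"
      by (elim exE)
    define X where "X = dyadic_mean x1"
    have N: "N \<ge> 0" using x norm_ge_zero order_trans by blast
    \<comment> \<open>\<open>a\<close> depends on \<open>X\<close> and \<open>N\<close> only, so the
      costs below are bounded uniformly in \<open>k\<close>.\<close>
    obtain a where a: "\<And>z. norm X + norm z \<le> norm X + N + 1 \<Longrightarrow> \<bar>J2 X z\<bar> \<le> a"
      using bounded_J2[of "norm X + N + 1"] N by (metis add_nonneg_nonneg add_nonneg_pos norm_ge_zero zero_less_one)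
    have "real k \<le> J1 X + a - v0" for k
    proof -
      \<comment> \<open>Position \<open>k\<close> uses the decision for \<open>u k\<close>, every
        other position the recourse for the perturbation 0. The first stages are the same
        \<open>x1 j\<close> either way, so their mean is \<open>X\<close> for every
        \<open>k\<close>.\<close>
      define Z where "Z w = dyadic_mean (\<lambda>j. if j = k then x2 k w else y j w)" for w
      define V where "V w = dyadic_mean (\<lambda>j. if j = k then u k w else 0)" for w
      have V: "V = (\<lambda>w. (1/2) ^ Suc k *\<^sub>R u k w)"
        unfolding V_def by (simp only: dyadic_mean_single)
      have "adm X (\<lambda>w. dyadic_mean (\<lambda>j. (if j = k then x2 k else y j) w)) (\<lambda>w. dyadic_mean (\<lambda>j. (if j = k then u k else (\<lambda>_. 0)) w))"
        unfolding X_def using x u(2) r(1) by (intro adm_dyadic_mean[where N = N and c = \<rho>]) auto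
      then have adm: "adm X Z V" unfolding Z_def V_def by (simp add: if_distribR)
      have Zb: "norm (Z w) \<le> N" if "w \<in> space M" for w
        unfolding Z_def using x that by (intro norm_dyadic_mean_le) auto
      have "(\<integral>w. J2 X (Z w) \<partial>M) \<le> (\<integral>w. a \<partial>M)"
      proof (rule integral_mono_AE)
        show "AE w in M. J2 X (Z w) \<le> a" using a Zb by (intro AE_I2) (smt (verit))
      qed (use adm integrable_J2 in \<open>auto simp: admissible_def\<close>)
      then have "cost X Z \<le> J1 X + a" by (simp add: expected_cost_def prob_space)
      moreover have "l V \<le> cost X Z - v0"
        unfolding V using adm by (intro le bdd_measurable_scaleR u(1)) (simp add: V)
      moreover have "l V = (1/2) ^ Suc k * l (u k)" unfolding V by (rule scl[OF u(1)])
      moreover have "real k \<le> (1/2) ^ Suc k * l (u k)"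
        using u(3)[of k] by (simp add: field_simps)
      ultimately show ?thesis by simp
    qed
    then show False by (metis reals_Archimedean2 not_le)
  qed
  then obtain B where B: "\<And>u. u \<in> bdd_measurable M \<Longrightarrow> \<forall>w\<in>space M. norm (u w) \<le> \<rho> \<Longrightarrow> l u \<le> B" by blast
  show ?thesis
  proof (intro exI[of _ "B / \<rho>"] ballI allI impI)
    fix u :: "'a \<Rightarrow> 'z" and b :: real assume u: "u \<in> bdd_measurable M" "norm_le_on M u b" and b: "b > 0"
    \<comment> \<open>The factor moves \<open>u\<close> into the ball of radius
      \<open>\<rho>\<close>; both signs of \<open>t\<close> are used because \<open>B\<close> bounds
      \<open>l\<close> from above only.\<close>
    have "l (\<lambda>w. t *\<^sub>R u w) \<le> B" if "\<bar>t\<bar> = \<rho> / b" for t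
    proof (intro B bdd_measurable_scaleR u(1) ballI)
      fix w assume "w \<in> space M"
      then have "\<bar>t\<bar> * norm (u w) \<le> \<rho> / b * b"
        unfolding that using u(2) b r(1) by (intro mult_left_mono) auto
      then show "norm (t *\<^sub>R u w) \<le> \<rho>" using b by simp
    qed
    from this[of "\<rho> / b"] this[of "- \<rho> / b"] have "\<rho> / b * l u \<le> B" "- \<rho> / b * l u \<le> B"
      using b r(1) by (simp_all only: scl[OF u(1)]) auto
    then show "\<bar>l u\<bar> \<le> B / \<rho> * b" using b r(1) by (simp add: field_simps abs_le_iff)
  qed
qed

end

section \<open>The absolutely continuous part of a bounded functional\<close>

definition cut_to :: "'a set \<Rightarrow> ('a \<Rightarrow> 'z::real_vector) \<Rightarrow> 'a \<Rightarrow> 'z"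
  where "cut_to A u = (\<lambda>w. indicat_real A w *\<^sub>R u w)"

lemma cut_to_cut_to: "cut_to A (cut_to B u) = cut_to (A \<inter> B) u"
  by (auto simp: cut_to_def indicator_def)

lemma cut_to_add: "cut_to A (\<lambda>w. u w + v w) = (\<lambda>w. cut_to A u w + cut_to A v w)"
  by (auto simp: cut_to_def scaleR_add_right)

lemma cut_to_scaleR: "cut_to A (\<lambda>w. t *\<^sub>R u w) = (\<lambda>w. t *\<^sub>R cut_to A u w)"
  by (auto simp: cut_to_def)

lemma cut_to_Un: "A \<inter> B = {} \<Longrightarrow> cut_to (A \<union> B) u = (\<lambda>w. cut_to A u w + cut_to B u w)"
  by (auto simp: cut_to_def fun_eq_iff split: split_indicator)

lemma norm_cut_to_le: "norm (cut_to A u w) \<le> norm (u w)"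
  by (auto simp: cut_to_def indicator_def)

lemma bdd_measurable_cut_to:
  assumes "A \<in> sets M" "u \<in> bdd_measurable M"
  shows "cut_to A u \<in> bdd_measurable M"
proof -
  obtain c where c: "c > 0" "norm_le_on M u c"
    by (rule bdd_measurable_bound[OF assms(2)])
  have "cut_to A u \<in> borel_measurable M"
    unfolding cut_to_def
    by (intro borel_measurable_scaleR borel_measurable_indicator assms(1) bdd_measurableD assms(2))
  then show ?thesis
    using c norm_cut_to_le[of A u] by (intro bdd_measurableI[of _ _ c]) (auto intro: order_trans)
qed

locale bounded_functional = prob_space M for M :: "'a measure" +
  fixes l :: "('a \<Rightarrow> 'z::{banach, second_countable_topology}) \<Rightarrow> real" and c :: real
  assumes functional_linear: "linear_functional_on (bdd_measurable M) l"
    and functional_bound: "\<And>u b. u \<in> bdd_measurable M \<Longrightarrow> b > 0 \<Longrightarrow> \<forall>w\<in>space M. norm (u w) \<le> b \<Longrightarrow> \<bar>l u\<bar> \<le> c * b"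
begin

lemma l_add: "u \<in> bdd_measurable M \<Longrightarrow> v \<in> bdd_measurable M \<Longrightarrow> l (\<lambda>w. u w + v w) = l u + l v"
  and l_scale: "u \<in> bdd_measurable M \<Longrightarrow> l (\<lambda>w. t *\<^sub>R u w) = t * l u"
  using functional_linear by (auto simp: linear_functional_on_def)

lemma l_zero: "l (\<lambda>_. 0) = 0"
  using l_scale[OF bdd_measurable_zero, of 0] by simp

lemma l_minus: "u \<in> bdd_measurable M \<Longrightarrow> l (\<lambda>w. - u w) = - l u"
  using l_scale[of u "-1"] by simp

lemma l_diff: "u \<in> bdd_measurable M \<Longrightarrow> v \<in> bdd_measurable M \<Longrightarrow> l (\<lambda>w. u w - v w) = l u - l v"
  using l_add[OF _ bdd_measurable_minus, of u v] l_minus[of v] by simp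

section \<open>Variation of a bounded functional as a finitely additive set function\<close>

definition unit_ball :: "('a \<Rightarrow> 'z) set"
  where "unit_ball = {u \<in> bdd_measurable M. \<forall>w\<in>space M. norm (u w) \<le> 1}"

text \<open>The norm of \<open>l\<close> on functions vanishing off \<open>A\<close>. No absolute
  value appears because \<open>unit_ball\<close> is symmetric.\<close>

definition variation :: "'a set \<Rightarrow> real"
  where "variation A = (SUP u\<in>unit_ball. l (cut_to A u))"

lemma cut_to_unit_ball: "A \<in> sets M \<Longrightarrow> u \<in> unit_ball \<Longrightarrow> cut_to A u \<in> unit_ball"
  unfolding unit_ball_def using norm_cut_to_le[of A u]
  by (auto intro: bdd_measurable_cut_to order_trans)

lemma zero_unit_ball: "(\<lambda>_. 0) \<in> unit_ball"
  by (simp add: unit_ball_def bdd_measurable_zero)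

lemma unit_ball_measurable: "u \<in> unit_ball \<Longrightarrow> u \<in> bdd_measurable M"
  by (simp add: unit_ball_def)

lemma cut_to_le_c: "A \<in> sets M \<Longrightarrow> u \<in> unit_ball \<Longrightarrow> l (cut_to A u) \<le> c"
  using cut_to_unit_ball[of A u] functional_bound[of "cut_to A u" 1] by (simp add: unit_ball_def)

lemma variation_ge: "A \<in> sets M \<Longrightarrow> u \<in> unit_ball \<Longrightarrow> l (cut_to A u) \<le> variation A"
  unfolding variation_def using cut_to_le_c
  by (intro cSUP_upper bdd_aboveI2[of _ _ c]) auto

lemma variation_le: "(\<And>u. u \<in> unit_ball \<Longrightarrow> l (cut_to A u) \<le> x) \<Longrightarrow> variation A \<le> x"
  unfolding variation_def using zero_unit_ball by (intro cSUP_least) auto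

lemma variation_nonneg: "A \<in> sets M \<Longrightarrow> 0 \<le> variation A"
  using variation_ge[OF _ zero_unit_ball, of A] by (simp add: cut_to_def l_zero)

lemma variation_le_c: "A \<in> sets M \<Longrightarrow> variation A \<le> c"
  using cut_to_le_c by (intro variation_le)

lemma cut_to_le_variation:
  assumes A: "A \<in> sets M" and u: "u \<in> bdd_measurable M" and b: "b \<ge> 0" "norm_le_on M u b"
  shows "\<bar>l (cut_to A u)\<bar> \<le> b * variation A"
proof (cases "b = 0")
  case True
  \<comment> \<open>The bound on \<open>u\<close> concerns \<open>space M\<close> only; off it
    \<open>cut_to A u\<close> vanishes because \<open>A\<close> is a subset of
    \<open>space M\<close>.\<close>
  have "cut_to A u = (\<lambda>_. 0)"
  proof
    fix w show "cut_to A u w = 0"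
      using b True sets.sets_into_space[OF A] by (cases "w \<in> A") (auto simp: cut_to_def)
  qed
  then show ?thesis using True by (simp add: l_zero)
next
  case False
  then have bp: "b > 0" using b by simp
  have "s * l (cut_to A u) \<le> b * variation A" if s: "\<bar>s\<bar> = 1" for s
  proof -
    have "(\<lambda>w. (s / b) *\<^sub>R u w) \<in> unit_ball"
      using u b bp s by (auto simp: unit_ball_def divide_simps intro!: bdd_measurable_scaleR)
    then have "l (cut_to A (\<lambda>w. (s / b) *\<^sub>R u w)) \<le> variation A" by (rule variation_ge[OF A])
    then show ?thesis
      unfolding cut_to_scaleR l_scale[OF bdd_measurable_cut_to[OF A u]]
      using bp by (simp add: field_simps)
  qed
  from this[of 1] this[of "-1"] show ?thesis by (simp add: abs_le_iff)
qed

lemma variation_empty: "variation {} = 0"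
  using variation_nonneg[of "{}"] variation_le[of "{}" 0] by (simp add: cut_to_def l_zero)

text \<open>For superadditivity, test functions on the disjoint sets \<open>A\<close> and
  \<open>B\<close> are glued into a single one, whose pointwise norm is still at most 1.\<close>

lemma variation_Un:
  assumes A: "A \<in> sets M" and B: "B \<in> sets M" and AB: "A \<inter> B = {}"
  shows "variation (A \<union> B) = variation A + variation B"
proof (rule antisym)
  show "variation (A \<union> B) \<le> variation A + variation B"
  proof (rule variation_le)
    fix u assume u: "u \<in> unit_ball"
    have "l (cut_to (A \<union> B) u) = l (cut_to A u) + l (cut_to B u)"
      unfolding cut_to_Un[OF AB] by (intro l_add bdd_measurable_cut_to A B unit_ball_measurable u)
    then show "l (cut_to (A \<union> B) u) \<le> variation A + variation B"
      using variation_ge[OF A u] variation_ge[OF B u] by simp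
  qed
  have "l (cut_to A u) + l (cut_to B v) \<le> variation (A \<union> B)" if u: "u \<in> unit_ball" and v: "v \<in> unit_ball" for u v
  proof -
    let ?f = "\<lambda>w. cut_to A u w + cut_to B v w"
    have m: "?f \<in> bdd_measurable M"
      by (intro bdd_measurable_add bdd_measurable_cut_to A B unit_ball_measurable u v)
    have "norm (?f w) \<le> 1" if "w \<in> space M" for w
      using AB u v that by (auto simp: unit_ball_def cut_to_def indicator_def)
    then have "?f \<in> unit_ball" using m by (simp add: unit_ball_def)
    then have "l (cut_to (A \<union> B) ?f) \<le> variation (A \<union> B)" using A B by (intro variation_ge) auto
    moreover have "cut_to (A \<union> B) ?f = ?f" by (auto simp: cut_to_def indicator_def)
    moreover have "l ?f = l (cut_to A u) + l (cut_to B v)"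
      by (intro l_add bdd_measurable_cut_to A B unit_ball_measurable u v)
    ultimately show ?thesis by simp
  qed
  then have "variation A \<le> variation (A \<union> B) - l (cut_to B v)" if "v \<in> unit_ball" for v
    using that by (intro variation_le) (simp add: le_diff_eq)
  then have "variation B \<le> variation (A \<union> B) - variation A"
    by (intro variation_le) (simp add: le_diff_eq add.commute)
  then show "variation A + variation B \<le> variation (A \<union> B)" by simp
qed

lemma variation_mono:
  assumes "A \<in> sets M" "B \<in> sets M" "A \<subseteq> B"
  shows "variation A \<le> variation B"
proof -
  have "variation (A \<union> (B - A)) = variation A + variation (B - A)"
    using assms by (intro variation_Un) auto
  moreover have "A \<union> (B - A) = B" using assms by auto
  ultimately show ?thesis using variation_nonneg[of "B - A"] assms by simp
qed

text \<open>The sets \<open>F n\<close> carry the whole singular part of \<open>l\<close>: they capture the limiting variation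
  of sets of vanishing probability, so nothing of it is left on sets disjoint from one of them.\<close>
lemma ex_singular_carrier:
  "\<exists>F. (\<forall>n::nat. F n \<in> sets M) \<and> decseq F \<and> (\<lambda>n. prob (F n)) \<longlonglongrightarrow> 0 \<and>
    (\<forall>\<epsilon>>0. \<exists>\<delta>>0. \<forall>A\<in>sets M. prob A < \<delta> \<longrightarrow> (\<exists>n. A \<inter> F n = {}) \<longrightarrow> variation A \<le> \<epsilon>)"
proof -
  \<comment> \<open>\<open>\<sigma> \<delta>\<close> is the supremal variation of sets of
    probability at most \<open>\<delta>\<close>; its limit \<open>s\<close> as
    \<open>\<delta>\<close> shrinks measures the singular part.\<close>
  define \<sigma> where "\<sigma> \<delta> = (SUP A\<in>{A\<in>sets M. prob A \<le> \<delta>}. variation A)" for \<delta>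
  define s where "s = (INF \<delta>\<in>{0<..}. \<sigma> \<delta>)"
  have \<sigma>_ge: "variation A \<le> \<sigma> \<delta>" if "A \<in> sets M" "prob A \<le> \<delta>" for A \<delta>
    unfolding \<sigma>_def using that variation_le_c by (intro cSUP_upper bdd_aboveI2[of _ _ c]) auto
  have \<sigma>_nonneg: "0 \<le> \<sigma> \<delta>" if "\<delta> > 0" for \<delta>
    using \<sigma>_ge[of "{}" \<delta>] that by (simp add: variation_empty)
  have s_le: "s \<le> \<sigma> \<delta>" if "\<delta> > 0" for \<delta>
    unfolding s_def using that \<sigma>_nonneg by (intro cINF_lower bdd_belowI2[of _ 0]) auto
  have s_approx: "\<exists>\<delta>>0. \<sigma> \<delta> < s + \<epsilon>" if "\<epsilon> > 0" for \<epsilon>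
  proof (rule ccontr)
    assume "\<not> ?thesis"
    then have "s + \<epsilon> \<le> \<sigma> \<delta>" if "\<delta> > 0" for \<delta> using that by (meson not_less)
    then have "s + \<epsilon> \<le> (INF \<delta>\<in>{0<..}. \<sigma> \<delta>)"
      by (intro cINF_greatest) auto
    then have "s + \<epsilon> \<le> s" unfolding s_def .
    then show False using that by simp
  qed
  have "\<exists>A. A \<in> sets M \<and> prob A \<le> (1/2) ^ n \<and> s - (1/2) ^ n \<le> variation A" for n :: nat
  proof (rule ccontr)
    assume "\<not> ?thesis"
    then have "variation A \<le> s - (1/2) ^ n" if "A \<in> sets M" "prob A \<le> (1/2) ^ n" for A
      using that by (meson nle_le)
    then have "\<sigma> ((1/2) ^ n) \<le> s - (1/2) ^ n"
      unfolding \<sigma>_def by (intro cSUP_least) (auto intro!: exI[of _ "{}"])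
    moreover have "(0::real) < (1/2) ^ n" by simp
    ultimately show False using s_le[of "(1/2) ^ n"] by linarith
  qed
  then have "\<forall>n. \<exists>A. A \<in> sets M \<and> prob A \<le> (1/2) ^ n \<and> s - (1/2) ^ n \<le> variation A" by blast
  from choice[OF this] obtain E where E: "\<And>n. E n \<in> sets M" "\<And>n. prob (E n) \<le> (1/2) ^ n"
      "\<And>n. s - (1/2) ^ n \<le> variation (E n)" by blast
  \<comment> \<open>Tail unions make the sequence decreasing. The bounds \<open>(1/2) ^ n\<close>
    are summable, so the probabilities still vanish, and \<open>F n\<close> has at least the
    variation of \<open>E n\<close>.\<close>
  define F where "F n = (\<Union>k. E (n + k))" for n
  have F: "F n \<in> sets M" for n unfolding F_def using E(1) by auto
  have dec: "decseq F"
  proof (rule decseq_SucI)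
    fix n show "F (Suc n) \<subseteq> F n"
    proof
      fix w assume "w \<in> F (Suc n)"
      then obtain k where "w \<in> E (Suc n + k)" by (auto simp: F_def)
      then have "w \<in> E (n + Suc k)" by simp
      then show "w \<in> F n" unfolding F_def by blast
    qed
  qed
  have pF: "prob (F n) \<le> 2 * (1/2) ^ n" for n
  proof -
    have g: "(\<lambda>k. (1/2) ^ (n + k)) sums (2 * (1/2::real) ^ n)"
      using sums_mult[OF geometric_sums[of "1/2::real"], of "(1/2) ^ n"] by (simp add: power_add mult.commute)
    have sm: "summable (\<lambda>k. prob (E (n + k)))"
      using E(2) by (intro summable_comparison_test'[OF sums_summable[OF g], of 0]) auto
    have "prob (F n) \<le> (\<Sum>k. prob (E (n + k)))"
      unfolding F_def using E(1) by (intro finite_measure_subadditive_countably sm) auto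
    also have "\<dots> \<le> (\<Sum>k. (1/2) ^ (n + k))"
      using E(2) by (intro suminf_le sm sums_summable[OF g]) auto
    finally show ?thesis using sums_unique[OF g] by simp
  qed
  have lim0: "(\<lambda>n. 2 * (1/2::real) ^ n) \<longlonglongrightarrow> 0"
    by (intro tendsto_mult_right_zero LIMSEQ_power_zero) auto
  have "(\<lambda>n. prob (F n)) \<longlonglongrightarrow> 0"
    using pF by (intro tendsto_sandwich[OF _ _ tendsto_const lim0]) auto
  moreover have "\<exists>\<delta>>0. \<forall>A\<in>sets M. prob A < \<delta> \<longrightarrow> (\<exists>n. A \<inter> F n = {}) \<longrightarrow> variation A \<le> \<epsilon>" if e: "\<epsilon> > 0" for \<epsilon>
  proof -
    obtain \<delta> where d: "\<delta> > 0" "\<sigma> \<delta> < s + \<epsilon> / 2" using s_approx[of "\<epsilon> / 2"] e by auto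
    have "variation A \<le> \<epsilon>" if A: "A \<in> sets M" "prob A < \<delta> / 2" "A \<inter> F n = {}" for A n
    proof -
      have "\<forall>\<^sub>F m in sequentially. 2 * (1/2) ^ m < min (\<delta> / 2) \<epsilon>"
        using order_tendstoD(2)[OF lim0, of "min (\<delta> / 2) \<epsilon>"] d e by simp
      then obtain m where m: "m \<ge> n" "2 * (1/2) ^ m < min (\<delta> / 2) \<epsilon>"
        unfolding eventually_sequentially by (meson nle_le)
      have dis: "A \<inter> F m = {}" using A(3) decseqD[OF dec m(1)] by auto
      \<comment> \<open>The union of \<open>A\<close> and \<open>F m\<close> is still a set of small
        probability, so its variation is below \<open>s + \<epsilon> / 2\<close>, while
        \<open>F m\<close> alone already accounts for at least
        \<open>s - \<epsilon> / 2\<close>.\<close>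
      have "variation A + variation (F m) = variation (A \<union> F m)"
        using variation_Un[OF A(1) F dis] by simp
      also have "\<dots> \<le> \<sigma> \<delta>"
      proof (rule \<sigma>_ge)
        have "prob (A \<union> F m) \<le> prob A + prob (F m)" by (intro measure_Un_le A F)
        then show "prob (A \<union> F m) \<le> \<delta>" using A(2) pF[of m] m by simp
      qed (use A F in auto)
      finally have "variation A + variation (F m) < s + \<epsilon> / 2" using d by simp
      moreover have "variation (E m) \<le> variation (F m)"
        using E F by (intro variation_mono) (auto simp: F_def intro!: exI[of _ 0])
      ultimately show ?thesis using E(3)[of m] m by simp
    qed
    then show ?thesis using d(1) by (intro exI[of _ "\<delta> / 2"]) auto
  qed
  ultimately show ?thesis using F dec by blast
qed

text \<open>Cutting \<open>l\<close> to the complements of the \<open>F n\<close> gives Cauchy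
  sequences, because \<open>F m - F n\<close> is disjoint from \<open>F n\<close> and of small
  probability. The limit is absolutely continuous for the same reason: the part of a small set
  outside \<open>F n\<close> is disjoint from \<open>F n\<close>.\<close>

lemma ex_absolutely_continuous_part:
  "\<exists>l' F. bounded_functional M l' c \<and> (\<forall>n::nat. F n \<in> sets M) \<and> (\<lambda>n. prob (F n)) \<longlonglongrightarrow> 0 \<and>
    (\<forall>u\<in>bdd_measurable M. (\<lambda>n. l (cut_to (space M - F n) u)) \<longlonglongrightarrow> l' u) \<and>
    (\<forall>\<epsilon>>0. \<exists>\<delta>>0. \<forall>A\<in>sets M. prob A < \<delta> \<longrightarrow> (\<forall>u\<in>bdd_measurable M. \<forall>b\<ge>0.
      norm_le_on M u b \<longrightarrow> \<bar>l' (cut_to A u)\<bar> \<le> b * \<epsilon>))"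
proof -
  obtain F where F: "\<And>n::nat. F n \<in> sets M" "decseq F" "(\<lambda>n. prob (F n)) \<longlonglongrightarrow> 0"
    and ac: "\<And>\<epsilon>. \<epsilon> > 0 \<Longrightarrow> \<exists>\<delta>>0. \<forall>A\<in>sets M. prob A < \<delta> \<longrightarrow> (\<exists>n. A \<inter> F n = {}) \<longrightarrow> variation A \<le> \<epsilon>"
    using ex_singular_carrier by blast
  define a where "a u n = l (cut_to (space M - F n) u)" for u n
  define l' where "l' u = lim (a u)" for u
  have FS: "space M - F n \<in> sets M" for n using F(1) by auto
  have conv: "a u \<longlonglongrightarrow> l' u" if u: "u \<in> bdd_measurable M" for u
  proof -
    obtain b where b: "b > 0" "norm_le_on M u b" by (rule bdd_measurable_bound[OF u])
    have "Cauchy (a u)"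
    proof (rule CauchyI')
      fix e :: real assume e: "e > 0"
      obtain \<delta> where d: "\<delta> > 0" "\<And>A. A \<in> sets M \<Longrightarrow> prob A < \<delta> \<Longrightarrow> (\<exists>n. A \<inter> F n = {}) \<Longrightarrow> variation A \<le> e / (2 * b)"
        using ac[of "e / (2 * b)"] e b by auto
      obtain n0 where n0: "\<And>n. n \<ge> n0 \<Longrightarrow> prob (F n) < \<delta>"
        using order_tendstoD(2)[OF F(3) d(1)] unfolding eventually_sequentially by blast
      have "dist (a u m) (a u n) < e" if mn: "m \<ge> n0" "n > m" for m n
      proof -
        have "prob (F m - F n) \<le> prob (F m)" by (intro finite_measure_mono F) auto
        then have v: "variation (F m - F n) \<le> e / (2 * b)"
          using n0[OF mn(1)] F(1) by (intro d(2)) (auto intro!: exI[of _ n])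
        have "F n \<subseteq> F m" using decseqD[OF F(2)] mn by auto
        then have "space M - F n = (space M - F m) \<union> (F m - F n)"
          using sets.sets_into_space[OF F(1)] by blast
        then have "cut_to (space M - F n) u = (\<lambda>w. cut_to (space M - F m) u w + cut_to (F m - F n) u w)"
          using cut_to_Un[of "space M - F m" "F m - F n" u] by auto
        then have "a u n = a u m + l (cut_to (F m - F n) u)"
          unfolding a_def using F(1) FS u by (simp add: l_add bdd_measurable_cut_to sets.Diff)
        moreover have "\<bar>l (cut_to (F m - F n) u)\<bar> \<le> b * variation (F m - F n)"
          using b F(1) by (intro cut_to_le_variation u) auto
        moreover have "b * variation (F m - F n) \<le> b * (e / (2 * b))"
          using v b by (intro mult_left_mono) auto
        moreover have "b * (e / (2 * b)) < e" using b e by simp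
        ultimately show ?thesis by (simp add: dist_real_def)
      qed
      then show "\<exists>M. \<forall>m\<ge>M. \<forall>n>m. dist (a u m) (a u n) < e" by blast
    qed
    then show ?thesis
      unfolding l'_def by (simp add: Cauchy_convergent convergent_LIMSEQ_iff[symmetric])
  qed
  have lin': "linear_functional_on (bdd_measurable M) l'"
    unfolding linear_functional_on_def
  proof (intro conjI ballI allI)
    fix u v :: "'a \<Rightarrow> 'z" assume u: "u \<in> bdd_measurable M" and v: "v \<in> bdd_measurable M"
    have "a (\<lambda>w. u w + v w) = (\<lambda>n. a u n + a v n)"
      unfolding a_def cut_to_add by (intro ext l_add bdd_measurable_cut_to FS u v)
    then have "a (\<lambda>w. u w + v w) \<longlonglongrightarrow> l' u + l' v"
      using tendsto_add[OF conv[OF u] conv[OF v]] by simp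
    then show "l' (\<lambda>w. u w + v w) = l' u + l' v"
      using conv[OF bdd_measurable_add[OF u v]] LIMSEQ_unique by blast
  next
    fix u :: "'a \<Rightarrow> 'z" and t :: real assume u: "u \<in> bdd_measurable M"
    have "a (\<lambda>w. t *\<^sub>R u w) = (\<lambda>n. t * a u n)"
      unfolding a_def cut_to_scaleR by (intro ext l_scale bdd_measurable_cut_to FS u)
    then have "a (\<lambda>w. t *\<^sub>R u w) \<longlonglongrightarrow> t * l' u"
      using tendsto_mult_left[OF conv[OF u], of t] by simp
    then show "l' (\<lambda>w. t *\<^sub>R u w) = t * l' u"
      using conv[OF bdd_measurable_scaleR[OF u]] LIMSEQ_unique by blast
  qed
  have bnd': "\<bar>l' u\<bar> \<le> c * b" if u: "u \<in> bdd_measurable M" and b: "b > 0" "norm_le_on M u b" for u b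
  proof (rule LIMSEQ_le_const2)
    show "(\<lambda>n. \<bar>a u n\<bar>) \<longlonglongrightarrow> \<bar>l' u\<bar>" by (intro tendsto_rabs conv u)
    have "\<bar>a u n\<bar> \<le> c * b" for n
      unfolding a_def
    proof (intro functional_bound bdd_measurable_cut_to FS u b(1) ballI)
      show "norm (cut_to (space M - F n) u w) \<le> b" if "w \<in> space M" for w
        using norm_cut_to_le[of "space M - F n" u w] b(2) that by force
    qed
    then show "\<exists>N. \<forall>n\<ge>N. \<bar>a u n\<bar> \<le> c * b" by blast
  qed
  have ac': "\<exists>\<delta>>0. \<forall>A\<in>sets M. prob A < \<delta> \<longrightarrow> (\<forall>u\<in>bdd_measurable M. \<forall>b\<ge>0.
      norm_le_on M u b \<longrightarrow> \<bar>l' (cut_to A u)\<bar> \<le> b * \<epsilon>)" if e: "\<epsilon> > 0" for \<epsilon>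
  proof -
    obtain \<delta> where d: "\<delta> > 0" "\<And>A. A \<in> sets M \<Longrightarrow> prob A < \<delta> \<Longrightarrow> (\<exists>n. A \<inter> F n = {}) \<Longrightarrow> variation A \<le> \<epsilon>"
      using ac[OF e] by blast
    have "\<bar>l' (cut_to A u)\<bar> \<le> b * \<epsilon>"
      if A: "A \<in> sets M" "prob A < \<delta>" and u: "u \<in> bdd_measurable M" and b: "b \<ge> 0" "norm_le_on M u b" for A u b
    proof (rule LIMSEQ_le_const2)
      show "(\<lambda>n. \<bar>a (cut_to A u) n\<bar>) \<longlonglongrightarrow> \<bar>l' (cut_to A u)\<bar>"
        by (intro tendsto_rabs conv bdd_measurable_cut_to u A)
      have "\<bar>a (cut_to A u) n\<bar> \<le> b * \<epsilon>" for n
      proof -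
        have m: "(space M - F n) \<inter> A \<in> sets M" using A F(1) by auto
        have "prob ((space M - F n) \<inter> A) \<le> prob A" by (intro finite_measure_mono A) auto
        then have "variation ((space M - F n) \<inter> A) \<le> \<epsilon>"
          using A(2) m by (intro d(2)) (auto intro!: exI[of _ n])
        moreover have "\<bar>a (cut_to A u) n\<bar> \<le> b * variation ((space M - F n) \<inter> A)"
          unfolding a_def cut_to_cut_to by (intro cut_to_le_variation m u b)
        ultimately show ?thesis using b(1) by (meson mult_left_mono order_trans)
      qed
      then show "\<exists>N. \<forall>n\<ge>N. \<bar>a (cut_to A u) n\<bar> \<le> b * \<epsilon>" by blast
    qed
    then show ?thesis using d(1) by blast
  qed
  have "bounded_functional M l' c"
    by unfold_locales (use lin' bnd' in auto)
  then show ?thesis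
    using F ac' conv unfolding a_def
    by (intro exI[of _ l'] exI[of _ F] conjI allI impI ballI)
qed

end

section \<open>Integral representation\<close>

text \<open>Absolute continuity turns finite additivity into continuity at the empty set, hence into
  countable additivity, so that the Radon-Nikodym theorem applies.\<close>

lemma (in prob_space) ex_density_of_additive:
  fixes \<mu> :: "'a set \<Rightarrow> real"
  assumes nonneg: "\<And>A. A \<in> sets M \<Longrightarrow> 0 \<le> \<mu> A"
    and additive: "\<And>A B. A \<in> sets M \<Longrightarrow> B \<in> sets M \<Longrightarrow> A \<inter> B = {} \<Longrightarrow> \<mu> (A \<union> B) = \<mu> A + \<mu> B"
    and ac: "\<And>\<epsilon>. \<epsilon> > 0 \<Longrightarrow> \<exists>\<delta>>0. \<forall>A\<in>sets M. prob A < \<delta> \<longrightarrow> \<mu> A \<le> \<epsilon>"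
  shows "\<exists>h. h \<in> borel_measurable M \<and> (\<forall>w. 0 \<le> h w) \<and> integrable M h \<and>
    (\<forall>A\<in>sets M. \<mu> A = (\<integral>w. indicator A w * h w \<partial>M))"
proof -
  have ca: "countably_additive (sets M) (\<lambda>A. ennreal (\<mu> A))"
  proof (rule sets.empty_continuous_imp_countably_additive)
    show "positive (sets M) (\<lambda>A. ennreal (\<mu> A))"
      using additive[of "{}" "{}"] by (simp add: positive_def)
    show "Measure_Space.additive (sets M) (\<lambda>A. ennreal (\<mu> A))"
      unfolding additive_def using nonneg additive by (simp add: ennreal_plus)
    fix A :: "nat \<Rightarrow> 'a set" assume A: "range A \<subseteq> sets M" "decseq A" "(\<Inter>i. A i) = {}"
    have pA: "(\<lambda>i. prob (A i)) \<longlonglongrightarrow> 0"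
      using finite_Lim_measure_decseq[OF A(1,2)] A(3) by simp
    have Ai: "A i \<in> sets M" for i using A(1) by auto
    have "(\<lambda>i. \<mu> (A i)) \<longlonglongrightarrow> 0"
    proof (rule LIMSEQ_I)
      fix r :: real assume r: "r > 0"
      obtain \<delta> where d: "\<delta> > 0" "\<forall>A\<in>sets M. prob A < \<delta> \<longrightarrow> \<mu> A \<le> r / 2"
        using ac[of "r / 2"] r by auto
      obtain N where "\<forall>n\<ge>N. prob (A n) < \<delta>"
        using order_tendstoD(2)[OF pA d(1)] unfolding eventually_sequentially by blast
      then have "\<forall>n\<ge>N. norm (\<mu> (A n) - 0) < r"
        using d(2) Ai nonneg r by fastforce
      then show "\<exists>N. \<forall>n\<ge>N. norm (\<mu> (A n) - 0) < r" by blast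
    qed
    then show "(\<lambda>i. ennreal (\<mu> (A i))) \<longlonglongrightarrow> 0"
      using tendsto_ennrealI by fastforce
  qed simp
  define N where "N = measure_of (space M) (sets M) (\<lambda>A. ennreal (\<mu> A))"
  have sN: "sets N = sets M" unfolding N_def by simp
  have eN: "emeasure N A = ennreal (\<mu> A)" if "A \<in> sets M" for A
    unfolding N_def using that ca additive[of "{}" "{}"]
    by (intro emeasure_measure_of_sigma) (auto simp: positive_def sets.sigma_algebra_axioms)
  have "absolutely_continuous M N"
    unfolding absolutely_continuous_def
  proof
    fix A assume A: "A \<in> null_sets M"
    then have As: "A \<in> sets M" and "prob A = 0" by (auto simp: null_sets_def measure_def)
    then have "\<mu> A \<le> \<epsilon>" if "\<epsilon> > 0" for \<epsilon> using ac[OF that] by auto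
    then have "\<mu> A \<le> 0" using field_le_epsilon[of "\<mu> A" 0] by simp
    then show "A \<in> null_sets N" using As by (simp add: null_sets_def sN eN ennreal_neg)
  qed
  from Radon_Nikodym[OF this sN] obtain f where f: "f \<in> borel_measurable M" "density M f = N" by blast
  have nf: "(\<integral>\<^sup>+w. f w * indicator A w \<partial>M) = ennreal (\<mu> A)" if "A \<in> sets M" for A
    using emeasure_density[OF f(1) that] eN[OF that] f(2) by simp
  have "(\<integral>\<^sup>+w. f w \<partial>M) = (\<integral>\<^sup>+w. f w * indicator (space M) w \<partial>M)"
    by (intro nn_integral_cong) auto
  then have "(\<integral>\<^sup>+w. f w \<partial>M) = ennreal (\<mu> (space M))" using nf[of "space M"] by simp
  then have fin: "AE w in M. f w \<noteq> \<infinity>" using f(1) by (intro nn_integral_PInf_AE) auto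
  \<comment> \<open>The density is finite almost everywhere because its integral is
    \<open>\<mu> (space M)\<close>; \<open>enn2real\<close> replaces infinite values by 0.\<close>
  define h where "h w = enn2real (f w)" for w
  have h: "h \<in> borel_measurable M" "\<And>w. 0 \<le> h w" unfolding h_def using f(1) by auto
  have nh: "(\<integral>\<^sup>+w. ennreal (indicator A w * h w) \<partial>M) = ennreal (\<mu> A)" if A: "A \<in> sets M" for A
  proof -
    have "(\<integral>\<^sup>+w. ennreal (indicator A w * h w) \<partial>M) = (\<integral>\<^sup>+w. f w * indicator A w \<partial>M)"
      using fin by (intro nn_integral_cong_AE, eventually_elim)
        (auto simp: h_def indicator_def less_top[symmetric] ennreal_enn2real)
    then show ?thesis using nf[OF A] by simp
  qed
  have int: "integrable M (\<lambda>w. indicator A w * h w)" if A: "A \<in> sets M" for A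
    using nh[OF A] h A by (intro integrableI_nonneg) auto
  have eq: "\<mu> A = (\<integral>w. indicator A w * h w \<partial>M)" if A: "A \<in> sets M" for A
  proof -
    have "ennreal (\<integral>w. indicator A w * h w \<partial>M) = ennreal (\<mu> A)"
      using nn_integral_eq_integral[OF int[OF A]] nh[OF A] h(2) by simp
    moreover have "0 \<le> (\<integral>w. indicator A w * h w \<partial>M)" using h(2) by (intro integral_nonneg_AE) auto
    ultimately show ?thesis using nonneg[OF A] by (simp add: ennreal_inj)
  qed
  have "integrable M h"
    using int[OF sets.top] by (subst Bochner_Integration.integrable_cong[OF refl, of _ _ "\<lambda>w. indicator (space M) w * h w"]) auto
  then show ?thesis using h eq by blast
qed

lemma AE_le_if_integrals_le:
  fixes f g :: "'a \<Rightarrow> real"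
  assumes "sigma_finite_measure M" and f: "integrable M f" and g: "integrable M g"
    and le: "\<And>A. A \<in> sets M \<Longrightarrow> (\<integral>w. indicator A w * f w \<partial>M) \<le> (\<integral>w. indicator A w * g w \<partial>M)"
  shows "AE w in M. f w \<le> g w"
proof -
  interpret sigma_finite_measure M by fact
  have "AE w in M. 0 \<le> g w - f w"
  proof (rule density_nonneg)
    fix A assume A: "A \<in> sets M"
    have "integrable M (\<lambda>w. indicator A w * f w)" "integrable M (\<lambda>w. indicator A w * g w)"
      using integrable_mult_indicator[OF A f] integrable_mult_indicator[OF A g] by simp_all
    then have "(\<integral>w. indicator A w *\<^sub>R (g w - f w) \<partial>M) = (\<integral>w. indicator A w * g w \<partial>M) - (\<integral>w. indicator A w * f w \<partial>M)"
      by (simp add: right_diff_distrib)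
    then show "0 \<le> set_lebesgue_integral M A (\<lambda>w. g w - f w)"
      unfolding set_lebesgue_integral_def using le[OF A] by simp
  qed (use f g in auto)
  then show ?thesis by eventually_elim simp
qed

section \<open>Assembling scalar densities into a functional\<close>

lemma ex_sequence_in_dense:
  fixes z :: "'z::real_normed_vector"
  assumes dense: "\<And>\<epsilon>. \<epsilon> > 0 \<Longrightarrow> \<exists>d\<in>D. norm (d - z) < \<epsilon>"
  shows "\<exists>s. (\<forall>n::nat. s n \<in> D) \<and> s \<longlonglongrightarrow> z"
proof -
  have "\<forall>n::nat. \<exists>d. d \<in> D \<and> norm (d - z) < 1 / real (Suc n)"
    using dense[of "1 / real (Suc n)" for n] by auto
  from choice[OF this] obtain s where s: "\<And>n. s n \<in> D" "\<And>n. norm (s n - z) < 1 / real (Suc n)" by blast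
  have "(\<lambda>n. norm (s n - z)) \<longlonglongrightarrow> 0"
    by (rule tendsto_sandwich[OF _ _ tendsto_const LIMSEQ_inverse_real_of_nat])
      (use s(2) in \<open>auto intro!: always_eventually less_imp_le simp: inverse_eq_divide\<close>)
  then have "s \<longlonglongrightarrow> z" by (simp add: tendsto_norm_zero_iff LIM_zero_iff)
  then show "\<exists>s. (\<forall>n::nat. s n \<in> D) \<and> s \<longlonglongrightarrow> z" using s(1) by blast
qed

text \<open>The hypothesis for rational \<open>q\<close> bounds both the oscillation of \<open>H\<close> on \<open>D\<close> and its defect
  from linearity, so the continuous extension of \<open>H\<close> is linear.\<close>
lemma ex_blinfun_extension_of_dense:
  fixes H :: "'z::real_normed_vector \<Rightarrow> real"
  assumes dense: "\<And>z \<epsilon>. \<epsilon> > 0 \<Longrightarrow> \<exists>d\<in>D. norm (d - z) < \<epsilon>" and c: "c \<ge> 0"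
    and H: "\<And>d1 d2 d3 q. d1 \<in> D \<Longrightarrow> d2 \<in> D \<Longrightarrow> d3 \<in> D \<Longrightarrow> q \<in> \<rat> \<Longrightarrow>
      \<bar>H d1 + q * H d2 - H d3\<bar> \<le> norm (d1 + q *\<^sub>R d2 - d3) * c"
  shows "\<exists>F :: 'z \<Rightarrow>\<^sub>L real. (\<forall>d\<in>D. blinfun_apply F d = H d) \<and> norm F \<le> c"
proof -
  have "\<forall>z. \<exists>s. (\<forall>n::nat. s n \<in> D) \<and> s \<longlonglongrightarrow> z"
    using ex_sequence_in_dense[OF dense] by blast
  from choice[OF this] obtain s where s: "\<And>z (n::nat). s z n \<in> D" "\<And>z. s z \<longlonglongrightarrow> z" by blast
  \<comment> \<open>With \<open>q = 0\<close> the hypothesis is a Lipschitz bound.\<close>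
  have lip: "\<bar>H d - H d'\<bar> \<le> norm (d - d') * c" if "d \<in> D" "d' \<in> D" for d d'
    using H[OF that(1,1,2), of 0] by simp
  define L where "L z = lim (\<lambda>n. H (s z n))" for z
  have L: "(\<lambda>n. H (s z n)) \<longlonglongrightarrow> L z" for z
  proof -
    have "Cauchy (\<lambda>n. H (s z n))"
    proof (rule CauchyI)
      fix e :: real assume e: "e > 0"
      have "Cauchy (s z)" using s(2) by (rule LIMSEQ_imp_Cauchy)
      then obtain N where N: "\<And>m n. m \<ge> N \<Longrightarrow> n \<ge> N \<Longrightarrow> norm (s z m - s z n) < e / (c + 1)"
        using CauchyD[of "s z" "e / (c + 1)"] e c by auto
      have "norm (H (s z m) - H (s z n)) < e" if "m \<ge> N" "n \<ge> N" for m n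
      proof -
        have "norm (H (s z m) - H (s z n)) \<le> norm (s z m - s z n) * c"
          using lip[OF s(1) s(1), of z m z n] by simp
        also have "\<dots> \<le> norm (s z m - s z n) * (c + 1)" by (intro mult_left_mono) auto
        also have "\<dots> < e / (c + 1) * (c + 1)" using N[OF that] c by (intro mult_strict_right_mono) auto
        finally show ?thesis using c by simp
      qed
      then show "\<exists>M. \<forall>m\<ge>M. \<forall>n\<ge>M. norm (H (s z m) - H (s z n)) < e" by blast
    qed
    then show ?thesis unfolding L_def using convergent_LIMSEQ_iff Cauchy_convergent by blast
  qed
  have ineq: "\<bar>L a + r * L b - L z\<bar> \<le> norm (a + r *\<^sub>R b - z) * c" for a b z r
  proof -
    have "\<exists>q. (\<forall>n::nat. q n \<in> \<rat>) \<and> q \<longlonglongrightarrow> r"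
    proof -
      have "\<forall>n::nat. \<exists>q. q \<in> \<rat> \<and> r < q \<and> q < r + 1 / real (Suc n)"
        using Rats_dense_in_real by (metis less_add_same_cancel1 of_nat_0_less_iff zero_less_Suc zero_less_divide_1_iff)
      from choice[OF this] obtain q where q: "\<And>n. q n \<in> \<rat>" "\<And>n. r < q n" "\<And>n. q n < r + 1 / real (Suc n)" by blast
      have "(\<lambda>n. r + inverse (real (Suc n))) \<longlonglongrightarrow> r + 0"
        by (intro tendsto_add tendsto_const LIMSEQ_inverse_real_of_nat)
      then have lim: "(\<lambda>n. r + inverse (real (Suc n))) \<longlonglongrightarrow> r" by simp
      have "q \<longlonglongrightarrow> r"
        by (rule tendsto_sandwich[OF _ _ tendsto_const lim])
          (use q(2,3) in \<open>auto intro!: always_eventually less_imp_le simp: inverse_eq_divide\<close>)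
      then show ?thesis using q(1) by blast
    qed
    then obtain q where q: "\<And>n::nat. q n \<in> \<rat>" "q \<longlonglongrightarrow> r" by blast
    have l: "(\<lambda>n. \<bar>H (s a n) + q n * H (s b n) - H (s z n)\<bar>) \<longlonglongrightarrow> \<bar>L a + r * L b - L z\<bar>"
      by (intro tendsto_intros L q)
    have m: "(\<lambda>n. norm (s a n + q n *\<^sub>R s b n - s z n) * c) \<longlonglongrightarrow> norm (a + r *\<^sub>R b - z) * c"
      by (intro tendsto_intros s(2) q)
    show ?thesis
      using H[OF s(1) s(1) s(1) q(1)] by (intro LIMSEQ_le[OF l m]) blast
  qed
  \<comment> \<open>This identity, additivity and homogeneity are instances of \<open>ineq\<close>
    whose right-hand side is 0.\<close>
  have L0: "L 0 = 0" using ineq[of 0 1 0 0] by simp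
  have Lb: "\<bar>L z\<bar> \<le> norm z * c" for z using ineq[of z 0 0 0] L0 by simp
  have bl: "bounded_linear L"
  proof (rule bounded_linear_intro[of _ c])
    show "L (a + b) = L a + L b" for a b using ineq[of a 1 b "a + b"] by simp
    show "L (r *\<^sub>R a) = r *\<^sub>R L a" for r a using ineq[of 0 r a "r *\<^sub>R a"] L0 by simp
  qed (use Lb in auto)
  have "L d = H d" if d: "d \<in> D" for d
  proof -
    have "(\<lambda>n. norm (s d n - d) * c) \<longlonglongrightarrow> norm (d - d) * c"
      by (intro tendsto_intros s(2))
    then have "(\<lambda>n. norm (s d n - d) * c) \<longlonglongrightarrow> 0" by simp
    then have "(\<lambda>n. H (s d n) - H d) \<longlonglongrightarrow> 0"
      by (rule Lim_null_comparison[rotated]) (use lip[OF s(1) d] in auto)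
    then have "(\<lambda>n. H (s d n)) \<longlonglongrightarrow> H d" by (simp add: LIM_zero_iff)
    then show ?thesis using L LIMSEQ_unique by blast
  qed
  then show ?thesis
    using Lb c by (intro exI[of _ "Blinfun L"])
      (auto simp: bounded_linear_Blinfun_apply[OF bl] mult.commute intro!: norm_blinfun_bound)
qed

locale ac_functional = bounded_functional M l c for M :: "'a measure"
    and l :: "('a \<Rightarrow> 'z::{banach, second_countable_topology}) \<Rightarrow> real" and c +
  assumes ac: "\<And>\<epsilon>. \<epsilon> > 0 \<Longrightarrow> \<exists>\<delta>>0. \<forall>A\<in>sets M. prob A < \<delta> \<longrightarrow> (\<forall>u\<in>bdd_measurable M. \<forall>b\<ge>0.
      norm_le_on M u b \<longrightarrow> \<bar>l (cut_to A u)\<bar> \<le> b * \<epsilon>)"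
begin

text \<open>On \<open>space M\<close> the difference is bounded by every \<open>b > 0\<close>, so
  its value under \<open>l\<close> is 0 whatever happens off \<open>space M\<close>.\<close>

lemma l_cong:
  assumes u: "u \<in> bdd_measurable M" and v: "v \<in> bdd_measurable M" and eq: "\<And>w. w \<in> space M \<Longrightarrow> u w = v w"
  shows "l u = l v"
proof -
  have m: "(\<lambda>w. u w - v w) \<in> bdd_measurable M" by (rule bdd_measurable_diff[OF u v])
  have "\<bar>l (\<lambda>w. u w - v w)\<bar> \<le> c * b" if "b > 0" for b
    using that eq by (intro functional_bound m) auto
  then have h: "\<bar>l u - l v\<bar> \<le> c * b" if "b > 0" for b using that l_diff[OF u v] by simp
  have c0: "c \<ge> 0" using variation_le_c[of "{}"] by (simp add: variation_empty)
  have "\<bar>l u - l v\<bar> \<le> 0 + e" if "e > 0" for e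
  proof -
    have "c * (e / (c + 1)) \<le> (c + 1) * (e / (c + 1))" using c0 that by (intro mult_right_mono) auto
    moreover have "(c + 1) * (e / (c + 1)) = e" using c0 by simp
    ultimately show ?thesis using h[of "e / (c + 1)"] c0 that by simp
  qed
  then have "\<bar>l u - l v\<bar> \<le> 0" by (rule field_le_epsilon)
  then show ?thesis by simp
qed

lemma variation_ac: "\<epsilon> > 0 \<Longrightarrow> \<exists>\<delta>>0. \<forall>A\<in>sets M. prob A < \<delta> \<longrightarrow> variation A \<le> \<epsilon>"
proof -
  assume "\<epsilon> > 0"
  then obtain \<delta> where d: "\<delta> > 0" "\<And>A u. A \<in> sets M \<Longrightarrow> prob A < \<delta> \<Longrightarrow> u \<in> bdd_measurable M \<Longrightarrow>
      norm_le_on M u 1 \<Longrightarrow> \<bar>l (cut_to A u)\<bar> \<le> \<epsilon>"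
    using ac[of \<epsilon>] by (metis mult_1 zero_le_one)
  have "variation A \<le> \<epsilon>" if "A \<in> sets M" "prob A < \<delta>" for A
    using d(2)[OF that] by (intro variation_le) (auto simp: unit_ball_def abs_le_iff)
  then show ?thesis using d(1) by blast
qed

lemma const_bdd_measurable: "(\<lambda>_. z) \<in> bdd_measurable M"
  by (rule bdd_measurableI[of _ _ "norm z"]) auto

text \<open>The value \<open>l (cut_to A (\<lambda>_. z))\<close> may be negative. Adding
  \<open>norm z * variation A\<close> makes it a nonnegative set function with a density;
  subtracting \<open>norm z * g\<close> from that density gives the signed one.\<close>

lemma ex_scalar_densities:
  "\<exists>g H. integrable M g \<and> (\<forall>w. 0 \<le> g w) \<and> (\<forall>A\<in>sets M. variation A = (\<integral>w. indicator A w * g w \<partial>M)) \<and>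
    (\<forall>z. integrable M (H z) \<and> (\<forall>A\<in>sets M. l (cut_to A (\<lambda>_. z)) = (\<integral>w. indicator A w * H z w \<partial>M)))"
proof -
  obtain g where g: "g \<in> borel_measurable M" "\<And>w. 0 \<le> g w" "integrable M g"
    "\<And>A. A \<in> sets M \<Longrightarrow> variation A = (\<integral>w. indicator A w * g w \<partial>M)"
    using ex_density_of_additive[of variation, OF variation_nonneg variation_Un variation_ac] by blast
  have "\<forall>z. \<exists>h. integrable M h \<and> (\<forall>A\<in>sets M. l (cut_to A (\<lambda>_. z)) = (\<integral>w. indicator A w * h w \<partial>M))"
  proof
    fix z :: 'z
    define \<mu> where "\<mu> A = l (cut_to A (\<lambda>_. z)) + norm z * variation A" for A
    have z: "\<bar>l (cut_to A (\<lambda>_. z))\<bar> \<le> norm z * variation A" if "A \<in> sets M" for A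
      using that by (intro cut_to_le_variation const_bdd_measurable) auto
    have "\<exists>h. h \<in> borel_measurable M \<and> (\<forall>w. 0 \<le> h w) \<and> integrable M h \<and>
      (\<forall>A\<in>sets M. \<mu> A = (\<integral>w. indicator A w * h w \<partial>M))"
    proof (rule ex_density_of_additive)
      show "0 \<le> \<mu> A" if "A \<in> sets M" for A using z[OF that] by (simp add: \<mu>_def abs_le_iff)
      show "\<mu> (A \<union> B) = \<mu> A + \<mu> B" if "A \<in> sets M" "B \<in> sets M" "A \<inter> B = {}" for A B
        unfolding \<mu>_def cut_to_Un[OF that(3)] variation_Un[OF that]
        using that by (simp add: l_add bdd_measurable_cut_to const_bdd_measurable algebra_simps)
      fix \<epsilon> :: real assume e: "\<epsilon> > 0"
      \<comment> \<open>\<open>\<mu>\<close> is at most \<open>2 * norm z\<close> times the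
        variation; the \<open>+ 1\<close> covers \<open>z = 0\<close>.\<close>
      have zp: "2 * norm z + 1 > 0" using norm_ge_zero[of z] by linarith
      obtain \<delta> where d: "\<delta> > 0" "\<And>A. A \<in> sets M \<Longrightarrow> prob A < \<delta> \<Longrightarrow> variation A \<le> \<epsilon> / (2 * norm z + 1)"
        using variation_ac[of "\<epsilon> / (2 * norm z + 1)"] e zp by auto
      have "\<mu> A \<le> \<epsilon>" if A: "A \<in> sets M" "prob A < \<delta>" for A
      proof -
        have "\<mu> A \<le> (2 * norm z) * variation A" unfolding \<mu>_def using z[OF A(1)] by (simp add: abs_le_iff)
        also have "\<dots> \<le> (2 * norm z + 1) * (\<epsilon> / (2 * norm z + 1))"
          using d(2)[OF A] variation_nonneg[OF A(1)] by (intro mult_mono) auto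
        finally show ?thesis using zp by simp
      qed
      then show "\<exists>\<delta>>0. \<forall>A\<in>sets M. prob A < \<delta> \<longrightarrow> \<mu> A \<le> \<epsilon>" using d(1) by blast
    qed
    then obtain k where k: "integrable M k" "\<And>A. A \<in> sets M \<Longrightarrow> \<mu> A = (\<integral>w. indicator A w * k w \<partial>M)" by blast
    have "l (cut_to A (\<lambda>_. z)) = (\<integral>w. indicator A w * (k w - norm z * g w) \<partial>M)" if A: "A \<in> sets M" for A
    proof -
      have i: "integrable M (\<lambda>w. indicator A w * k w)" "integrable M (\<lambda>w. indicator A w * g w)"
        using integrable_mult_indicator[OF A k(1)] integrable_mult_indicator[OF A g(3)] by simp_all
      have "(\<integral>w. indicator A w * (k w - norm z * g w) \<partial>M) = (\<integral>w. indicator A w * k w - norm z * (indicator A w * g w) \<partial>M)"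
        by (intro Bochner_Integration.integral_cong) (auto simp: algebra_simps)
      also have "\<dots> = \<mu> A - norm z * variation A" using i by (simp add: k(2)[OF A] g(4)[OF A])
      finally show ?thesis by (simp add: \<mu>_def)
    qed
    then show "\<exists>h. integrable M h \<and> (\<forall>A\<in>sets M. l (cut_to A (\<lambda>_. z)) = (\<integral>w. indicator A w * h w \<partial>M))"
      using k(1) g(3) by (intro exI[of _ "\<lambda>w. k w - norm z * g w"]) auto
  qed
  from choice[OF this] obtain H where "\<forall>z. integrable M (H z) \<and> (\<forall>A\<in>sets M. l (cut_to A (\<lambda>_. z)) = (\<integral>w. indicator A w * H z w \<partial>M))" by blast
  then show ?thesis using g(2,3,4) by blast
qed

text \<open>The densities \<open>H z\<close> are linear in \<open>z\<close> only up to null sets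
  that depend on the vectors. Restricted to a countable dense set and rational factors, the defect
  bound holds off one null set \<open>N\<close>, and there it determines a functional of norm at
  most \<open>g w\<close>.\<close>

lemma ex_operator_density:
  "\<exists>(\<Lambda> :: 'a \<Rightarrow> 'z \<Rightarrow>\<^sub>L real) g. integrable M g \<and> (\<forall>w. norm (\<Lambda> w) \<le> g w) \<and>
    (\<forall>z. (\<lambda>w. blinfun_apply (\<Lambda> w) z) \<in> borel_measurable M) \<and>
    (\<forall>z. \<forall>A\<in>sets M. l (cut_to A (\<lambda>_. z)) = (\<integral>w. indicator A w * blinfun_apply (\<Lambda> w) z \<partial>M))"
proof -
  obtain g H where g: "integrable M g" "\<forall>w. 0 \<le> g w" "\<forall>A\<in>sets M. variation A = (\<integral>w. indicator A w * g w \<partial>M)"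
    and H: "\<forall>z. integrable M (H z) \<and> (\<forall>A\<in>sets M. l (cut_to A (\<lambda>_. z)) = (\<integral>w. indicator A w * H z w \<partial>M))"
    using ex_scalar_densities by blast
  have Hi: "integrable M (H z)" for z using H by blast
  have gm: "0 \<le> g w" for w using g by blast
  have sf: "sigma_finite_measure M" by unfold_locales
  obtain D :: "'z set" where D: "countable D" "\<And>X. open X \<Longrightarrow> X \<noteq> {} \<Longrightarrow> \<exists>d\<in>D. d \<in> X"
    by (erule countable_dense_setE)
  have dense: "\<exists>d\<in>D. norm (d - z) < \<epsilon>" if "\<epsilon> > 0" for z \<epsilon>
    using D(2)[of "ball z \<epsilon>"] that by (auto simp: dist_norm norm_minus_commute)
  \<comment> \<open>With \<open>z3 = z1 + r *\<^sub>R z2\<close> this expresses linearity, with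
    \<open>r = 0\<close> a Lipschitz bound; the extension to a functional asks for both in this
    combined form.\<close>
  have defect: "AE w in M. \<bar>H z1 w + r * H z2 w - H z3 w\<bar> \<le> norm (z1 + r *\<^sub>R z2 - z3) * g w" for z1 z2 z3 r
  proof -
    have "AE w in M. t * (H z1 w + r * H z2 w - H z3 w) \<le> norm (z1 + r *\<^sub>R z2 - z3) * g w" if t: "\<bar>t\<bar> = 1" for t
    proof (rule AE_le_if_integrals_le[OF sf])
      fix A assume A: "A \<in> sets M"
      have i: "integrable M (\<lambda>w. indicator A w * H z w)" for z
        using integrable_mult_indicator[OF A Hi] by simp
      have cm: "cut_to A (\<lambda>_. z) \<in> bdd_measurable M" for z
        by (intro bdd_measurable_cut_to A const_bdd_measurable)
      have "cut_to A (\<lambda>_. z1 + r *\<^sub>R z2 - z3) =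
          (\<lambda>w. (cut_to A (\<lambda>_. z1) w + r *\<^sub>R cut_to A (\<lambda>_. z2) w) - cut_to A (\<lambda>_. z3) w)"
        by (auto simp: cut_to_def algebra_simps)
      then have "l (cut_to A (\<lambda>_. z1 + r *\<^sub>R z2 - z3)) =
          l (cut_to A (\<lambda>_. z1)) + r * l (cut_to A (\<lambda>_. z2)) - l (cut_to A (\<lambda>_. z3))"
        by (simp add: l_diff l_add l_scale cm bdd_measurable_add bdd_measurable_scaleR)
      moreover have "(\<integral>w. indicator A w * (t * (H z1 w + r * H z2 w - H z3 w)) \<partial>M) =
          (\<integral>w. t * (indicator A w * H z1 w + r * (indicator A w * H z2 w) - indicator A w * H z3 w) \<partial>M)"
        by (intro Bochner_Integration.integral_cong) (auto simp: algebra_simps)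
      ultimately have "(\<integral>w. indicator A w * (t * (H z1 w + r * H z2 w - H z3 w)) \<partial>M) =
          t * l (cut_to A (\<lambda>_. z1 + r *\<^sub>R z2 - z3))"
        using i H A by simp
      also have "\<dots> \<le> \<bar>l (cut_to A (\<lambda>_. z1 + r *\<^sub>R z2 - z3))\<bar>"
        using t by (metis abs_ge_self abs_mult mult_1)
      also have "\<dots> \<le> norm (z1 + r *\<^sub>R z2 - z3) * variation A"
        by (intro cut_to_le_variation A const_bdd_measurable) auto
      also have "\<dots> = (\<integral>w. norm (z1 + r *\<^sub>R z2 - z3) * (indicator A w * g w) \<partial>M)"
        using g(3) A integrable_mult_indicator[OF A g(1)] by simp
      also have "\<dots> = (\<integral>w. indicator A w * (norm (z1 + r *\<^sub>R z2 - z3) * g w) \<partial>M)"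
        by (intro Bochner_Integration.integral_cong) (auto simp: algebra_simps)
      finally show "(\<integral>w. indicator A w * (t * (H z1 w + r * H z2 w - H z3 w)) \<partial>M)
          \<le> (\<integral>w. indicator A w * (norm (z1 + r *\<^sub>R z2 - z3) * g w) \<partial>M)" .
    qed (use Hi g(1) in auto)
    from this[of 1] this[of "-1"] show ?thesis by (auto simp: abs_le_iff)
  qed
  have "AE w in M. \<forall>d1\<in>D. \<forall>d2\<in>D. \<forall>d3\<in>D. \<forall>q\<in>\<rat>.
      \<bar>H d1 w + q * H d2 w - H d3 w\<bar> \<le> norm (d1 + q *\<^sub>R d2 - d3) * g w"
    using defect by (intro AE_ball_countable' D(1) countable_rat) auto
  then obtain N where N: "N \<in> null_sets M"
    "\<And>w. w \<in> space M - N \<Longrightarrow> \<forall>d1\<in>D. \<forall>d2\<in>D. \<forall>d3\<in>D. \<forall>q\<in>\<rat>.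
      \<bar>H d1 w + q * H d2 w - H d3 w\<bar> \<le> norm (d1 + q *\<^sub>R d2 - d3) * g w"
    by (rule AE_E3) blast
  \<comment> \<open>On \<open>N\<close> and outside \<open>space M\<close> the functional is set to
    0, so that the norm bound holds everywhere and the values at a fixed vector are
    measurable.\<close>
  have "\<forall>w. \<exists>F :: 'z \<Rightarrow>\<^sub>L real. norm F \<le> g w \<and>
      (if w \<in> space M - N then \<forall>d\<in>D. blinfun_apply F d = H d w else F = 0)"
  proof
    fix w
    show "\<exists>F :: 'z \<Rightarrow>\<^sub>L real. norm F \<le> g w \<and>
      (if w \<in> space M - N then \<forall>d\<in>D. blinfun_apply F d = H d w else F = 0)"
    proof (cases "w \<in> space M - N")
      case True
      have "\<exists>F :: 'z \<Rightarrow>\<^sub>L real. (\<forall>d\<in>D. blinfun_apply F d = H d w) \<and> norm F \<le> g w"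
        using N(2)[OF True] by (intro ex_blinfun_extension_of_dense dense gm) auto
      then show ?thesis using True by auto
    next
      case False
      then show ?thesis using gm[of w] by (intro exI[of _ 0]) auto
    qed
  qed
  from choice[OF this] obtain \<Lambda> :: "'a \<Rightarrow> 'z \<Rightarrow>\<^sub>L real" where \<Lambda>: "\<And>w. norm (\<Lambda> w) \<le> g w"
      "\<And>w d. w \<in> space M - N \<Longrightarrow> d \<in> D \<Longrightarrow> blinfun_apply (\<Lambda> w) d = H d w" "\<And>w. w \<notin> space M - N \<Longrightarrow> \<Lambda> w = 0"
    by (metis (no_types, lifting))
  have Nm: "space M - N \<in> sets M" using N(1) by auto
  have approx: "\<exists>s. (\<forall>n::nat. s n \<in> D) \<and> s \<longlonglongrightarrow> z" for z
    by (rule ex_sequence_in_dense[OF dense])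
  have meas: "(\<lambda>w. blinfun_apply (\<Lambda> w) z) \<in> borel_measurable M" for z
  proof -
    obtain s where s: "\<And>n::nat. s n \<in> D" "s \<longlonglongrightarrow> z" using approx by blast
    show ?thesis
    proof (rule borel_measurable_LIMSEQ_metric)
      show "(\<lambda>w. indicator (space M - N) w * H (s n) w) \<in> borel_measurable M" for n
        using Nm Hi by (intro borel_measurable_times borel_measurable_indicator) auto
      fix w assume w: "w \<in> space M"
      have "(\<lambda>n. blinfun_apply (\<Lambda> w) (s n)) \<longlonglongrightarrow> blinfun_apply (\<Lambda> w) z"
        by (intro tendsto_intros s)
      moreover have "blinfun_apply (\<Lambda> w) (s n) = indicator (space M - N) w * H (s n) w" for n
        using \<Lambda>(2)[of w "s n"] \<Lambda>(3)[of w] s(1) by (cases "w \<in> space M - N") auto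
      ultimately show "(\<lambda>n. indicator (space M - N) w * H (s n) w) \<longlonglongrightarrow> blinfun_apply (\<Lambda> w) z" by simp
    qed
  qed
  \<comment> \<open>Off \<open>N\<close> agreement is known on \<open>D\<close> only. For a given
    \<open>z\<close> it is obtained almost everywhere from a sequence in \<open>D\<close>, along
    which both sides converge.\<close>
  have ae: "AE w in M. blinfun_apply (\<Lambda> w) z = H z w" for z
  proof -
    obtain s where s: "\<And>n::nat. s n \<in> D" "s \<longlonglongrightarrow> z" using approx by blast
    have "AE w in M. \<bar>H (s n) w - H z w\<bar> \<le> norm (s n - z) * g w" for n
      using defect[of "s n" 0 "s n" z] by simp
    then have "AE w in M. \<forall>n. \<bar>H (s n) w - H z w\<bar> \<le> norm (s n - z) * g w" by (simp add: AE_all_countable)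
    then show ?thesis using AE_not_in[OF N(1)] AE_space
    proof eventually_elim
      case (elim w)
      have "(\<lambda>n. norm (s n - z) * g w) \<longlonglongrightarrow> norm (z - z) * g w" by (intro tendsto_intros s)
      then have "(\<lambda>n. norm (s n - z) * g w) \<longlonglongrightarrow> 0" by simp
      then have "(\<lambda>n. H (s n) w - H z w) \<longlonglongrightarrow> 0"
        by (rule Lim_null_comparison[rotated]) (use elim(1) in auto)
      then have "(\<lambda>n. H (s n) w) \<longlonglongrightarrow> H z w" by (simp add: LIM_zero_iff)
      moreover have "(\<lambda>n. H (s n) w) \<longlonglongrightarrow> blinfun_apply (\<Lambda> w) z"
      proof -
        have "(\<lambda>n. blinfun_apply (\<Lambda> w) (s n)) \<longlonglongrightarrow> blinfun_apply (\<Lambda> w) z" by (intro tendsto_intros s)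
        then show ?thesis using \<Lambda>(2)[of w] s(1) elim by simp
      qed
      ultimately show ?case using LIMSEQ_unique by blast
    qed
  qed
  have "l (cut_to A (\<lambda>_. z)) = (\<integral>w. indicator A w * blinfun_apply (\<Lambda> w) z \<partial>M)" if A: "A \<in> sets M" for z A
  proof -
    have "(\<integral>w. indicator A w * blinfun_apply (\<Lambda> w) z \<partial>M) = (\<integral>w. indicator A w * H z w \<partial>M)"
    proof (rule integral_cong_AE)
      show "AE w in M. indicator A w * blinfun_apply (\<Lambda> w) z = indicator A w * H z w"
        using ae[of z] by eventually_elim simp
      show "(\<lambda>w. indicator A w * blinfun_apply (\<Lambda> w) z) \<in> borel_measurable M"
        "(\<lambda>w. indicator A w * H z w) \<in> borel_measurable M"
        using meas[of z] A Hi[of z] by (auto intro!: borel_measurable_times borel_measurable_indicator)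
    qed
    then show ?thesis using H A by simp
  qed
  then show ?thesis using g(1) \<Lambda>(1) meas by (intro exI[of _ \<Lambda>] exI[of _ g]) auto
qed

end

section \<open>Measurability of functions with values in the dual\<close>

lemma borel_measurable_blinfun_apply:
  fixes F :: "'a \<Rightarrow> 'z::{real_normed_vector, second_countable_topology} \<Rightarrow>\<^sub>L real"
  assumes F: "\<And>z. (\<lambda>w. blinfun_apply (F w) z) \<in> borel_measurable M" and u: "u \<in> borel_measurable M"
  shows "(\<lambda>w. blinfun_apply (F w) (u w)) \<in> borel_measurable M"
proof -
  obtain s where s: "\<And>i. simple_function M (s i)" "\<And>w. w \<in> space M \<Longrightarrow> (\<lambda>i. s i w) \<longlonglongrightarrow> u w"
    using borel_measurable_implies_sequence_metric[OF u, of 0] by blast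
  show ?thesis
  proof (rule borel_measurable_LIMSEQ_metric)
    show "(\<lambda>i. blinfun_apply (F w) (s i w)) \<longlonglongrightarrow> blinfun_apply (F w) (u w)" if "w \<in> space M" for w
      by (intro tendsto_intros s(2) that)
    fix i
    have fin: "finite (s i ` space M)" using simple_functionD(1)[OF s(1)] .
    have "(\<lambda>w. \<Sum>y\<in>s i ` space M. indicator (s i -` {y} \<inter> space M) w * blinfun_apply (F w) y) \<in> borel_measurable M"
      using simple_functionD(2)[OF s(1)] F
      by (intro borel_measurable_sum borel_measurable_times borel_measurable_indicator) auto
    moreover have "(\<Sum>y\<in>s i ` space M. indicator (s i -` {y} \<inter> space M) w * blinfun_apply (F w) y) =
        blinfun_apply (F w) (s i w)" if w: "w \<in> space M" for w
    proof -
      have "(\<Sum>y\<in>s i ` space M. indicator (s i -` {y} \<inter> space M) w * blinfun_apply (F w) y) =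
          (\<Sum>y\<in>s i ` space M. if y = s i w then blinfun_apply (F w) y else 0)"
        using w by (intro sum.cong) (auto simp: indicator_def)
      then show ?thesis using fin w by (simp add: sum.delta)
    qed
    ultimately show "(\<lambda>w. blinfun_apply (F w) (s i w)) \<in> borel_measurable M"
      using measurable_cong[of M "\<lambda>w. \<Sum>y\<in>s i ` space M. indicator (s i -` {y} \<inter> space M) w * blinfun_apply (F w) y"
          "\<lambda>w. blinfun_apply (F w) (s i w)" borel] by blast
  qed
qed

text \<open>By continuity, \<open>norm f \<le> a\<close> is decided by the inequalities
  \<open>\<bar>blinfun_apply f d\<bar> \<le> a * norm d\<close> on a countable dense set, so
  sublevel sets of the norm are countable intersections of measurable sets.\<close>

lemma borel_measurable_norm_blinfun:
  fixes F :: "'a \<Rightarrow> 'z::{real_normed_vector, second_countable_topology} \<Rightarrow>\<^sub>L real"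
  assumes F: "\<And>z. (\<lambda>w. blinfun_apply (F w) z) \<in> borel_measurable M"
  shows "(\<lambda>w. norm (F w)) \<in> borel_measurable M"
  unfolding borel_measurable_iff_le
proof
  fix a :: real
  obtain D :: "'z set" where D: "countable D" "\<And>X. open X \<Longrightarrow> X \<noteq> {} \<Longrightarrow> \<exists>d\<in>D. d \<in> X"
    by (erule countable_dense_setE)
  show "{w \<in> space M. norm (F w) \<le> a} \<in> sets M"
  proof (cases "a \<ge> 0")
    case False
    then have "{w \<in> space M. norm (F w) \<le> a} = {}" using norm_ge_zero order_trans by blast
    then show ?thesis by (simp only: sets.empty_sets)
  next
    case True
    have "norm f \<le> a \<longleftrightarrow> (\<forall>d\<in>D. \<bar>blinfun_apply f d\<bar> \<le> a * norm d)" for f :: "'z \<Rightarrow>\<^sub>L real"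
    proof
      assume "norm f \<le> a"
      then show "\<forall>d\<in>D. \<bar>blinfun_apply f d\<bar> \<le> a * norm d"
        using norm_blinfun[of f] mult_right_mono[of "norm f" a "norm d" for d] by (force intro: order_trans)
    next
      assume d: "\<forall>d\<in>D. \<bar>blinfun_apply f d\<bar> \<le> a * norm d"
      let ?C = "{z. \<bar>blinfun_apply f z\<bar> \<le> a * norm z}"
      have "closed ?C" by (intro closed_Collect_le continuous_intros)
      have "- ?C = {}"
      proof (rule ccontr)
        assume "- ?C \<noteq> {}"
        then obtain d' where "d' \<in> D" "d' \<in> - ?C" using D(2)[of "- ?C"] \<open>closed ?C\<close> by auto
        then show False using d by auto
      qed
      then have "\<bar>blinfun_apply f z\<bar> \<le> a * norm z" for z by blast
      then show "norm f \<le> a" using True by (intro norm_blinfun_bound) (auto simp: mult.commute)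
    qed
    then have "{w \<in> space M. norm (F w) \<le> a} = {w \<in> space M. \<forall>d\<in>D. \<bar>blinfun_apply (F w) d\<bar> \<le> a * norm d}" by simp
    moreover have "{w \<in> space M. \<forall>d\<in>D. \<bar>blinfun_apply (F w) d\<bar> \<le> a * norm d} \<in> sets M"
      by (intro sets.sets_Collect_countable_All' D(1) borel_measurable_le borel_measurable_abs F) auto
    ultimately show ?thesis by simp
  qed
qed

text \<open>Pettis' theorem in the only case needed: simple functions choose, among the first \<open>n\<close>
  elements of a dense sequence of the dual, one that is closest to \<open>F w\<close>.\<close>
lemma strongly_measurable_blinfun:
  fixes F :: "'a \<Rightarrow> 'z::{real_normed_vector, second_countable_topology} \<Rightarrow>\<^sub>L real"
  assumes refl: "reflexive_space TYPE('z)"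
    and F: "\<And>z. (\<lambda>w. blinfun_apply (F w) z) \<in> borel_measurable M"
  shows "strongly_measurable M F"
proof -
  obtain E :: "('z \<Rightarrow>\<^sub>L real) set" where E: "countable E" "E \<noteq> {}" "\<And>f \<epsilon>. \<epsilon> > 0 \<Longrightarrow> \<exists>e\<in>E. norm (f - e) < \<epsilon>"
    using reflexive_space_separable_dual[OF refl] by metis
  define \<phi> where "\<phi> = from_nat_into E"
  \<comment> \<open>The best candidate so far is kept unless the next one is strictly closer. The
    recursive form makes simplicity an induction: each step splits \<open>s n\<close> along one
    measurable set.\<close>
  define s where "s = rec_nat (\<lambda>w. \<phi> 0) (\<lambda>n t w. if norm (F w - \<phi> (Suc n)) < norm (F w - t w) then \<phi> (Suc n) else t w)"
  have s0: "s 0 = (\<lambda>w. \<phi> 0)" by (simp add: s_def)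
  have sS: "s (Suc n) = (\<lambda>w. if norm (F w - \<phi> (Suc n)) < norm (F w - s n w) then \<phi> (Suc n) else s n w)" for n
    unfolding s_def by simp
  have simple: "simple_function M (s n)" for n
  proof (induction n)
    case (Suc n)
    have nm: "(\<lambda>w. norm (F w - t w)) \<in> borel_measurable M" if t: "simple_function M t" for t
    proof (rule borel_measurable_norm_blinfun)
      fix z
      have "(\<lambda>w. blinfun_apply (t w) z) \<in> borel_measurable M"
        using simple_function_compose1[OF t, of "\<lambda>f. blinfun_apply f z"] by (rule borel_measurable_simple_function)
      then show "(\<lambda>w. blinfun_apply (F w - t w) z) \<in> borel_measurable M"
        using F by (simp add: blinfun.diff_left)
    qed
    have "{w \<in> space M. norm (F w - \<phi> (Suc n)) < norm (F w - s n w)} \<in> sets M"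
      by (intro borel_measurable_less nm Suc simple_function_const)
    then show ?case unfolding sS by (intro simple_function_If Suc simple_function_const)
  qed (simp add: s0)
  have best: "norm (F w - s n w) \<le> norm (F w - \<phi> k)" if "k \<le> n" for k n w
    using that
  proof (induction n)
    case (Suc n)
    then show ?case by (cases "k = Suc n") (auto simp: sS)
  qed (simp add: s0)
  have "(\<lambda>n. s n w) \<longlonglongrightarrow> F w" for w
  proof (rule LIMSEQ_I)
    fix r :: real assume "r > 0"
    then obtain f where "f \<in> E" "norm (F w - f) < r" using E(3) by blast
    then obtain k where "norm (F w - \<phi> k) < r"
      unfolding \<phi>_def using from_nat_into_surj[OF E(1)] by metis
    then have "\<forall>n\<ge>k. norm (s n w - F w) < r"
      using best[of k _ w] by (auto simp: norm_minus_commute intro: le_less_trans)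
    then show "\<exists>k. \<forall>n\<ge>k. norm (s n w - F w) < r" by blast
  qed
  then show ?thesis unfolding strongly_measurable_def using simple by (intro exI[of _ s]) auto
qed

section \<open>Representation of absolutely continuous functionals by integrals\<close>

context ac_functional
begin

lemma l_sum:
  assumes "finite Y" "\<And>y. y \<in> Y \<Longrightarrow> f y \<in> bdd_measurable M"
  shows "(\<lambda>w. \<Sum>y\<in>Y. f y w) \<in> bdd_measurable M \<and> l (\<lambda>w. \<Sum>y\<in>Y. f y w) = (\<Sum>y\<in>Y. l (f y))"
  using assms
proof (induction Y)
  case empty
  then show ?case by (simp add: bdd_measurable_zero l_zero)
next
  case (insert y Y)
  then have "(\<lambda>w. \<Sum>y\<in>Y. f y w) \<in> bdd_measurable M" "l (\<lambda>w. \<Sum>y\<in>Y. f y w) = (\<Sum>y\<in>Y. l (f y))"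
    "f y \<in> bdd_measurable M" by auto
  then show ?case using insert.hyps by (simp add: l_add bdd_measurable_add)
qed

text \<open>Dominated convergence for \<open>l\<close>. Where \<open>v n\<close> exceeds
  \<open>\<eta>\<close>, a set of vanishing probability, absolute continuity is used; elsewhere the
  sup norm bound. It bridges the gap that simple functions in general approximate pointwise and not
  uniformly.\<close>

lemma l_tendsto:
  assumes v: "\<And>n::nat. v n \<in> bdd_measurable M" and b: "b > 0" "\<And>n w. w \<in> space M \<Longrightarrow> norm (v n w) \<le> b"
    and lim: "\<And>w. w \<in> space M \<Longrightarrow> (\<lambda>n. v n w) \<longlonglongrightarrow> 0"
  shows "(\<lambda>n. l (v n)) \<longlonglongrightarrow> 0"
proof (rule LIMSEQ_I)
  fix r :: real assume r: "r > 0"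
  have c0: "c \<ge> 0" using variation_le_c[of "{}"] by (simp add: variation_empty)
  \<comment> \<open>Makes the contribution \<open>c * \<eta>\<close> of the small values less than
    \<open>r / 2\<close>; \<open>c + 1\<close> avoids division by 0. The large values contribute at
    most the other half.\<close>
  define \<eta> where "\<eta> = r / (3 * (c + 1))"
  have \<eta>: "\<eta> > 0" "c * \<eta> < r / 2"
  proof -
    show "\<eta> > 0" unfolding \<eta>_def using r c0 by simp
    then have "c * \<eta> \<le> (c + 1) * \<eta>" by (intro mult_right_mono) auto
    also have "\<dots> = r / 3" unfolding \<eta>_def using c0 by (simp add: field_simps)
    finally show "c * \<eta> < r / 2" using r by simp
  qed
  define A where "A n = {w \<in> space M. \<eta> < norm (v n w)}" for n
  have vm: "v n \<in> borel_measurable M" for n using v by (rule bdd_measurableD)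
  have A: "A n \<in> sets M" for n unfolding A_def using vm by measurable
  have "(\<lambda>n. \<integral>w. indicat_real (A n) w \<partial>M) \<longlonglongrightarrow> (\<integral>w. 0 \<partial>M)"
  proof (rule integral_dominated_convergence[where w = "\<lambda>_. 1"])
    show "AE w in M. (\<lambda>n. indicat_real (A n) w) \<longlonglongrightarrow> 0"
    proof (rule AE_I2)
      fix w assume w: "w \<in> space M"
      have "\<forall>\<^sub>F n in sequentially. norm (v n w) < \<eta>"
        using order_tendstoD(2)[OF tendsto_norm_zero[OF lim[OF w]] \<eta>(1)] .
      then have "\<forall>\<^sub>F n in sequentially. indicat_real (A n) w = 0"
        by eventually_elim (simp add: A_def)
      then show "(\<lambda>n. indicat_real (A n) w) \<longlonglongrightarrow> 0" by (rule tendsto_eventually)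
    qed
    show "AE w in M. norm (indicat_real (A n) w) \<le> 1" for n by (simp add: indicator_def)
  qed (use A in auto)
  then have pA: "(\<lambda>n. prob (A n)) \<longlonglongrightarrow> 0"
    using sets.sets_into_space[OF A] by (simp add: Int_absorb2)
  have "r / (2 * b) > 0" using r b(1) by simp
  from ac[OF this] obtain \<delta> where d: "\<delta> > 0" "\<forall>A\<in>sets M. prob A < \<delta> \<longrightarrow> (\<forall>u\<in>bdd_measurable M. \<forall>b'\<ge>0.
      norm_le_on M u b' \<longrightarrow> \<bar>l (cut_to A u)\<bar> \<le> b' * (r / (2 * b)))"
    by (elim exE conjE)
  obtain N where N: "\<forall>n\<ge>N. prob (A n) < \<delta>"
    using order_tendstoD(2)[OF pA d(1)] unfolding eventually_sequentially by blast
  have "norm (l (v n) - 0) < r" if n: "n \<ge> N" for n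
  proof -
    have B: "space M - A n \<in> sets M" using A by auto
    have "l (v n) = l (\<lambda>w. cut_to (A n) (v n) w + cut_to (space M - A n) (v n) w)"
      using A B v by (intro l_cong bdd_measurable_add bdd_measurable_cut_to)
        (auto simp: cut_to_def indicator_def)
    also have "\<dots> = l (cut_to (A n) (v n)) + l (cut_to (space M - A n) (v n))"
      using A B v by (intro l_add bdd_measurable_cut_to)
    finally have e: "l (v n) = l (cut_to (A n) (v n)) + l (cut_to (space M - A n) (v n))" .
    have "\<bar>l (cut_to (space M - A n) (v n))\<bar> \<le> c * \<eta>"
      using B v \<eta>(1) by (intro functional_bound bdd_measurable_cut_to)
        (auto simp: cut_to_def A_def indicator_def)
    moreover have "\<bar>l (cut_to (A n) (v n))\<bar> \<le> b * (r / (2 * b))"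
      using A N n v b by (intro d(2)[rule_format]) auto
    moreover have "b * (r / (2 * b)) = r / 2" using b(1) by simp
    ultimately show ?thesis using e \<eta>(2) by simp
  qed
  then show "\<exists>N. \<forall>n\<ge>N. norm (l (v n) - 0) < r" by blast
qed

text \<open>Both sides agree on \<open>cut_to A (\<lambda>_. z)\<close> by the choice of the
  density, hence on simple functions. For general \<open>u\<close>, simple functions with norm at
  most \<open>2 * norm (u w)\<close> converge pointwise, and both sides pass to the limit.\<close>

lemma ex_integral_representation:
  "\<exists>(\<Lambda> :: 'a \<Rightarrow> 'z \<Rightarrow>\<^sub>L real) g. integrable M g \<and> (\<forall>w. norm (\<Lambda> w) \<le> g w) \<and>
    (\<forall>z. (\<lambda>w. blinfun_apply (\<Lambda> w) z) \<in> borel_measurable M) \<and>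
    (\<forall>u\<in>bdd_measurable M. l u = (\<integral>w. blinfun_apply (\<Lambda> w) (u w) \<partial>M))"
proof -
  obtain \<Lambda> :: "'a \<Rightarrow> 'z \<Rightarrow>\<^sub>L real" and g where g: "integrable M g" "\<forall>w. norm (\<Lambda> w) \<le> g w"
    and \<Lambda>: "\<forall>z. (\<lambda>w. blinfun_apply (\<Lambda> w) z) \<in> borel_measurable M"
      "\<forall>z. \<forall>A\<in>sets M. l (cut_to A (\<lambda>_. z)) = (\<integral>w. indicator A w * blinfun_apply (\<Lambda> w) z \<partial>M)"
    using ex_operator_density by (elim exE conjE)
  have \<Lambda>m: "(\<lambda>w. blinfun_apply (\<Lambda> w) z) \<in> borel_measurable M" for z using \<Lambda>(1) by blast
  have le: "\<bar>blinfun_apply (\<Lambda> w) z\<bar> \<le> g w * norm z" for w z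
    using norm_blinfun[of "\<Lambda> w" z] mult_right_mono[of "norm (\<Lambda> w)" "g w" "norm z"] g(2) by simp
  have int: "integrable M (\<lambda>w. indicator A w * blinfun_apply (\<Lambda> w) z)" if A: "A \<in> sets M" for A z
  proof (rule Bochner_Integration.integrable_bound[of _ "\<lambda>w. g w * norm z"])
    show "AE w in M. norm (indicator A w * blinfun_apply (\<Lambda> w) z) \<le> norm (g w * norm z)"
    proof (rule AE_I2)
      fix w
      have "0 \<le> g w" using g(2) norm_ge_zero order_trans by blast
      then show "norm (indicator A w * blinfun_apply (\<Lambda> w) z) \<le> norm (g w * norm z)"
        using le[of w z] by (auto simp: indicator_def abs_mult)
    qed
  qed (use g(1) \<Lambda>m A in auto)
  have simple: "s \<in> bdd_measurable M \<and> l s = (\<integral>w. blinfun_apply (\<Lambda> w) (s w) \<partial>M)"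
    if s: "simple_function M s" for s :: "'a \<Rightarrow> 'z"
  proof -
    let ?Y = "s ` space M"
    let ?A = "\<lambda>y. s -` {y} \<inter> space M"
    have fin: "finite ?Y" and A: "?A y \<in> sets M" for y using simple_functionD[OF s] by auto
    have cm: "cut_to (?A y) (\<lambda>_. y) \<in> bdd_measurable M" for y
      by (intro bdd_measurable_cut_to A const_bdd_measurable)
    have sm: "s \<in> bdd_measurable M"
    proof (rule bdd_measurableI[OF borel_measurable_simple_function[OF s]])
      show "norm (s w) \<le> Max (norm ` ?Y)" if "w \<in> space M" for w
        using fin that by (intro Max_ge) auto
    qed
    \<comment> \<open>At \<open>w\<close> only the summand for the value \<open>s w\<close>
      survives. The form with arbitrary \<open>h\<close> serves both the decomposition of
      \<open>s\<close> and that of the integrand.\<close>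
    have pick: "(\<Sum>y\<in>?Y. indicat_real (?A y) w *\<^sub>R h y) = h (s w)" if w: "w \<in> space M" for w and h :: "'z \<Rightarrow> 'q::real_vector"
    proof -
      have "(\<Sum>y\<in>?Y. indicat_real (?A y) w *\<^sub>R h y) = (\<Sum>y\<in>?Y. if y = s w then h y else 0)"
        using w by (intro sum.cong) (auto simp: indicator_def)
      then show ?thesis using fin w by (simp add: sum.delta)
    qed
    note sum_cut = l_sum[OF fin, of "\<lambda>y. cut_to (?A y) (\<lambda>_. y)", OF cm]
    have "l s = l (\<lambda>w. \<Sum>y\<in>?Y. cut_to (?A y) (\<lambda>_. y) w)"
      using sum_cut pick[of _ "\<lambda>y. y"] by (intro l_cong sm) (auto simp: cut_to_def)
    also have "\<dots> = (\<Sum>y\<in>?Y. l (cut_to (?A y) (\<lambda>_. y)))" using sum_cut by blast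
    also have "\<dots> = (\<Sum>y\<in>?Y. \<integral>w. indicator (?A y) w * blinfun_apply (\<Lambda> w) y \<partial>M)"
      using \<Lambda>(2) A by (intro sum.cong) auto
    also have "\<dots> = (\<integral>w. (\<Sum>y\<in>?Y. indicator (?A y) w * blinfun_apply (\<Lambda> w) y) \<partial>M)"
      using int A by (intro Bochner_Integration.integral_sum[symmetric]) auto
    also have "\<dots> = (\<integral>w. blinfun_apply (\<Lambda> w) (s w) \<partial>M)"
      using pick[of _ "blinfun_apply (\<Lambda> w)" for w] by (intro Bochner_Integration.integral_cong) auto
    finally show ?thesis using sm by blast
  qed
  have "l u = (\<integral>w. blinfun_apply (\<Lambda> w) (u w) \<partial>M)" if u: "u \<in> bdd_measurable M" for u
  proof -
    obtain b where b: "b > 0" "norm_le_on M u b" by (rule bdd_measurable_bound[OF u])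
    obtain s where s: "\<And>i. simple_function M (s i)" "\<And>w. w \<in> space M \<Longrightarrow> (\<lambda>i. s i w) \<longlonglongrightarrow> u w"
      "\<And>i w. w \<in> space M \<Longrightarrow> norm (s i w) \<le> 2 * norm (u w)"
      using borel_measurable_implies_sequence_metric[OF bdd_measurableD[OF u], of 0] by (metis dist_0_norm dist_commute)
    have sb: "norm (s i w) \<le> 2 * b" if "w \<in> space M" for i w
      using s(3)[OF that, of i] b(2) that by force
    have sm: "s i \<in> bdd_measurable M" for i using simple[OF s(1)] by blast
    have "(\<lambda>i. l (\<lambda>w. s i w - u w)) \<longlonglongrightarrow> 0"
    proof (rule l_tendsto[of _ "3 * b"])
      show "(\<lambda>w. s i w - u w) \<in> bdd_measurable M" for i by (intro bdd_measurable_diff sm u)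
      show "norm (s i w - u w) \<le> 3 * b" if "w \<in> space M" for i w
        using norm_triangle_ineq4[of "s i w" "u w"] sb[OF that, of i] b(2) that by force
      show "(\<lambda>i. s i w - u w) \<longlonglongrightarrow> 0" if "w \<in> space M" for w
        using s(2)[OF that] by (simp add: LIM_zero_iff)
    qed (use b in auto)
    then have "(\<lambda>i. l (s i)) \<longlonglongrightarrow> l u" by (simp add: l_diff sm u LIM_zero_iff)
    then have 1: "(\<lambda>i. \<integral>w. blinfun_apply (\<Lambda> w) (s i w) \<partial>M) \<longlonglongrightarrow> l u" using simple[OF s(1)] by simp
    have 2: "(\<lambda>i. \<integral>w. blinfun_apply (\<Lambda> w) (s i w) \<partial>M) \<longlonglongrightarrow> (\<integral>w. blinfun_apply (\<Lambda> w) (u w) \<partial>M)"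
    proof (rule integral_dominated_convergence[where w = "\<lambda>w. g w * (2 * b)"])
      show "(\<lambda>w. blinfun_apply (\<Lambda> w) (u w)) \<in> borel_measurable M"
        by (rule borel_measurable_blinfun_apply[OF \<Lambda>m bdd_measurableD[OF u]])
      show "(\<lambda>w. blinfun_apply (\<Lambda> w) (s i w)) \<in> borel_measurable M" for i
        by (rule borel_measurable_blinfun_apply[OF \<Lambda>m bdd_measurableD[OF sm]])
      show "AE w in M. (\<lambda>i. blinfun_apply (\<Lambda> w) (s i w)) \<longlonglongrightarrow> blinfun_apply (\<Lambda> w) (u w)"
        by (intro AE_I2 tendsto_intros s(2))
      show "AE w in M. norm (blinfun_apply (\<Lambda> w) (s i w)) \<le> g w * (2 * b)" for i
      proof (rule AE_I2)
        fix w assume w: "w \<in> space M"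
        have "0 \<le> g w" using g(2) norm_ge_zero order_trans by blast
        then have "g w * norm (s i w) \<le> g w * (2 * b)" using sb[OF w] by (intro mult_left_mono)
        then show "norm (blinfun_apply (\<Lambda> w) (s i w)) \<le> g w * (2 * b)" using le[of w "s i w"] by simp
      qed
    qed (use g(1) in auto)
    show ?thesis using LIMSEQ_unique[OF 1 2] .
  qed
  then show ?thesis using g \<Lambda>(1) by (intro exI[of _ \<Lambda>] exI[of _ g]) auto
qed

end

theorem (in recourse_problem) ex_integrable_multiplier:
  "\<exists>(\<Lambda> :: 'a \<Rightarrow> 'z \<Rightarrow>\<^sub>L real) g. integrable M g \<and> (\<forall>w. norm (\<Lambda> w) \<le> g w) \<and>
    (\<forall>z. (\<lambda>w. blinfun_apply (\<Lambda> w) z) \<in> borel_measurable M) \<and>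
    (\<forall>x1 x2. \<forall>u\<in>bdd_measurable M. adm x1 x2 u \<longrightarrow>
      (\<integral>w. blinfun_apply (\<Lambda> w) (u w) \<partial>M) \<le> cost x1 x2 - v0)"
proof -
  obtain l where l: "linear_functional_on (bdd_measurable M) l"
    "\<forall>x1 x2. \<forall>u\<in>bdd_measurable M. adm x1 x2 u \<longrightarrow> l u \<le> cost x1 x2 - v0"
    using ex_linear_minorant by (elim exE conjE)
  have "\<exists>c. \<forall>u\<in>bdd_measurable M. \<forall>b>0. norm_le_on M u b \<longrightarrow> \<bar>l u\<bar> \<le> c * b"
    using l(2) by (intro linear_minorant_bounded l(1)) blast
  then obtain c where "bounded_functional M l c"
    using l(1) by (auto simp: bounded_functional_def bounded_functional_axioms_def prob_space_axioms)
  then interpret f: bounded_functional M l c .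
  obtain l' and F :: "nat \<Rightarrow> 'a set" where l': "bounded_functional M l' c" "\<forall>n. F n \<in> sets M"
    "(\<lambda>n. prob (F n)) \<longlonglongrightarrow> 0"
    "\<forall>u\<in>bdd_measurable M. (\<lambda>n. l (cut_to (space M - F n) u)) \<longlonglongrightarrow> l' u"
    "\<forall>\<epsilon>>0. \<exists>\<delta>>0. \<forall>A\<in>sets M. prob A < \<delta> \<longrightarrow> (\<forall>u\<in>bdd_measurable M. \<forall>b\<ge>0.
      norm_le_on M u b \<longrightarrow> \<bar>l' (cut_to A u)\<bar> \<le> b * \<epsilon>)"
    using f.ex_absolutely_continuous_part by (elim exE conjE)
  have "ac_functional M l' c"
    using l'(1,5) by (simp add: ac_functional_def ac_functional_axioms_def)
  then interpret a: ac_functional M l' c .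
  have F: "F n \<in> sets M" for n using l'(2) by blast
  have le: "l' u \<le> cost x1 x2 - v0" if u: "u \<in> bdd_measurable M" and x: "adm x1 x2 u" for x1 x2 u
  proof -
    obtain y where y: "adm x1 y (\<lambda>_. 0)" using recourse[OF x] by blast
    have m: "x2 \<in> bdd_measurable M" "y \<in> bdd_measurable M"
      using x y by (simp_all add: admissible_def)
    obtain p where p: "p > 0" "norm_le_on M x2 p" by (rule bdd_measurable_bound[OF m(1)])
    obtain q where q: "q > 0" "norm_le_on M y q" by (rule bdd_measurable_bound[OF m(2)])
    have "norm x1 + p + q > 0" using p(1) q(1) norm_ge_zero[of x1] by linarith
    from bounded_J2[OF this] obtain a where a: "\<And>z. norm x1 + norm z \<le> norm x1 + p + q \<Longrightarrow> \<bar>J2 x1 z\<bar> \<le> a" by blast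
    have ax: "\<bar>J2 x1 (x2 w)\<bar> \<le> a" "\<bar>J2 x1 (y w)\<bar> \<le> a" if "w \<in> space M" for w
      using p q that by (auto intro!: a simp: add_increasing2)
    \<comment> \<open>Recourse on \<open>F n\<close> and the original decision elsewhere: the same
      \<open>x1\<close> then serves the perturbation that is 0 on \<open>F n\<close> and
      \<open>u\<close> off it.\<close>
    define z where "z n w = (if w \<in> F n then y w else x2 w)" for n w
    have zm: "z n \<in> bdd_measurable M" for n
    proof (rule bdd_measurableI[of _ _ "p + q"])
      show "z n \<in> borel_measurable M"
        unfolding z_def using F m by (intro measurable_If_set) (auto simp: bdd_measurableD)
      show "norm (z n w) \<le> p + q" if "w \<in> space M" for w
        using p q that by (auto simp: z_def add_increasing add_increasing2)
    qed
    have adm: "adm x1 (z n) (cut_to (space M - F n) u)" for n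
    proof -
      have "AE w in M. (x1, x2 w, u w) \<in> G w" "AE w in M. (x1, y w, 0) \<in> G w"
        using x y by (simp_all add: admissible_def)
      then have "AE w in M. (x1, z n w, cut_to (space M - F n) u w) \<in> G w"
        using AE_space by eventually_elim (auto simp: z_def cut_to_def)
      then show ?thesis using zm by (simp add: admissible_def)
    qed
    \<comment> \<open>The two second-stage costs differ by at most \<open>2 * a\<close>, and only on
      \<open>F n\<close>.\<close>
    have cost: "cost x1 (z n) \<le> cost x1 x2 + 2 * a * prob (F n)" for n
    proof -
      have ind: "integrable M (indicat_real (F n))"
        by (intro integrable_real_indicator F) (simp add: emeasure_eq_measure)
      have "(\<integral>w. J2 x1 (z n w) \<partial>M) \<le> (\<integral>w. J2 x1 (x2 w) + 2 * a * indicat_real (F n) w \<partial>M)"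
      proof (rule integral_mono_AE)
        show "AE w in M. J2 x1 (z n w) \<le> J2 x1 (x2 w) + 2 * a * indicat_real (F n) w"
        proof (rule AE_I2)
          fix w assume "w \<in> space M"
          from ax[OF this] show "J2 x1 (z n w) \<le> J2 x1 (x2 w) + 2 * a * indicat_real (F n) w"
            by (auto simp: z_def abs_le_iff indicator_def)
        qed
      qed (use integrable_J2[OF zm] integrable_J2[OF m(1)] ind in simp_all)
      also have "\<dots> = (\<integral>w. J2 x1 (x2 w) \<partial>M) + 2 * a * prob (F n)"
        using integrable_J2[OF m(1)] ind sets.sets_into_space[OF F] by (simp add: Int_absorb2)
      finally show ?thesis by (simp add: expected_cost_def)
    qed
    show ?thesis
    proof (rule LIMSEQ_le)
      show "(\<lambda>n. l (cut_to (space M - F n) u)) \<longlonglongrightarrow> l' u" using l'(4) u by blast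
      have "(\<lambda>n. cost x1 x2 + 2 * a * prob (F n) - v0) \<longlonglongrightarrow> cost x1 x2 + 2 * a * 0 - v0"
        by (intro tendsto_intros l'(3))
      then show "(\<lambda>n. cost x1 x2 + 2 * a * prob (F n) - v0) \<longlonglongrightarrow> cost x1 x2 - v0" by simp
      have "l (cut_to (space M - F n) u) \<le> cost x1 x2 + 2 * a * prob (F n) - v0" for n
      proof -
        have "cut_to (space M - F n) u \<in> bdd_measurable M" using F by (intro bdd_measurable_cut_to u) auto
        then have "l (cut_to (space M - F n) u) \<le> cost x1 (z n) - v0" using l(2) adm by blast
        then show ?thesis using cost[of n] by simp
      qed
      then show "\<exists>N. \<forall>n\<ge>N. l (cut_to (space M - F n) u) \<le> cost x1 x2 + 2 * a * prob (F n) - v0" by blast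
    qed
  qed
  obtain \<Lambda> :: "'a \<Rightarrow> 'z \<Rightarrow>\<^sub>L real" and g where \<Lambda>: "integrable M g" "\<forall>w. norm (\<Lambda> w) \<le> g w"
    "\<forall>z. (\<lambda>w. blinfun_apply (\<Lambda> w) z) \<in> borel_measurable M"
    "\<forall>u\<in>bdd_measurable M. l' u = (\<integral>w. blinfun_apply (\<Lambda> w) (u w) \<partial>M)"
    using a.ex_integral_representation by (elim exE conjE)
  have "\<forall>x1 x2. \<forall>u\<in>bdd_measurable M. adm x1 x2 u \<longrightarrow>
      (\<integral>w. blinfun_apply (\<Lambda> w) (u w) \<partial>M) \<le> cost x1 x2 - v0"
    using le \<Lambda>(4) by simp
  then show ?thesis using \<Lambda>(1,2,3) by (intro exI[of _ \<Lambda>] exI[of _ g] conjI)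
qed

section \<open>Duality\<close>

text \<open>The passage from essentially bounded functions to functions bounded everywhere: setting
  \<open>f\<close> to 0 where its norm exceeds the essential bound changes it on a null set
  only.\<close>

lemma bochner_Linf_bounded_version:
  fixes f :: "'a \<Rightarrow> 'b::{real_normed_vector, second_countable_topology}"
  assumes f: "f \<in> bochner_Linf M"
  obtains f' where "f' \<in> bdd_measurable M" "AE w in M. f' w = f w"
proof -
  have fm: "f \<in> borel_measurable M" and fin: "Linf_norm M f < \<infinity>"
    using f by (auto simp: bochner_Linf_def)
  obtain c where c: "Linf_norm M f \<le> ereal c"
    using fin by (cases "Linf_norm M f") auto
  have "AE w in M. ereal (norm (f w)) \<le> ereal c"
    using esssup_AE[of "\<lambda>w. ereal (norm (f w))" M]
    by eventually_elim (rule order_trans[OF _ c[unfolded Linf_norm_def]])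
  then have b: "AE w in M. norm (f w) \<le> c" by simp
  define f' where "f' w = (if norm (f w) \<le> c then f w else 0)" for w
  show ?thesis
  proof (rule that[of f'])
    have "f' \<in> borel_measurable M" unfolding f'_def using fm by measurable
    then show "f' \<in> bdd_measurable M"
      by (rule bdd_measurableI[of _ _ "max c 0"]) (auto simp: f'_def)
    show "AE w in M. f' w = f w" using b by eventually_elim (simp add: f'_def)
  qed
qed

lemma Linf_norm_le:
  assumes "f \<in> borel_measurable M" "\<And>w. w \<in> space M \<Longrightarrow> norm (f w) \<le> c"
  shows "Linf_norm M f \<le> ereal c"
  unfolding Linf_norm_def using assms by (intro esssup_I AE_I2) auto

lemma bdd_measurable_bochner_Linf:
  assumes "f \<in> bdd_measurable M"
  shows "f \<in> bochner_Linf M"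
proof -
  obtain c where "norm_le_on M f c" using bdd_measurable_bound[OF assms] by metis
  then have "Linf_norm M f \<le> ereal c" using bdd_measurableD[OF assms] by (intro Linf_norm_le) auto
  then show ?thesis
    using bdd_measurableD[OF assms] by (auto simp: bochner_Linf_def intro: le_less_trans)
qed

text \<open>The condition \<open>x1 \<in> C1\<close> does not involve \<open>w\<close> but is put
  into every fibre, so that admissibility at almost every \<open>w\<close> encodes it as
  well.\<close>

definition constraint_graph :: "'x1 set \<Rightarrow> 'x2 set \<Rightarrow> 'r::real_vector set \<Rightarrow> ('x1 \<Rightarrow> 'x2 \<Rightarrow> 'a \<Rightarrow> 'w) \<Rightarrow> ('x1 \<Rightarrow> 'x2 \<Rightarrow> 'a \<Rightarrow> 'r) \<Rightarrow>
    'a \<Rightarrow> ('x1 \<times> 'x2 \<times> 'w \<times> 'r) set"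
  where "constraint_graph C1 C2 K e i w =
    {(x1, x2, ue, ui). x1 \<in> C1 \<and> x2 \<in> C2 \<and> e x1 x2 w = ue \<and> cone_le K (i x1 x2 w) ui}"

lemma closed_constraint_graph:
  fixes C1 :: "'x1::real_normed_vector set" and C2 :: "'x2::real_normed_vector set"
    and e :: "'x1 \<Rightarrow> 'x2 \<Rightarrow> 'a \<Rightarrow> 'w::real_normed_vector" and i :: "'x1 \<Rightarrow> 'x2 \<Rightarrow> 'a \<Rightarrow> 'r::real_normed_vector"
  assumes "closed C1" "closed C2" "closed K"
    and e: "bounded_linear (\<lambda>(x1, x2). e x1 x2 w)" and i: "continuous_on UNIV (\<lambda>(x1, x2). i x1 x2 w)"
  shows "closed (constraint_graph C1 C2 K e i w)"
proof -
  have pr: "continuous_on UNIV (\<lambda>p :: 'x1 \<times> 'x2 \<times> 'w \<times> 'r. (fst p, fst (snd p)))"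
    by (intro continuous_intros)
  have ec: "continuous_on UNIV (\<lambda>p :: 'x1 \<times> 'x2 \<times> 'w \<times> 'r. e (fst p) (fst (snd p)) w)"
    using continuous_on_compose2[OF linear_continuous_on[OF e, of UNIV] pr subset_UNIV] by simp
  have ic: "continuous_on UNIV (\<lambda>p :: 'x1 \<times> 'x2 \<times> 'w \<times> 'r. i (fst p) (fst (snd p)) w)"
    using continuous_on_compose2[OF i pr subset_UNIV] by simp
  have "constraint_graph C1 C2 K e i w = fst -` C1 \<inter> (\<lambda>p. fst (snd p)) -` C2 \<inter>
      {p. e (fst p) (fst (snd p)) w = fst (snd (snd p))} \<inter>
      (\<lambda>p. snd (snd (snd p)) - i (fst p) (fst (snd p)) w) -` K"
    by (auto simp: constraint_graph_def cone_le_def)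
  moreover have "closed \<dots>"
    using assms(1-3) by (intro closed_Int closed_vimage closed_Collect_eq continuous_intros ec ic)
  ultimately show ?thesis by simp
qed

lemma convex_constraint_graph:
  fixes C1 :: "'x1::real_normed_vector set" and C2 :: "'x2::real_normed_vector set"
    and e :: "'x1 \<Rightarrow> 'x2 \<Rightarrow> 'a \<Rightarrow> 'w::real_normed_vector" and i :: "'x1 \<Rightarrow> 'x2 \<Rightarrow> 'a \<Rightarrow> 'r::real_normed_vector"
  assumes "convex C1" "convex C2" and K: "convex_cone K"
    and e: "bounded_linear (\<lambda>(x1, x2). e x1 x2 w)" and i: "K_convex K (\<lambda>x1 x2. i x1 x2 w)"
  shows "convex (constraint_graph C1 C2 K e i w)"
proof (rule convexI)
  fix p q :: "'x1 \<times> 'x2 \<times> 'w \<times> 'r" and s t :: real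
  assume p: "p \<in> constraint_graph C1 C2 K e i w" and q: "q \<in> constraint_graph C1 C2 K e i w"
    and st: "0 \<le> s" "0 \<le> t" "s + t = 1"
  show "s *\<^sub>R p + t *\<^sub>R q \<in> constraint_graph C1 C2 K e i w"
  \<comment> \<open>\<open>K_convex\<close> speaks of weights strictly between 0 and 1, so the end
    points are treated separately.\<close>
  proof (cases "s = 0 \<or> t = 0")
    case True
    then show ?thesis using p q st by auto
  next
    case False
    then have s: "s \<in> {0<..<1}" "t = 1 - s" using st by auto
    obtain x1 x2 ue ui where P: "p = (x1, x2, ue, ui)" by (cases p)
    obtain y1 y2 ve vi where Q: "q = (y1, y2, ve, vi)" by (cases q)
    have x: "x1 \<in> C1" "x2 \<in> C2" "e x1 x2 w = ue" "ui - i x1 x2 w \<in> K"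
      and y: "y1 \<in> C1" "y2 \<in> C2" "e y1 y2 w = ve" "vi - i y1 y2 w \<in> K"
      using p q by (auto simp: P Q constraint_graph_def cone_le_def)
    interpret e: bounded_linear "\<lambda>(x1, x2). e x1 x2 w" by (rule e)
    have "e (s *\<^sub>R x1 + t *\<^sub>R y1) (s *\<^sub>R x2 + t *\<^sub>R y2) w = s *\<^sub>R ue + t *\<^sub>R ve"
      using e.add[of "s *\<^sub>R (x1, x2)" "t *\<^sub>R (y1, y2)"] e.scaleR[of s "(x1, x2)"] e.scaleR[of t "(y1, y2)"] x(3) y(3)
      by simp
    moreover have "cone_le K (i (s *\<^sub>R x1 + t *\<^sub>R y1) (s *\<^sub>R x2 + t *\<^sub>R y2) w) (s *\<^sub>R ui + t *\<^sub>R vi)"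
    proof -
      \<comment> \<open>The slack of the combination is the convexity defect of \<open>i\<close>
        plus the combined slacks, a sum of two elements of the cone.\<close>
      have "(s *\<^sub>R i x1 x2 w + t *\<^sub>R i y1 y2 w) - i (s *\<^sub>R x1 + t *\<^sub>R y1) (s *\<^sub>R x2 + t *\<^sub>R y2) w \<in> K"
        using i s unfolding K_convex_def cone_le_def by blast
      moreover have "s *\<^sub>R (ui - i x1 x2 w) + t *\<^sub>R (vi - i y1 y2 w) \<in> K"
        using x(4) y(4) st by (intro convex_cone_add[OF K] convex_cone_scaleR[OF K])
      ultimately have "((s *\<^sub>R i x1 x2 w + t *\<^sub>R i y1 y2 w) - i (s *\<^sub>R x1 + t *\<^sub>R y1) (s *\<^sub>R x2 + t *\<^sub>R y2) w) +
          (s *\<^sub>R (ui - i x1 x2 w) + t *\<^sub>R (vi - i y1 y2 w)) \<in> K"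
        by (rule convex_cone_add[OF K])
      then show ?thesis unfolding cone_le_def by (simp add: algebra_simps)
    qed
    moreover have "s *\<^sub>R x1 + t *\<^sub>R y1 \<in> C1" "s *\<^sub>R x2 + t *\<^sub>R y2 \<in> C2"
      using x y st assms(1,2) by (auto intro: convexD)
    ultimately show ?thesis by (simp add: P Q constraint_graph_def)
  qed
qed

lemma value_domainE:
  assumes "u \<in> value_domain M C1 C2 K J1 J2 e i"
  obtains x1 x2 where "x2 \<in> bdd_measurable M"
    "x1 \<in> C1" "AE w in M. x2 w \<in> C2 \<and> e x1 (x2 w) w = fst u w \<and> cone_le K (i x1 (x2 w) w) (snd u w)"
proof -
  have "value_function M C1 C2 K J1 J2 e i u < \<infinity>" using assms by (simp add: value_domain_def)
  then obtain x where x: "x \<in> X_space M" "perturbed_objective M C1 C2 K J1 J2 e i x u < \<infinity>"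
    unfolding value_function_def INF_less_iff by blast
  have f: "fst x \<in> C1" "AE w in M. snd x w \<in> C2 \<and> e (fst x) (snd x w) w = fst u w \<and>
      cone_le K (i (fst x) (snd x w) w) (snd u w)"
    using x(2) unfolding perturbed_objective_def by (auto split: if_splits)
  have "snd x \<in> bochner_Linf M" using x(1) by (auto simp: X_space_def)
  then obtain x2 where x2: "x2 \<in> bdd_measurable M" "AE w in M. x2 w = snd x w"
    by (rule bochner_Linf_bounded_version)
  have "AE w in M. x2 w \<in> C2 \<and> e (fst x) (x2 w) w = fst u w \<and> cone_le K (i (fst x) (x2 w) w) (snd u w)"
    using f(2) x2(2) by eventually_elim simp
  then show ?thesis by (rule that[OF x2(1) f(1)])
qed

text \<open>Weak duality: at a feasible point the Lagrangian is tested with the perturbation 0,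
  where the pairing vanishes.\<close>

lemma dual_objective_le_inf_P:
  "dual_objective M C1 C2 K J1 J2 e i l \<le> inf_P M C1 C2 K J1 J2 e i"
  unfolding inf_P_def
proof (rule INF_greatest)
  fix x assume x: "x \<in> feasible_set M C1 C2 K e i"
  then have xX: "x \<in> X_space M" by (auto simp: feasible_set_def)
  have p: "perturbed_objective M C1 C2 K J1 J2 e i x ((\<lambda>_. 0), (\<lambda>_. 0)) = ereal (objective M J1 J2 x)"
    using x by (auto simp: perturbed_objective_def feasible_set_def)
  have u: "((\<lambda>_. 0), (\<lambda>_. 0)) \<in> U_space M"
    by (auto simp: U_space_def intro!: bdd_measurable_bochner_Linf bdd_measurable_zero)
  have "dual_objective M C1 C2 K J1 J2 e i l \<le> lagrangian M C1 C2 K J1 J2 e i x l"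
    unfolding dual_objective_def by (rule INF_lower[OF xX])
  also have "\<dots> \<le> ereal (U_pairing M ((\<lambda>_. 0), (\<lambda>_. 0)) l) + perturbed_objective M C1 C2 K J1 J2 e i x ((\<lambda>_. 0), (\<lambda>_. 0))"
    unfolding lagrangian_def by (rule INF_lower[OF u])
  also have "\<dots> = ereal (objective M J1 J2 x)"
    unfolding p by (simp add: U_pairing_def blinfun.zero_right)
  finally show "dual_objective M C1 C2 K J1 J2 e i l \<le> ereal (objective M J1 J2 x)" .
qed

lemma strictly_feasible_ball:
  fixes K :: "'r::{banach, second_countable_topology} set"
    and e :: "'x1::{banach, second_countable_topology} \<Rightarrow> 'x2::{banach, second_countable_topology} \<Rightarrow> 'a \<Rightarrow> 'w::{banach, second_countable_topology}"
  assumes "strictly_feasible M C1 C2 K J1 J2 e i"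
  obtains \<delta> where "\<delta> > 0"
    "\<And>ue ui. ue \<in> bdd_measurable M \<Longrightarrow> ui \<in> bdd_measurable M \<Longrightarrow>
      \<forall>w\<in>space M. norm (ue w) \<le> \<delta> \<and> norm (ui w) \<le> \<delta> \<Longrightarrow> (ue, ui) \<in> value_domain M C1 C2 K J1 J2 e i"
proof -
  obtain T where T: "openin (U_topology M) T" "((\<lambda>_. 0), (\<lambda>_. 0)) \<in> T" "T \<subseteq> value_domain M C1 C2 K J1 J2 e i"
    using assms unfolding strictly_feasible_def interior_of_def by blast
  obtain \<epsilon> where e: "\<epsilon> > 0" "\<forall>u'\<in>U_space M. U_dist M ((\<lambda>_. 0), (\<lambda>_. 0)) u' < ereal \<epsilon> \<longrightarrow> u' \<in> T"
    using T(1,2) unfolding openin_U_topology by blast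
  show ?thesis
  \<comment> \<open>The distance in \<open>U\<close> is the sum of two norms; two quarters of
    \<open>\<epsilon>\<close> stay strictly below \<open>\<epsilon>\<close>.\<close>
  proof (rule that[of "\<epsilon> / 4"])
    fix ue :: "'a \<Rightarrow> 'w" and ui :: "'a \<Rightarrow> 'r" assume m: "ue \<in> bdd_measurable M" "ui \<in> bdd_measurable M"
      and b: "\<forall>w\<in>space M. norm (ue w) \<le> \<epsilon> / 4 \<and> norm (ui w) \<le> \<epsilon> / 4"
    have "(ue, ui) \<in> U_space M" using m by (simp add: U_space_def bdd_measurable_bochner_Linf)
    moreover have "Linf_norm M ue + Linf_norm M ui \<le> ereal (\<epsilon> / 4) + ereal (\<epsilon> / 4)"
      using m b by (intro add_mono Linf_norm_le bdd_measurableD) auto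
    then have "U_dist M ((\<lambda>_. 0), (\<lambda>_. 0)) (ue, ui) < ereal \<epsilon>"
      using e(1) by (auto simp: U_dist_def intro: le_less_trans)
    ultimately have "(ue, ui) \<in> T" using e(2) by blast
    then show "(ue, ui) \<in> value_domain M C1 C2 K J1 J2 e i" using T(3) by blast
  qed (use e in auto)
qed

lemma bdd_measurable_Pair:
  assumes "f \<in> bdd_measurable M" "g \<in> bdd_measurable M"
  shows "(\<lambda>w. (f w, g w)) \<in> bdd_measurable M"
proof -
  obtain c d where "norm_le_on M f c" "norm_le_on M g d"
    using bdd_measurable_bound[OF assms(1)] bdd_measurable_bound[OF assms(2)] by metis
  then show ?thesis
    using assms by (intro bdd_measurableI[of _ _ "c + d"])
      (auto intro!: borel_measurable_Pair bdd_measurableD norm_Pair_le[THEN order_trans] add_mono)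
qed

lemma norm_fst_snd_le: "norm (fst p) \<le> norm p" "norm (snd p) \<le> norm p"
  by (cases p; simp add: norm_fst_le norm_snd_le)+

lemma bdd_measurable_fst_snd:
  assumes "u \<in> bdd_measurable M"
  shows "(\<lambda>w. fst (u w)) \<in> bdd_measurable M" "(\<lambda>w. snd (u w)) \<in> bdd_measurable M"
proof -
  obtain c where "norm_le_on M u c" using bdd_measurable_bound[OF assms] by metis
  moreover have "(\<lambda>w. fst (u w)) \<in> borel_measurable M" "(\<lambda>w. snd (u w)) \<in> borel_measurable M"
    using bdd_measurableD[OF assms] by (auto simp: borel_prod[symmetric])
  ultimately show "(\<lambda>w. fst (u w)) \<in> bdd_measurable M" "(\<lambda>w. snd (u w)) \<in> bdd_measurable M"
    by (auto intro!: bdd_measurableI[of _ _ c] intro: order_trans[OF norm_fst_snd_le(1)] order_trans[OF norm_fst_snd_le(2)])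
qed

lemma zero_bochner_L1: "(\<lambda>_. 0) \<in> bochner_L1 M"
  by (auto simp: bochner_L1_def strongly_measurable_def intro!: exI[of _ "\<lambda>_ _. 0"])

lemma bochner_L1_blinfun:
  fixes F :: "'a \<Rightarrow> 'z::{real_normed_vector, second_countable_topology} \<Rightarrow>\<^sub>L real"
  assumes "reflexive_space TYPE('z)" and F: "\<And>z. (\<lambda>w. blinfun_apply (F w) z) \<in> borel_measurable M"
    and g: "integrable M g" "\<And>w. norm (F w) \<le> g w"
  shows "F \<in> bochner_L1 M"
proof -
  have "integrable M (\<lambda>w. norm (F w))"
  proof (rule Bochner_Integration.integrable_bound[OF g(1) borel_measurable_norm_blinfun[OF F]])
    show "AE w in M. norm (norm (F w)) \<le> norm (g w)" using g(2) by (intro AE_I2) (simp add: order_trans[OF g(2) abs_ge_self])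
  qed
  then show ?thesis using strongly_measurable_blinfun[OF assms(1) F] by (simp add: bochner_L1_def)
qed

theorem theorem3p8:
  fixes M :: "'a measure"
    and C1 :: "'x1::{banach, second_countable_topology} set"
    and C2 :: "'x2::{banach, second_countable_topology} set"
    and K :: "'r::{banach, second_countable_topology} set"
    and J1 :: "'x1 \<Rightarrow> real"
    and J2 :: "'x1 \<Rightarrow> 'x2 \<Rightarrow> real"
    and e :: "'x1 \<Rightarrow> 'x2 \<Rightarrow> 'a \<Rightarrow> 'w::{banach, second_countable_topology}"
    and i :: "'x1 \<Rightarrow> 'x2 \<Rightarrow> 'a \<Rightarrow> 'r"
  assumes "prob_space M" and "complete_measure M"
    and "reflexive_space TYPE('x1)" and "reflexive_space TYPE('x2)"
    and "reflexive_space TYPE('w)" and "reflexive_space TYPE('r)"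
    and "basic_assumption M C1 C2 K J1 J2 e i"
    and relatively_complete_recourse: "C1 \<subseteq> induced_feasible_set M C2 K e i"
    and "strictly_feasible M C1 C2 K J1 J2 e i"
  shows "inf_P M C1 C2 K J1 J2 e i < \<infinity> \<and>
    (\<exists>l\<in>Lambda_space M.
      dual_objective M C1 C2 K J1 J2 e i l = inf_P M C1 C2 K J1 J2 e i \<and>
      (\<forall>l'\<in>Lambda_space M.
        dual_objective M C1 C2 K J1 J2 e i l' \<le> dual_objective M C1 C2 K J1 J2 e i l))"
proof -
  interpret prob_space M by fact
  let ?inf = "inf_P M C1 C2 K J1 J2 e i"
  let ?dual = "dual_objective M C1 C2 K J1 J2 e i"
  define G where "G = constraint_graph C1 C2 K e i"
  obtain \<delta> where d: "\<delta> > 0"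
    "\<And>ue ui. ue \<in> bdd_measurable M \<Longrightarrow> ui \<in> bdd_measurable M \<Longrightarrow>
      \<forall>w\<in>space M. norm (ue w) \<le> \<delta> \<and> norm (ui w) \<le> \<delta> \<Longrightarrow> (ue, ui) \<in> value_domain M C1 C2 K J1 J2 e i"
    using strictly_feasible_ball[OF assms(9)] by metis
  have ball: "\<exists>x1 x2. admissible M G x1 x2 u"
    if u: "u \<in> bdd_measurable M" "norm_le_on M u \<delta>" for u
  proof -
    have "((\<lambda>w. fst (u w)), (\<lambda>w. snd (u w))) \<in> value_domain M C1 C2 K J1 J2 e i"
      using u bdd_measurable_fst_snd[OF u(1)]
      by (intro d(2)) (auto intro: order_trans[OF norm_fst_snd_le(1)] order_trans[OF norm_fst_snd_le(2)])
    then obtain x1 x2 where x: "x2 \<in> bdd_measurable M" "x1 \<in> C1"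
      "AE w in M. x2 w \<in> C2 \<and> e x1 (x2 w) w = fst (u w) \<and> cone_le K (i x1 (x2 w) w) (snd (u w))"
      by (rule value_domainE) auto
    have "AE w in M. (x1, x2 w, u w) \<in> G w"
      using x(3) by eventually_elim (auto simp: G_def constraint_graph_def x(2) case_prod_unfold)
    then show ?thesis using x(1) unfolding admissible_def by blast
  qed
  have feasible: "(x1, x2) \<in> feasible_set M C1 C2 K e i" if x: "admissible M G x1 x2 (\<lambda>_. 0)" for x1 x2
  proof -
    have x2: "x2 \<in> bdd_measurable M" and ae: "AE w in M. (x1, x2 w, 0) \<in> G w"
      using x by (simp_all add: admissible_def)
    \<comment> \<open>A condition free of \<open>w\<close> that holds almost everywhere holds
      outright, because the measure is a probability.\<close>
    have "AE w in M. x1 \<in> C1" using ae by eventually_elim (auto simp: G_def constraint_graph_def)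
    moreover have "AE w in M. x2 w \<in> C2 \<and> e x1 (x2 w) w = 0 \<and> cone_le K (i x1 (x2 w) w) 0"
      using ae by eventually_elim (auto simp: G_def constraint_graph_def zero_prod_def)
    ultimately show ?thesis
      using bdd_measurable_bochner_Linf[OF x2] by (auto simp: feasible_set_def X_space_def)
  qed
  have finite: "?inf < \<infinity>"
  proof -
    obtain x1 x2 where "admissible M G x1 x2 (\<lambda>_. 0)"
      using ball[of "\<lambda>_. 0"] bdd_measurable_zero d(1) by auto
    from feasible[OF this] have "?inf \<le> ereal (objective M J1 J2 (x1, x2))"
      unfolding inf_P_def by (rule INF_lower)
    then show ?thesis by (rule le_less_trans) simp
  qed
  have "\<exists>l\<in>Lambda_space M. ?inf \<le> ?dual l"
  \<comment> \<open>The abstract problem needs a real \<open>v0\<close>. If the infimum is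
    \<open>- \<infinity>\<close>, every multiplier is optimal by weak duality, and 0 is
    taken.\<close>
  proof (cases "?inf = - \<infinity>")
    case True
    have "((\<lambda>w. 0), (\<lambda>w. 0)) \<in> Lambda_space M" by (simp add: Lambda_space_def zero_bochner_L1)
    then show ?thesis using True by auto
  next
    case False
    then obtain v0 where v0: "?inf = ereal v0" using finite by (cases ?inf) auto
    interpret recourse_problem M G J1 J2 v0
    proof
      show "closed (G w)" if "w \<in> space M" for w
        unfolding G_def using assms(7) that
        by (intro closed_constraint_graph) (auto simp: basic_assumption_def)
      show "convex (G w)" if "w \<in> space M" for w
        unfolding G_def using assms(7) that
        by (intro convex_constraint_graph) (auto simp: basic_assumption_def)
      show "convex_on UNIV (\<lambda>(x1, x2). J1 x1 + J2 x1 x2)"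
        using assms(7) by (simp add: basic_assumption_def)
      show "\<exists>a>0. \<forall>x1 x2. norm x1 + norm x2 \<le> r \<longrightarrow> \<bar>J2 x1 x2\<bar> \<le> a" if "r > 0" for r
        using assms(7) that unfolding basic_assumption_def by blast
      show "\<exists>y. admissible M G x1 y (\<lambda>_. 0)" if x: "admissible M G x1 x2 u" for x1 x2 u
      proof -
        have "AE w in M. (x1, x2 w, u w) \<in> G w" using x by (simp add: admissible_def)
        then have "AE w in M. x1 \<in> C1" by eventually_elim (auto simp: G_def constraint_graph_def)
        then have x1: "x1 \<in> C1" by simp
        then obtain y where y: "y \<in> bochner_Linf M"
          "AE w in M. e x1 (y w) w = 0 \<and> cone_le K (i x1 (y w) w) 0 \<and> y w \<in> C2"
          using relatively_complete_recourse unfolding induced_feasible_set_def by blast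
        obtain y' where y': "y' \<in> bdd_measurable M" "AE w in M. y' w = y w"
          by (rule bochner_Linf_bounded_version[OF y(1)])
        have "AE w in M. (x1, y' w, 0) \<in> G w"
          using y(2) y'(2) by eventually_elim (auto simp: G_def constraint_graph_def zero_prod_def x1)
        then show ?thesis using y'(1) unfolding admissible_def by blast
      qed
      show "\<exists>\<delta>>0. \<forall>u\<in>bdd_measurable M. norm_le_on M u \<delta> \<longrightarrow> (\<exists>x1 x2. admissible M G x1 x2 u)"
        using d(1) ball by blast
      show "v0 \<le> expected_cost M J1 J2 x1 x2" if x: "admissible M G x1 x2 (\<lambda>_. 0)" for x1 x2
      proof -
        have "?inf \<le> ereal (objective M J1 J2 (x1, x2))"
          unfolding inf_P_def by (rule INF_lower[OF feasible[OF x]])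
        then show ?thesis by (simp add: v0 objective_def expected_cost_def)
      qed
    qed
    obtain \<Lambda> :: "'a \<Rightarrow> ('w \<times> 'r) \<Rightarrow>\<^sub>L real" and g where g: "integrable M g" "\<forall>w. norm (\<Lambda> w) \<le> g w"
      and \<Lambda>: "\<forall>z. (\<lambda>w. blinfun_apply (\<Lambda> w) z) \<in> borel_measurable M"
        "\<forall>x1 x2. \<forall>u\<in>bdd_measurable M. adm x1 x2 u \<longrightarrow>
          (\<integral>w. blinfun_apply (\<Lambda> w) (u w) \<partial>M) \<le> cost x1 x2 - v0"
      using ex_integrable_multiplier by (elim exE conjE)
    have \<Lambda>m: "(\<lambda>w. blinfun_apply (\<Lambda> w) z) \<in> borel_measurable M" for z using \<Lambda>(1) by blast
    \<comment> \<open>Composition with the embeddings of the two factors splits a multiplier on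
      \<open>'w \<times> 'r\<close> into its components.\<close>
    define Iw :: "'w \<Rightarrow>\<^sub>L ('w \<times> 'r)" where "Iw = Blinfun (\<lambda>z. (z, 0))"
    define Ir :: "'r \<Rightarrow>\<^sub>L ('w \<times> 'r)" where "Ir = Blinfun (\<lambda>z. (0, z))"
    have Iw: "blinfun_apply Iw z = (z, 0)" for z
      unfolding Iw_def by (subst bounded_linear_Blinfun_apply) (auto intro!: bounded_linear_intros)
    have Ir: "blinfun_apply Ir z = (0, z)" for z
      unfolding Ir_def by (subst bounded_linear_Blinfun_apply) (auto intro!: bounded_linear_intros)
    \<comment> \<open>The sign turns the minorant inequality into the form of the Lagrangian, where
      the pairing is added to the perturbed objective.\<close>
    define le where "le w = - (\<Lambda> w o\<^sub>L Iw)" for w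
    define li where "li w = - (\<Lambda> w o\<^sub>L Ir)" for w
    have le_apply: "blinfun_apply (le w) z = - blinfun_apply (\<Lambda> w) (z, 0)" for w z
      by (simp add: le_def blinfun.minus_left Iw)
    have li_apply: "blinfun_apply (li w) z = - blinfun_apply (\<Lambda> w) (0, z)" for w z
      by (simp add: li_def blinfun.minus_left Ir)
    have "le \<in> bochner_L1 M"
    proof (rule bochner_L1_blinfun[OF assms(5)])
      show "(\<lambda>w. blinfun_apply (le w) z) \<in> borel_measurable M" for z
        unfolding le_apply using \<Lambda>m by simp
      show "integrable M (\<lambda>w. g w * norm Iw)" using g(1) by simp
      show "norm (le w) \<le> g w * norm Iw" for w
        using norm_blinfun_compose[of "\<Lambda> w" Iw] mult_right_mono[of "norm (\<Lambda> w)" "g w" "norm Iw"] g(2)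
        by (simp add: le_def)
    qed
    moreover have "li \<in> bochner_L1 M"
    proof (rule bochner_L1_blinfun[OF assms(6)])
      show "(\<lambda>w. blinfun_apply (li w) z) \<in> borel_measurable M" for z
        unfolding li_apply using \<Lambda>m by simp
      show "integrable M (\<lambda>w. g w * norm Ir)" using g(1) by simp
      show "norm (li w) \<le> g w * norm Ir" for w
        using norm_blinfun_compose[of "\<Lambda> w" Ir] mult_right_mono[of "norm (\<Lambda> w)" "g w" "norm Ir"] g(2)
        by (simp add: li_def)
    qed
    ultimately have lam: "(le, li) \<in> Lambda_space M" by (simp add: Lambda_space_def)
    have pairing: "U_pairing M u (le, li) = - (\<integral>w. blinfun_apply (\<Lambda> w) (fst u w, snd u w) \<partial>M)" for u
    proof -
      have "blinfun_apply (le w) (fst u w) + blinfun_apply (li w) (snd u w) =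
          - blinfun_apply (\<Lambda> w) (fst u w, snd u w)" for w
        unfolding le_apply li_apply using blinfun.add_right[of "\<Lambda> w" "(fst u w, 0)" "(0, snd u w)"] by simp
      then show ?thesis by (simp add: U_pairing_def)
    qed
    have "?inf \<le> ?dual (le, li)"
      unfolding dual_objective_def lagrangian_def
    proof (intro INF_greatest)
      fix x :: "'x1 \<times> ('a \<Rightarrow> 'x2)" and u :: "('a \<Rightarrow> 'w) \<times> ('a \<Rightarrow> 'r)"
      assume x: "x \<in> X_space M" and u: "u \<in> U_space M"
      show "?inf \<le> ereal (U_pairing M u (le, li)) + perturbed_objective M C1 C2 K J1 J2 e i x u"
      proof (cases "fst x \<in> C1 \<and> (AE w in M. snd x w \<in> C2 \<and> e (fst x) (snd x w) w = fst u w \<and>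
          cone_le K (i (fst x) (snd x w) w) (snd u w))")
        case False
        then have "perturbed_objective M C1 C2 K J1 J2 e i x u = \<infinity>" unfolding perturbed_objective_def by (rule if_not_P)
        then show ?thesis by simp
      next
        case True
        have xm: "snd x \<in> bochner_Linf M" and um: "fst u \<in> bochner_Linf M" "snd u \<in> bochner_Linf M"
          using x u by (auto simp: X_space_def U_space_def)
        \<comment> \<open>The second stage and both perturbations are replaced by representatives
          bounded everywhere, to which the multiplier inequality applies; cost and pairing do not
          change.\<close>
        obtain x2 where x2: "x2 \<in> bdd_measurable M" "AE w in M. x2 w = snd x w"
          by (rule bochner_Linf_bounded_version[OF xm])
        obtain ue where ue: "ue \<in> bdd_measurable M" "AE w in M. ue w = fst u w"
          by (rule bochner_Linf_bounded_version[OF um(1)])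
        obtain ui where ui: "ui \<in> bdd_measurable M" "AE w in M. ui w = snd u w"
          by (rule bochner_Linf_bounded_version[OF um(2)])
        have ad: "adm (fst x) x2 (\<lambda>w. (ue w, ui w))"
        proof -
          have "AE w in M. (fst x, x2 w, ue w, ui w) \<in> G w"
            using conjunct2[OF True] x2(2) ue(2) ui(2)
            by eventually_elim (simp add: G_def constraint_graph_def conjunct1[OF True])
          then show ?thesis using x2(1) by (simp add: admissible_def)
        qed
        have c: "cost (fst x) x2 = objective M J1 J2 x"
        proof -
          have "(\<integral>w. J2 (fst x) (x2 w) \<partial>M) = (\<integral>w. J2 (fst x) (snd x w) \<partial>M)"
          proof (rule integral_cong_AE)
            show "(\<lambda>w. J2 (fst x) (x2 w)) \<in> borel_measurable M"
              by (rule measurable_J2[OF bdd_measurableD[OF x2(1)]])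
            show "(\<lambda>w. J2 (fst x) (snd x w)) \<in> borel_measurable M"
              using xm by (intro measurable_J2) (simp add: bochner_Linf_def)
            show "AE w in M. J2 (fst x) (x2 w) = J2 (fst x) (snd x w)"
              using x2(2) by eventually_elim simp
          qed
          then show ?thesis by (simp add: expected_cost_def objective_def)
        qed
        have p: "(\<integral>w. blinfun_apply (\<Lambda> w) (ue w, ui w) \<partial>M) = (\<integral>w. blinfun_apply (\<Lambda> w) (fst u w, snd u w) \<partial>M)"
        proof (rule integral_cong_AE)
          show "(\<lambda>w. blinfun_apply (\<Lambda> w) (ue w, ui w)) \<in> borel_measurable M"
            by (rule borel_measurable_blinfun_apply[OF \<Lambda>m bdd_measurableD[OF bdd_measurable_Pair[OF ue(1) ui(1)]]])
          have "(\<lambda>w. (fst u w, snd u w)) \<in> borel_measurable M"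
            using um by (intro borel_measurable_Pair) (simp_all add: bochner_Linf_def)
          then show "(\<lambda>w. blinfun_apply (\<Lambda> w) (fst u w, snd u w)) \<in> borel_measurable M"
            by (rule borel_measurable_blinfun_apply[OF \<Lambda>m])
          show "AE w in M. blinfun_apply (\<Lambda> w) (ue w, ui w) = blinfun_apply (\<Lambda> w) (fst u w, snd u w)"
            using ue(2) ui(2) by eventually_elim simp
        qed
        have "(\<integral>w. blinfun_apply (\<Lambda> w) (ue w, ui w) \<partial>M) \<le> cost (fst x) x2 - v0"
          using \<Lambda>(2) ad bdd_measurable_Pair[OF ue(1) ui(1)] by blast
        then have "v0 \<le> U_pairing M u (le, li) + objective M J1 J2 x"
          unfolding pairing c p by simp
        moreover have "perturbed_objective M C1 C2 K J1 J2 e i x u = ereal (objective M J1 J2 x)"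
          using True unfolding perturbed_objective_def by (rule if_P)
        ultimately show ?thesis by (simp add: v0)
      qed
    qed
    then show ?thesis using lam by blast
  qed
  then obtain l where l: "l \<in> Lambda_space M" "?inf \<le> ?dual l" by blast
  have "?dual l = ?inf" using l(2) by (intro antisym dual_objective_le_inf_P)
  then show ?thesis
    using finite l(1) dual_objective_le_inf_P by (intro conjI bexI[of _ l]) auto
qed

end
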